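(* Let $\mathfrak g$ be one of the Lie superalgebras $\mathfrak{gl}(m,n)$, $\mathfrak{osp}(2m+1,2n)$, $\mathfrak{osp}(2m,2n)$ over an algebraically closed field $\mathtt k$ of characteristic zero, and let $I(\mathfrak h)\subseteq S(\mathfrak h)$ be the associated algebra described in the context. If $\mathfrak m$ is any maximal ideal of $I(\mathfrak h)$, then there is a $\lambda\in\mathfrak h^*$ such that $$\mathfrak m=\{f\in I(\mathfrak h): f(\lambda)=0\}.$$
   Context: Let $m,n\ge0$ be integers. The Cartan subalgebra $\mathfrak h$ of $\mathfrak g$ has basis $h_1,\dots,h_m,h'_1,\dots,h'_n$, dual to the basis $\epsilon_1,\dots,\epsilon_m,\delta_1,\dots,\delta_n$ of $\mathfrak h^*$, and $S(\mathfrak h)=\mathtt k[h_1,\dots,h_m,h'_1,\dots,h'_n]$ is regarded as the algebra of polynomial functions on $\mathfrak h^*\cong\mathtt k^{m+n}$. $I(\mathfrak h)$ is the image of the center $Z(\mathfrak g)$ of the enveloping algebra $U(\mathfrak g)$ under the (injective) Harish-Chandra map; explicitly it is the following subalgebra of $S(\mathfrak h)$. (a) If $\mathfrak g=\mathfrak{gl}(m,n)$, $I(\mathfrak h)$ is the algebra of supersymmetric polynomials in $h_1,\dots,h_m$ and $h'_1,\dots,h'_n$: all polynomials $f$, symmetric in the $h_i$ and symmetric in the $h'_j$ separately, such that the substitution $h_1=t$, $h'_1=-t$ gives a polynomial independent of $t$. (b) If $\mathfrak g=\mathfrak{osp}(2m+1,2n)$, $I(\mathfrak h)=J(\mathfrak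 h)$, where $J(\mathfrak h)$ is the algebra of all $f\in\mathtt k[h_1^2,\dots,h_m^2,h_1'^{2},\dots,h_n'^{2}]$, symmetric in the $h_i^2$ and symmetric in the $h_j'^2$ separately, such that the substitution $h_1^2=h_1'^2=t$ gives a polynomial independent of $t$. (c) If $\mathfrak g=\mathfrak{osp}(2m,2n)$, $I(\mathfrak h)=J(\mathfrak h)+\Phi S(\mathfrak h)^{W'}$, where $J(\mathfrak h)$ is as in (b), $\Phi=h_1\cdots h_m\prod_{i,j}(h_i^2-h_j'^2)$, and $W'=(\mathbb Z_2^m\rtimes\mathcal S_m)\times(\mathbb Z_2^n\rtimes\mathcal S_n)$ acts on $S(\mathfrak h)$ with $\mathcal S_m,\mathcal S_n$ permuting the $h_i$ and the $h'_j$ respectively, and $\mathbb Z_2^m,\mathbb Z_2^n$ changing their signs. In all cases, when $mn=0$ the substitution condition is vacuous. *)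

theory Defs
  imports
    "HOL-Library.Poly_Mapping"
    "HOL-Library.FuncSet"
    "HOL-Combinatorics.Permutations"
    "HOL-Algebra.Ideal"
    "HOL-Algebra.Algebraic_Closure_Type"
begin

section \<open>Multivariate polynomials\<close>

type_synonym ('v, 'a) mpoly = "('v \<Rightarrow>\<^sub>0 nat) \<Rightarrow>\<^sub>0 'a"

definition Const :: "'a \<Rightarrow> ('v, 'a::comm_ring_1) mpoly" where
  "Const c = Poly_Mapping.single 0 c"

definition Var :: "'v \<Rightarrow> ('v, 'a::comm_ring_1) mpoly" where
  "Var v = Poly_Mapping.single (Poly_Mapping.single v 1) 1"

text \<open>The homomorphism that sends a coefficient \<open>c\<close> to \<open>\<phi> c\<close> and a variable \<open>v\<close> to \<open>x v\<close>.\<close>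

definition mp_eval :: "('a::comm_ring_1 \<Rightarrow> 'r::comm_ring_1) \<Rightarrow> ('v \<Rightarrow> 'r) \<Rightarrow> ('v, 'a) mpoly \<Rightarrow> 'r" where
  "mp_eval \<phi> x p =
     (\<Sum>e\<in>Poly_Mapping.keys p. \<phi> (Poly_Mapping.lookup p e) *
        (\<Prod>v\<in>Poly_Mapping.keys e. x v ^ Poly_Mapping.lookup e v))"

abbreviation mp_value :: "('v, 'a::comm_ring_1) mpoly \<Rightarrow> ('v \<Rightarrow> 'a) \<Rightarrow> 'a" where
  "mp_value p x \<equiv> mp_eval (\<lambda>c. c) x p"

abbreviation mp_subst :: "('v \<Rightarrow> ('w, 'a) mpoly) \<Rightarrow> ('v, 'a::comm_ring_1) mpoly \<Rightarrow> ('w, 'a) mpoly" where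
  "mp_subst \<equiv> mp_eval Const"

section \<open>The algebras \<open>S(h)\<close> and \<open>I(h)\<close>\<close>

text \<open>\<open>H i\<close> is $h_i$ and \<open>H' j\<close> is $h'_j$; indices start at 1.\<close>

datatype hvar = H nat | H' nat

definition hvars :: "nat \<Rightarrow> nat \<Rightarrow> hvar set" where
  "hvars m n = H ` {1..m} \<union> H' ` {1..n}"

definition S_h :: "nat \<Rightarrow> nat \<Rightarrow> (hvar, 'k::comm_ring_1) mpoly set" where
  "S_h m n = {f. \<forall>e\<in>Poly_Mapping.keys f. Poly_Mapping.keys e \<subseteq> hvars m n}"

text \<open>An element of the dual of the Cartan subalgebra is given by its coordinates with respect to
  \<open>\<epsilon>\<^sub>1, \<dots>, \<epsilon>\<^sub>m, \<delta>\<^sub>1, \<dots>, \<delta>\<^sub>n\<close>, i.e. by its values on the $h_i$ and $h'_j$.\<close>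

definition dual_cartan :: "nat \<Rightarrow> nat \<Rightarrow> (hvar \<Rightarrow> 'k) set" where
  "dual_cartan m n = hvars m n \<rightarrow>\<^sub>E UNIV"

fun permute_vars :: "(nat \<Rightarrow> nat) \<Rightarrow> (nat \<Rightarrow> nat) \<Rightarrow> hvar \<Rightarrow> (hvar, 'k::comm_ring_1) mpoly" where
  "permute_vars \<sigma> \<tau> (H i) = Var (H (\<sigma> i))"
| "permute_vars \<sigma> \<tau> (H' j) = Var (H' (\<tau> j))"

definition separately_symmetric :: "nat \<Rightarrow> nat \<Rightarrow> (hvar, 'k::comm_ring_1) mpoly \<Rightarrow> bool" where
  "separately_symmetric m n f \<longleftrightarrow>
     (\<forall>\<sigma>. \<sigma> permutes {1..m} \<longrightarrow> mp_subst (permute_vars \<sigma> id) f = f) \<and>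
     (\<forall>\<tau>. \<tau> permutes {1..n} \<longrightarrow> mp_subst (permute_vars id \<tau>) f = f)"

text \<open>The substitution \<open>h\<^sub>1 = t\<close>, \<open>h'\<^sub>1 = c t\<close>; the result is a univariate polynomial in \<open>t\<close>
  whose coefficients are polynomials in the remaining variables.\<close>

definition subst_t :: "'k \<Rightarrow> (hvar, 'k::comm_ring_1) mpoly \<Rightarrow> (hvar, 'k) mpoly poly" where
  "subst_t c f =
     mp_eval (\<lambda>a. [:Const a:])
       (\<lambda>v. if v = H 1 then [:0, 1:] else if v = H' 1 then [:0, Const c:] else [:Var v:]) f"

definition subst_indep :: "nat \<Rightarrow> nat \<Rightarrow> 'k \<Rightarrow> (hvar, 'k::comm_ring_1) mpoly \<Rightarrow> bool" where
  "subst_indep m n c f \<longleftrightarrow> (m \<ge> 1 \<and> n \<ge> 1 \<longrightarrow> Polynomial.degree (subst_t c f) = 0)"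

definition I_gl :: "nat \<Rightarrow> nat \<Rightarrow> (hvar, 'k::comm_ring_1) mpoly set" where
  "I_gl m n = {f \<in> S_h m n. separately_symmetric m n f \<and> subst_indep m n (-1) f}"

text \<open>Elements of \<open>J_h\<close> are polynomials \<open>g\<close> in the squares of the variables; symmetry and the
  substitution condition are conditions on \<open>g\<close>.\<close>

definition J_h :: "nat \<Rightarrow> nat \<Rightarrow> (hvar, 'k::comm_ring_1) mpoly set" where
  "J_h m n = mp_subst (\<lambda>v. Var v ^ 2) `
     {g \<in> S_h m n. separately_symmetric m n g \<and> subst_indep m n 1 g}"

definition \<Phi> :: "nat \<Rightarrow> nat \<Rightarrow> (hvar, 'k::comm_ring_1) mpoly" where
  "\<Phi> m n = (\<Prod>i=1..m. Var (H i)) * (\<Prod>i=1..m. \<Prod>j=1..n. Var (H i) ^ 2 - Var (H' j) ^ 2)"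

text \<open>The action of a general element of \<open>W'\<close>, given by permutations \<open>\<sigma>\<close>, \<open>\<tau>\<close> and signs \<open>s\<close>.\<close>

definition W'_invariants :: "nat \<Rightarrow> nat \<Rightarrow> (hvar, 'k::comm_ring_1) mpoly set" where
  "W'_invariants m n =
     {f \<in> S_h m n. \<forall>\<sigma> \<tau> s. \<sigma> permutes {1..m} \<longrightarrow> \<tau> permutes {1..n} \<longrightarrow> (\<forall>v. s v \<in> {1, -1}) \<longrightarrow>
        mp_subst (\<lambda>v. Const (s v) * permute_vars \<sigma> \<tau> v) f = f}"

definition I_osp_even :: "nat \<Rightarrow> nat \<Rightarrow> (hvar, 'k::comm_ring_1) mpoly set" where
  "I_osp_even m n = {f + \<Phi> m n * g | f g. f \<in> J_h m n \<and> g \<in> W'_invariants m n}"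

text \<open>For parameters \<open>m\<close>, \<open>n\<close> these stand for $gl(m,n)$, $osp(2m+1,2n)$ and $osp(2m,2n)$.\<close>

datatype superalgebra_type = GL | OSP_odd | OSP_even

fun I_h :: "superalgebra_type \<Rightarrow> nat \<Rightarrow> nat \<Rightarrow> (hvar, 'k::comm_ring_1) mpoly set" where
  "I_h GL m n = I_gl m n"
| "I_h OSP_odd m n = J_h m n"
| "I_h OSP_even m n = I_osp_even m n"

definition I_ring :: "superalgebra_type \<Rightarrow> nat \<Rightarrow> nat \<Rightarrow> (hvar, 'k::comm_ring_1) mpoly ring" where
  "I_ring \<gg> m n = ring_of_type_algebra \<lparr>carrier := I_h \<gg> m n\<rparr>"

end

(*
  A maximal ideal M of I(h) is the vanishing ideal of a point as soon as its elements have a common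
  zero.  Over an infinite field polynomials may be replaced by polynomial functions, so let N be an
  ideal of the algebra I of supersymmetric functions in x_1..x_m, y_1..y_n (signs normalised so that
  x_i = y_j = t is independent of t) without common zero.  By the Nullstellensatz 1 is a combination
  of elements of N with polynomial coefficients, which averaging over the symmetric groups makes
  symmetric; multiplying by Q = prod (x_i - y_j) turns them into elements of I.  Hence N contains all
  symmetric multiples of Q.  These form the kernel of the restriction rho to x_m = y_n = 0, and rho
  maps I onto the corresponding algebra with m-1 and n-1 variables, so induction gives 1 in N.

  Surjectivity of rho: the Lagrange-type symmetrisation E (lift_sum) in the opposite direction
  satisfies rho E = 1 + E rho, and rho is nilpotent; in characteristic zero this forces
  rho to be onto.

  J(h) is the same algebra in the squares of the variables.  For osp(2m,2n) the norm
  (f + Phi g)(f - Phi g) lies in J(h), which transfers the common zero from J(h) to I(h), possibly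
  after changing the sign of one coordinate.
*)
theory Submission
  imports Defs "HOL-Library.Function_Algebras"
begin

section \<open>Polynomial functions\<close>

text \<open>The lift E is a rational expression. Its denominators come from Lagrange interpolation
  in each block of variables, and its numerators are chosen so that on x_p = y_q = t the unwanted
  terms vanish and t cancels from the others. Its identities are therefore proved first where the
  coordinates within each block are distinct and are then carried to all points by density. For this
  reason, and because permutation, restriction and change of sign are operations on points, the
  algebras are handled as sets of functions rather than of formal polynomials.\<close>

inductive_set polyfun :: "'v set \<Rightarrow> (('v \<Rightarrow> 'a::comm_ring_1) \<Rightarrow> 'a) set" for V where
  const: "(\<lambda>z. c) \<in> polyfun V"
| var: "v \<in> V \<Longrightarrow> (\<lambda>z. z v) \<in> polyfun V"
| add: "f \<in> polyfun V \<Longrightarrow> g \<in> polyfun V \<Longrightarrow> (\<lambda>z. f z + g z) \<in> polyfun V"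
| mult: "f \<in> polyfun V \<Longrightarrow> g \<in> polyfun V \<Longrightarrow> (\<lambda>z. f z * g z) \<in> polyfun V"

lemma polyfun_uminus: "f \<in> polyfun V \<Longrightarrow> (\<lambda>z. - f z) \<in> polyfun V"
  using polyfun.mult[OF polyfun.const[of "-1"], of f V] by simp

lemma polyfun_diff: "f \<in> polyfun V \<Longrightarrow> g \<in> polyfun V \<Longrightarrow> (\<lambda>z. f z - g z) \<in> polyfun V"
  using polyfun.add[of f V "\<lambda>z. - g z"] by (simp add: polyfun_uminus)

lemma polyfun_sum:
  "(\<And>i. i \<in> I \<Longrightarrow> f i \<in> polyfun V) \<Longrightarrow> (\<lambda>z. \<Sum>i\<in>I. f i z) \<in> polyfun V"
  by (induction I rule: infinite_finite_induct) (auto simp: polyfun.const[of 0] polyfun.add)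

lemma polyfun_prod:
  "(\<And>i. i \<in> I \<Longrightarrow> f i \<in> polyfun V) \<Longrightarrow> (\<lambda>z. \<Prod>i\<in>I. f i z) \<in> polyfun V"
  by (induction I rule: infinite_finite_induct) (auto simp: polyfun.const[of 1] polyfun.mult)

lemma polyfun_power: "f \<in> polyfun V \<Longrightarrow> (\<lambda>z. f z ^ n) \<in> polyfun V"
  by (induction n) (auto intro: polyfun.intros)

lemmas polyfun_intros =
  polyfun.intros polyfun_uminus polyfun_diff polyfun_sum polyfun_prod polyfun_power

lemma polyfun_mono:
  assumes "f \<in> polyfun V" "V \<subseteq> W" shows "f \<in> polyfun W"
  using assms by (induction rule: polyfun.induct) (auto intro: polyfun.intros)

lemma polyfun_cong:
  assumes "f \<in> polyfun V" "\<And>v. v \<in> V \<Longrightarrow> z v = z' v" shows "f z = f z'"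
  using assms by (induction rule: polyfun.induct) auto

lemma polyfun_subst:
  assumes "f \<in> polyfun V" "\<And>v. v \<in> V \<Longrightarrow> (\<lambda>z. s z v) \<in> polyfun W"
  shows "(\<lambda>z. f (s z)) \<in> polyfun W"
  using assms by (induction rule: polyfun.induct) (auto intro: polyfun.intros)

lemma polyfun_merge:
  assumes "f \<in> polyfun V" "v \<in> V"
  shows "(\<lambda>z. f (z(u := z v))) \<in> polyfun V"
proof (rule polyfun_subst[OF assms(1)])
  show "(\<lambda>z. (z(u := z v)) w) \<in> polyfun V" if "w \<in> V" for w
    using assms(2) that by (cases "w = u") (auto intro: polyfun.var)
qed

text \<open>Reduction to one variable: it makes the finiteness of the roots of a univariate
  polynomial available, along lines and later along the diagonal
  \<open>z p = z q = t\<close>.\<close>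

lemma polyfun_along_curve:
  assumes "f \<in> polyfun V" "\<And>v. v \<in> V \<Longrightarrow> \<exists>p. \<forall>t. l t v = poly p t"
  shows "\<exists>p. \<forall>t. f (l t) = poly p t"
  using assms
proof (induction rule: polyfun.induct)
  case (const c)
  show ?case by (rule exI[of _ "[:c:]"]) simp
next
  case (add f g)
  then obtain p q where "\<forall>t. f (l t) = poly p t" "\<forall>t. g (l t) = poly q t" by blast
  then show ?case by (intro exI[of _ "p + q"]) simp
next
  case (mult f g)
  then obtain p q where "\<forall>t. f (l t) = poly p t" "\<forall>t. g (l t) = poly q t" by blast
  then show ?case by (intro exI[of _ "p * q"]) simp
qed auto

text \<open>On the line from \<open>z\<close> to \<open>z0\<close> the product of \<open>f\<close>
  and \<open>d\<close> is a univariate polynomial that vanishes for every \<open>t\<close>, hence is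
  zero over an infinite field. If \<open>f z\<close> were nonzero, neither factor would be zero:
  \<open>f\<close> is nonzero at \<open>t = 0\<close> and \<open>d\<close> at
  \<open>t = 1\<close>.\<close>

lemma polyfun_density:
  fixes f d :: "('v \<Rightarrow> 'a::field_char_0) \<Rightarrow> 'a"
  assumes "f \<in> polyfun V" "d \<in> polyfun W" "d z0 \<noteq> 0" and eq: "\<And>z. d z \<noteq> 0 \<Longrightarrow> f z = 0"
  shows "f z = 0"
proof (rule ccontr)
  assume nz: "f z \<noteq> 0"
  define l where "l t v = z v + t * (z0 v - z v)" for t v
  have l: "\<exists>p. \<forall>t. l t v = poly p t" for v
    by (rule exI[of _ "[:z v, z0 v - z v:]"]) (simp add: l_def)
  obtain p where p: "\<And>t. f (l t) = poly p t"
    using polyfun_along_curve[OF assms(1), of l] l by blast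
  obtain q where q: "\<And>t. d (l t) = poly q t"
    using polyfun_along_curve[OF assms(2), of l] l by blast
  have "l 0 = z" "l 1 = z0" by (auto simp: l_def)
  then have "p \<noteq> 0" "q \<noteq> 0" using p[of 0] q[of 1] nz assms(3) by auto
  then have "p * q \<noteq> 0" by simp
  moreover have "poly (p * q) t = 0" for t
    using eq[of "l t"] p[of t] q[of t] by auto
  ultimately show False using poly_all_0_iff_0 by blast
qed

lemma polyfun_mult_eq_0:
  fixes f d :: "('v \<Rightarrow> 'a::field_char_0) \<Rightarrow> 'a"
  assumes "f \<in> polyfun V" "d \<in> polyfun W" "d z0 \<noteq> 0" "\<And>z. d z * f z = 0"
  shows "f z = 0"
  using polyfun_density[OF assms(1-3)] assms(4) by fastforce

lemma polyfun_prod_nonzero: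
  fixes f :: "'i \<Rightarrow> ('v \<Rightarrow> 'a::field_char_0) \<Rightarrow> 'a"
  assumes "finite I" "\<And>i. i \<in> I \<Longrightarrow> f i \<in> polyfun V" "\<And>i. i \<in> I \<Longrightarrow> \<exists>z. f i z \<noteq> 0"
  shows "\<exists>z. (\<Prod>i\<in>I. f i z) \<noteq> 0"
  using assms
proof (induction I)
  case (insert i I)
  then obtain z1 where z1: "f i z1 \<noteq> 0" by blast
  obtain z2 where z2: "(\<Prod>i\<in>I. f i z2) \<noteq> 0" using insert by auto
  show ?case
  proof (rule ccontr)
    assume "\<not> ?thesis"
    then have "f i z * (\<Prod>i\<in>I. f i z) = 0" for z using insert.hyps by auto
    moreover have "(\<lambda>z. \<Prod>i\<in>I. f i z) \<in> polyfun V" using insert.prems by (intro polyfun_prod) simp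
    ultimately have "(\<Prod>i\<in>I. f i z2) = 0"
      using polyfun_mult_eq_0[of "\<lambda>z. \<Prod>i\<in>I. f i z" V "f i" V z1] insert.prems z1 by blast
    with z2 show False by simp
  qed
qed auto

section \<open>Divisibility by products of coordinate differences\<close>

lemma polyfun_hyperplane:
  assumes "f \<in> polyfun V" "v \<in> V"
  shows "\<exists>g\<in>polyfun V. \<forall>z. f z - f (z(u := z v)) = (z u - z v) * g z"
  using assms
proof (induction rule: polyfun.induct)
  case (const c)
  show ?case by (rule bexI[of _ "\<lambda>_. 0"]) (auto intro: polyfun.const)
next
  case (var w)
  show ?case
  proof (cases "w = u")
    case True then show ?thesis by (intro bexI[of _ "\<lambda>_. 1"]) (auto intro: polyfun.const)
  next
    case False then show ?thesis by (intro bexI[of _ "\<lambda>_. 0"]) (auto intro: polyfun.const)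
  qed
next
  case (add f1 f2)
  then obtain g1 g2 where g: "g1 \<in> polyfun V" "g2 \<in> polyfun V"
    "\<And>z. f1 z - f1 (z(u := z v)) = (z u - z v) * g1 z"
    "\<And>z. f2 z - f2 (z(u := z v)) = (z u - z v) * g2 z" by blast
  have "(f1 z + f2 z) - (f1 (z(u := z v)) + f2 (z(u := z v))) = (z u - z v) * (g1 z + g2 z)" for z
    using g(3,4)[of z] by (simp add: distrib_left add_diff_add)
  then show ?case using g(1,2) by (intro bexI[of _ "\<lambda>z. g1 z + g2 z"] allI polyfun.add)
next
  case (mult f1 f2)
  then obtain g1 g2 where g: "g1 \<in> polyfun V" "g2 \<in> polyfun V"
    "\<And>z. f1 z - f1 (z(u := z v)) = (z u - z v) * g1 z"
    "\<And>z. f2 z - f2 (z(u := z v)) = (z u - z v) * g2 z" by blast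
  have s: "(\<lambda>z. f2 (z(u := z v))) \<in> polyfun V"
    using mult.hyps(2) mult.prems by (rule polyfun_merge)
  \<comment> \<open>The Leibniz rule for difference quotients supplies the cofactor of a
    product.\<close>
  have "f1 z * f2 z - f1 (z(u := z v)) * f2 (z(u := z v))
      = (z u - z v) * (f1 z * g2 z + f2 (z(u := z v)) * g1 z)" for z
  proof -
    have "f1 z * f2 z - f1 (z(u := z v)) * f2 (z(u := z v))
        = f1 z * (f2 z - f2 (z(u := z v))) + f2 (z(u := z v)) * (f1 z - f1 (z(u := z v)))"
      by (simp add: algebra_simps)
    also have "\<dots> = (z u - z v) * (f1 z * g2 z + f2 (z(u := z v)) * g1 z)"
      unfolding g(3,4) by (simp add: algebra_simps)
    finally show ?thesis .
  qed
  moreover have "(\<lambda>z. f1 z * g2 z + f2 (z(u := z v)) * g1 z) \<in> polyfun V"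
    using g(1,2) s mult.hyps by (intro polyfun.add polyfun.mult)
  ultimately show ?case by (intro bexI allI)
qed

text \<open>At least one end of the pair \<open>(u', v')\<close> lies outside \<open>{u, v}\<close>.
  Raising that coordinate alone to 1 in the zero point separates \<open>u'\<close> from
  \<open>v'\<close> without disturbing \<open>z u = z v\<close>.\<close>

lemma polyfun_restrict_nonzero:
  fixes u v u' v' :: 'v
  assumes "u \<noteq> v" "u' \<noteq> v'" "(u', v') \<noteq> (u, v)" "(u', v') \<noteq> (v, u)"
  shows "\<exists>z :: 'v \<Rightarrow> 'a::field_char_0. z u = z v \<and> z u' - z v' \<noteq> 0"
proof -
  consider "u' \<noteq> u" "u' \<noteq> v" | "v' \<noteq> u" "v' \<noteq> v"
    using assms by blast
  then show ?thesis
  proof cases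
    case 1
    then show ?thesis using assms(2) by (intro exI[of _ "(\<lambda>_. 0)(u' := 1)"]) auto
  next
    case 2
    then show ?thesis using assms(2) by (intro exI[of _ "(\<lambda>_. 0)(v' := 1)"]) auto
  qed
qed

text \<open>Every unordered pair occurs at most once and never degenerately, so the linear factors
  of \<open>diffprod\<close> are nonzero and pairwise non-proportional.\<close>

definition oriented :: "('v \<times> 'v) set \<Rightarrow> bool" where
  "oriented P \<longleftrightarrow> (\<forall>u v. (u, v) \<in> P \<longrightarrow> u \<noteq> v \<and> (v, u) \<notin> P)"

definition diffprod :: "('v \<times> 'v) set \<Rightarrow> ('v \<Rightarrow> 'a::comm_ring_1) \<Rightarrow> 'a" where
  "diffprod P z = (\<Prod>(u, v)\<in>P. z u - z v)"

lemma polyfun_diffprod: "P \<subseteq> V \<times> V \<Longrightarrow> diffprod P \<in> polyfun V"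
  unfolding diffprod_def[abs_def] by (intro polyfun_prod) (auto split: prod.splits intro!: polyfun_intros)

lemma diffprod_nonzero_on_hyperplane:
  assumes "finite P" "P \<subseteq> V \<times> V" "oriented (insert (u, v) P)" "(u, v) \<notin> P" "u \<in> V" "v \<in> V"
  shows "\<exists>z :: 'v \<Rightarrow> 'a::field_char_0. diffprod P (z(u := z v)) \<noteq> 0"
proof -
  let ?f = "\<lambda>(a, b) (z :: 'v \<Rightarrow> 'a). (z(u := z v)) a - (z(u := z v)) b"
  have "\<exists>z. (\<Prod>i\<in>P. ?f i z) \<noteq> 0"
  proof (rule polyfun_prod_nonzero)
    fix i assume i: "i \<in> P"
    then obtain a b where [simp]: "i = (a, b)" by force
    have ab: "a \<in> V" "b \<in> V" using i assms by auto
    show "?f i \<in> polyfun V"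
      using ab assms(5,6) by (cases "a = u"; cases "b = u") (auto intro!: polyfun_intros)
    have "u \<noteq> v" "a \<noteq> b" "(a, b) \<noteq> (u, v)" "(a, b) \<noteq> (v, u)"
      using assms(3,4) i by (auto simp: oriented_def)
    from polyfun_restrict_nonzero[OF this, where ?'a = 'a]
    obtain z :: "'v \<Rightarrow> 'a" where z: "z u = z v" "z a - z b \<noteq> 0" by blast
    have "z(u := z v) = z" using z(1) by (intro fun_upd_idem)
    then have "?f i z = z a - z b" by (simp only: \<open>i = (a, b)\<close> split_conv)
    with z(2) have "?f i z \<noteq> 0" by metis
    then show "\<exists>z. ?f i z \<noteq> 0" by blast
  qed (use assms in auto)
  then show ?thesis unfolding diffprod_def by (simp add: case_prod_unfold)
qed

text \<open>The factors are split off one at a time. The cofactor \<open>g\<close> left by the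
  earlier factors inherits the vanishing on \<open>z u = z v\<close>, because their product is not
  identically zero on that hyperplane and polynomial functions have no zero divisors.\<close>

lemma polyfun_dvd_diffprod:
  fixes f :: "('v \<Rightarrow> 'a::field_char_0) \<Rightarrow> 'a"
  assumes "finite P" "P \<subseteq> V \<times> V" "oriented P" "f \<in> polyfun V"
    and "\<And>u v z. (u, v) \<in> P \<Longrightarrow> f (z(u := z v)) = 0"
  shows "\<exists>g\<in>polyfun V. \<forall>z. f z = diffprod P z * g z"
  using assms(1,2,3,5)
proof (induction P)
  case empty
  then show ?case using assms(4) by (intro bexI[of _ f]) (simp_all add: diffprod_def)
next
  case (insert p P)
  obtain u v where p: "p = (u, v)" by (cases p)
  have or: "oriented P" using insert.prems(2) unfolding oriented_def by blast
  have "\<exists>g\<in>polyfun V. \<forall>z. f z = diffprod P z * g z"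
    by (rule insert.IH[OF _ or insert.prems(3)]) (use insert.prems(1) in auto)
  then obtain g where g: "g \<in> polyfun V" "\<And>z. f z = diffprod P z * g z" by blast
  have uv: "u \<in> V" "v \<in> V" using insert.prems(1) p by auto
  have "oriented (insert (u, v) P)" "(u, v) \<notin> P" "P \<subseteq> V \<times> V"
    using insert.hyps(2) insert.prems(1,2) p by auto
  from diffprod_nonzero_on_hyperplane[OF insert.hyps(1) this(3,1,2) uv, where ?'a = 'a]
  obtain z0 :: "'v \<Rightarrow> 'a" where z0: "diffprod P (z0(u := z0 v)) \<noteq> 0" by blast
  have "g (z(u := z v)) = 0" for z
  proof (rule polyfun_mult_eq_0[of "\<lambda>z. g (z(u := z v))" V "\<lambda>z. diffprod P (z(u := z v))" V])
    show "(\<lambda>z. g (z(u := z v))) \<in> polyfun V"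
      using g(1) uv(2) by (rule polyfun_merge)
    show "(\<lambda>z. diffprod P (z(u := z v))) \<in> polyfun V"
      using insert.prems(1) uv(2) by (intro polyfun_merge[OF polyfun_diffprod]) auto
    show "diffprod P (z0(u := z0 v)) \<noteq> 0" by fact
    show "diffprod P (z(u := z v)) * g (z(u := z v)) = 0" for z
      using g(2)[of "z(u := z v)"] insert.prems(3)[of u v z] p by simp
  qed
  moreover obtain h where h: "h \<in> polyfun V" "\<And>z. g z - g (z(u := z v)) = (z u - z v) * h z"
    using polyfun_hyperplane[OF g(1) uv(2)] by blast
  ultimately have "g z = (z u - z v) * h z" for z by (metis diff_zero)
  moreover have "diffprod (insert p P) z = (z u - z v) * diffprod P z" for z :: "'v \<Rightarrow> 'a"
    using insert.hyps p by (simp add: diffprod_def)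
  ultimately have "f z = diffprod (insert p P) z * h z" for z
    unfolding g(2) by (simp add: mult_ac)
  with h(1) show ?case by blast
qed

section \<open>The weak Nullstellensatz\<close>

definition subring1 :: "'r::comm_ring_1 set \<Rightarrow> bool" where
  "subring1 A \<longleftrightarrow> 0 \<in> A \<and> 1 \<in> A \<and> (\<forall>a\<in>A. \<forall>b\<in>A. a + b \<in> A \<and> a - b \<in> A \<and> a * b \<in> A)"

definition ideal_of :: "'r::comm_ring_1 set \<Rightarrow> 'r set \<Rightarrow> bool" where
  "ideal_of B P \<longleftrightarrow> P \<subseteq> B \<and> 0 \<in> P \<and> (\<forall>a\<in>P. \<forall>b\<in>P. a + b \<in> P) \<and> (\<forall>a\<in>P. \<forall>b\<in>B. a * b \<in> P)"

definition prime_ideal_of :: "'r::comm_ring_1 set \<Rightarrow> 'r set \<Rightarrow> bool" where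
  "prime_ideal_of B P \<longleftrightarrow> ideal_of B P \<and> 1 \<notin> P \<and> (\<forall>a\<in>B. \<forall>b\<in>B. a * b \<in> P \<longrightarrow> a \<in> P \<or> b \<in> P)"

definition polys_over :: "'r::comm_ring_1 set \<Rightarrow> 'r poly set" where
  "polys_over A = {p. \<forall>i. coeff p i \<in> A}"

lemma subring1D:
  assumes "subring1 A"
  shows "0 \<in> A" "1 \<in> A" "a \<in> A \<Longrightarrow> b \<in> A \<Longrightarrow> a + b \<in> A" "a \<in> A \<Longrightarrow> b \<in> A \<Longrightarrow> a - b \<in> A"
    "a \<in> A \<Longrightarrow> b \<in> A \<Longrightarrow> a * b \<in> A" "a \<in> A \<Longrightarrow> - a \<in> A"
proof -
  show *: "0 \<in> A" "1 \<in> A" "a \<in> A \<Longrightarrow> b \<in> A \<Longrightarrow> a + b \<in> A"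
    "a \<in> A \<Longrightarrow> b \<in> A \<Longrightarrow> a * b \<in> A"
    and minus: "a \<in> A \<Longrightarrow> b \<in> A \<Longrightarrow> a - b \<in> A" for a b
    using assms unfolding subring1_def by blast+
  show "- a \<in> A" if "a \<in> A"
    using minus[OF *(1) that] by simp
qed

lemma ideal_ofD:
  assumes "ideal_of B P" "subring1 B"
  shows "P \<subseteq> B" "0 \<in> P" "a \<in> P \<Longrightarrow> b \<in> P \<Longrightarrow> a + b \<in> P" "a \<in> P \<Longrightarrow> b \<in> P \<Longrightarrow> a - b \<in> P"
    "a \<in> P \<Longrightarrow> b \<in> B \<Longrightarrow> a * b \<in> P" "a \<in> P \<Longrightarrow> b \<in> B \<Longrightarrow> b * a \<in> P"
proof -
  show "P \<subseteq> B" "0 \<in> P" using assms(1) unfolding ideal_of_def by blast+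
  show add: "a \<in> P \<Longrightarrow> b \<in> P \<Longrightarrow> a + b \<in> P" for a b
    using assms(1) unfolding ideal_of_def by blast
  show mult: "a \<in> P \<Longrightarrow> b \<in> B \<Longrightarrow> a * b \<in> P" for a b
    using assms(1) unfolding ideal_of_def by blast
  show "a \<in> P \<Longrightarrow> b \<in> B \<Longrightarrow> b * a \<in> P"
    using mult[of a b] by (simp add: mult.commute)
  show "a - b \<in> P" if "a \<in> P" "b \<in> P"
    using add[OF that(1) mult[OF that(2) subring1D(6)[OF assms(2) subring1D(2)[OF assms(2)]]]] by simp
qed

lemma subring1_sum: "subring1 A \<Longrightarrow> (\<And>i. i \<in> I \<Longrightarrow> f i \<in> A) \<Longrightarrow> (\<Sum>i\<in>I. f i) \<in> A"
  by (induction I rule: infinite_finite_induct) (simp_all add: subring1D)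

lemma subring1_power: "subring1 A \<Longrightarrow> a \<in> A \<Longrightarrow> a ^ k \<in> A"
  by (induction k) (simp_all add: subring1D)

lemma ideal_of_sum: "ideal_of B P \<Longrightarrow> (\<And>i. i \<in> I \<Longrightarrow> f i \<in> P) \<Longrightarrow> (\<Sum>i\<in>I. f i) \<in> P"
  by (induction I rule: infinite_finite_induct) (simp_all add: ideal_of_def)

lemma prime_ideal_of_power:
  assumes "prime_ideal_of B P" "subring1 B" "a \<in> B" "a ^ k \<in> P" shows "a \<in> P"
  using assms(4)
proof (induction k)
  case (Suc k)
  then have "a * a ^ k \<in> P" by simp
  then show ?case
    using assms(1,3) Suc.IH subring1_power[OF assms(2,3)] unfolding prime_ideal_of_def by blast
qed (use assms(1) in \<open>simp add: prime_ideal_of_def\<close>)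

section \<open>Pseudo-division over a subring\<close>

context
  fixes A :: "'r::comm_ring_1 set"
  assumes A: "subring1 A"
begin

lemma polys_over_closed:
  assumes "p \<in> polys_over A" "q \<in> polys_over A"
  shows "p + q \<in> polys_over A" "p - q \<in> polys_over A" "p * q \<in> polys_over A"
  using assms subring1D[OF A] by (auto simp: polys_over_def coeff_mult intro!: subring1_sum[OF A])

lemma polys_over_monom: "a \<in> A \<Longrightarrow> monom a n \<in> polys_over A"
  using subring1D[OF A] by (auto simp: polys_over_def)

lemma polys_over_smult: "a \<in> A \<Longrightarrow> p \<in> polys_over A \<Longrightarrow> smult a p \<in> polys_over A"
  using subring1D[OF A] by (auto simp: polys_over_def)

lemma polys_over_cutoff: "p \<in> polys_over A \<Longrightarrow> poly_cutoff n p \<in> polys_over A"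
  using subring1D[OF A] by (auto simp: polys_over_def coeff_poly_cutoff)

text \<open>Dividing by a polynomial whose leading coefficient need not be a unit costs a power of
  that coefficient. The remainder is bounded through its coefficients rather than its degree, so
  that a constant \<open>f\<close> leaves remainder 0.\<close>

lemma pseudo_division_over:
  assumes f: "f \<in> polys_over A" and "p \<in> polys_over A"
  shows "\<exists>k. \<exists>q\<in>polys_over A. \<exists>r\<in>polys_over A.
    smult (lead_coeff f ^ k) p = q * f + r \<and> (\<forall>i\<ge>degree f. coeff r i = 0)"
proof -
  have "\<exists>k. \<exists>q\<in>polys_over A. \<exists>r\<in>polys_over A.
      smult (lead_coeff f ^ k) p = q * f + r \<and> (\<forall>i\<ge>degree f. coeff r i = 0)"
    if "p \<in> polys_over A" "\<forall>i\<ge>n. coeff p i = 0" for n p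
    using that
  proof (induction n arbitrary: p)
    case 0
    show ?case
      by (intro exI[of _ 0] bexI[of _ 0] bexI[of _ p])
        (use 0 subring1D(1)[OF A] in \<open>auto simp: polys_over_def\<close>)
  next
    case (Suc n)
    show ?case
    proof (cases "Suc n \<le> degree f")
      case True
      then show ?thesis
        by (intro exI[of _ 0] bexI[of _ 0] bexI[of _ p])
          (use Suc.prems subring1D(1)[OF A] in \<open>auto simp: polys_over_def\<close>)
    next
      case False
      define c where "c = lead_coeff f"
      define t where "t = monom (coeff p n) (n - degree f)"
      define p' where "p' = smult c p - t * f"
      have c: "c \<in> A" using f by (auto simp: polys_over_def c_def)
      have t: "t \<in> polys_over A"
        unfolding t_def using Suc.prems(1) by (intro polys_over_monom) (auto simp: polys_over_def)
      have p': "p' \<in> polys_over A"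
        unfolding p'_def using t c f Suc.prems by (intro polys_over_closed polys_over_smult)
      have "coeff p' i = 0" if "i \<ge> n" for i
      proof (cases "i = n")
        case True
        then show ?thesis using False by (simp add: p'_def t_def c_def coeff_monom_mult)
      next
        case ne: False
        then have "coeff p i = 0" "coeff f (i - (n - degree f)) = 0"
          using Suc.prems(2) that False by (auto intro!: coeff_eq_0)
        then show ?thesis by (simp add: p'_def t_def coeff_monom_mult)
      qed
      then obtain k q r where *: "q \<in> polys_over A" "r \<in> polys_over A"
        "smult (c ^ k) p' = q * f + r" "\<forall>i\<ge>degree f. coeff r i = 0"
        using Suc.IH[OF p'] unfolding c_def by blast
      have "smult (c ^ Suc k) p = smult (c ^ k) (p' + t * f)"
        by (simp add: p'_def mult.commute)
      also have "\<dots> = (q + smult (c ^ k) t) * f + r"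
        by (simp add: smult_add_right *(3) algebra_simps)
      finally have "smult (c ^ Suc k) p = (q + smult (c ^ k) t) * f + r" .
      moreover have "q + smult (c ^ k) t \<in> polys_over A"
        using * t c by (intro polys_over_closed polys_over_smult subring1_power[OF A])
      ultimately show ?thesis using * unfolding c_def by blast
    qed
  qed
  from this[OF assms(2), of "Suc (degree p)"] show ?thesis
    by (simp add: coeff_eq_0)
qed

section \<open>A prime ideal of the simple extension \<open>B = A[u]\<close>\<close>

context
  fixes u :: 'r and P :: "'r set" and B :: "'r set"
  defines "B \<equiv> (\<lambda>p. poly p u) ` polys_over A"
  assumes P: "prime_ideal_of B P" and B: "subring1 B"
begin

lemma base_subset_extension: "A \<subseteq> B"
proof
  fix a assume "a \<in> A"
  then have "monom a 0 \<in> polys_over A" by (rule polys_over_monom)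
  then have "poly (monom a 0) u \<in> B" unfolding B_def by (rule imageI)
  then show "a \<in> B" by (simp add: poly_monom)
qed

lemma generator_in_extension: "u \<in> B"
proof -
  have "poly (monom 1 1) u \<in> B"
    unfolding B_def using subring1D(2)[OF A] by (intro imageI polys_over_monom)
  then show ?thesis by (simp add: poly_monom)
qed

lemma extension_ideal: "ideal_of B P" using P by (simp add: prime_ideal_of_def)

lemma eval_in_extension: "p \<in> polys_over A \<Longrightarrow> poly p u \<in> B"
  unfolding B_def by simp

lemma eval_in_ideal: "(\<And>i. coeff p i \<in> P) \<Longrightarrow> poly p u \<in> P"
  unfolding poly_altdef
  by (intro ideal_of_sum[OF extension_ideal] ideal_ofD(5)[OF extension_ideal B] subring1_power[OF B generator_in_extension])

text \<open>Terms with coefficients in \<open>P\<close> contribute an element of \<open>P\<close> to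
  the value at \<open>u\<close>, so everything above the last coefficient outside \<open>P\<close>
  may be cut off. The degree of \<open>p'\<close> is the degree of \<open>p\<close> read modulo
  \<open>P\<close>.\<close>

lemma strip_leading_coeffs:
  assumes p: "p \<in> polys_over A" and "coeff p i \<notin> P"
  shows "\<exists>p'\<in>polys_over A. lead_coeff p' \<notin> P \<and> degree p' \<le> degree p
    \<and> (\<forall>j>degree p'. coeff p j \<in> P) \<and> lead_coeff p' = coeff p (degree p') \<and> poly p u - poly p' u \<in> P"
proof -
  define S where "S = {j. coeff p j \<notin> P}"
  have 0: "0 \<in> P" using ideal_ofD[OF extension_ideal B] by blast
  have S: "S \<subseteq> {..degree p}"
    using 0 coeff_eq_0[of p] by (force simp: S_def not_le[symmetric])
  then have fin: "finite S" by (rule finite_subset) simp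
  have "S \<noteq> {}" using assms(2) by (auto simp: S_def)
  define n where "n = Max S"
  have n: "coeff p n \<notin> P" "n \<le> degree p" "\<And>j. j > n \<Longrightarrow> coeff p j \<in> P"
    using Max_in[OF fin \<open>S \<noteq> {}\<close>] S Max_ge[OF fin] by (auto simp: n_def S_def not_le[symmetric])
  define p' where "p' = poly_cutoff (Suc n) p"
  have "degree p' \<le> n" unfolding p'_def by (intro degree_le) (auto simp: coeff_poly_cutoff)
  moreover have "coeff p' n \<noteq> 0" using n 0 by (auto simp: p'_def coeff_poly_cutoff)
  ultimately have d: "degree p' = n" using le_degree by (metis le_antisym)
  have "poly (p - p') u \<in> P"
    by (rule eval_in_ideal) (use n 0 in \<open>auto simp: p'_def coeff_poly_cutoff not_less\<close>)
  moreover have "p' \<in> polys_over A" unfolding p'_def by (rule polys_over_cutoff[OF p])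
  ultimately show ?thesis
    using d n by (intro bexI[of _ p']) (auto simp: p'_def coeff_poly_cutoff)
qed

text \<open>In the algebraic case \<open>f\<close> plays the role of the minimal polynomial of \<open>u\<close> over the field of
  fractions of \<open>A / P\<close>, and \<open>e = s * b + j\<close> is a Bezout identity for \<open>f\<close> and \<open>b\<close> with cleared denominators.\<close>

lemma prime_ideal_step:
  obtains (generic) "\<And>p i. p \<in> polys_over A \<Longrightarrow> poly p u \<in> P \<Longrightarrow> coeff p i \<in> P"
  | (algebraic) f where "f \<in> polys_over A" "lead_coeff f \<notin> P" "degree f \<ge> 1"
      "\<And>p. p \<in> polys_over A \<Longrightarrow> poly p u \<in> P \<Longrightarrow>
        \<exists>k. \<exists>q\<in>polys_over A. \<exists>r\<in>polys_over A. smult (lead_coeff f ^ k) p = q * f + r \<and> (\<forall>i. coeff r i \<in> P)"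
      "\<And>b. b \<in> B \<Longrightarrow> b \<notin> P \<Longrightarrow> \<exists>e\<in>A - P. \<exists>s\<in>B. \<exists>j\<in>P. e = s * b + j"
proof (cases "\<forall>p\<in>polys_over A. poly p u \<in> P \<longrightarrow> (\<forall>i. coeff p i \<in> P)")
  case True
  then have "coeff p i \<in> P" if "p \<in> polys_over A" "poly p u \<in> P" for p i
    using that by blast
  then show ?thesis by (rule generic)
next
  case False
  note P_intros = ideal_ofD[OF extension_ideal B]
  have prime: "a \<in> B \<Longrightarrow> b \<in> B \<Longrightarrow> a * b \<in> P \<Longrightarrow> a \<in> P \<or> b \<in> P" for a b
    using P by (auto simp: prime_ideal_of_def)
  define F where "F f \<longleftrightarrow> f \<in> polys_over A \<and> poly f u \<in> P \<and> lead_coeff f \<notin> P" for f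
  have "\<exists>f. F f"
  proof -
    obtain p i where p: "p \<in> polys_over A" "poly p u \<in> P" "coeff p i \<notin> P" using False by blast
    obtain p' where p': "p' \<in> polys_over A" "lead_coeff p' \<notin> P" "poly p u - poly p' u \<in> P"
      using strip_leading_coeffs[OF p(1,3)] by blast
    have "poly p u - (poly p u - poly p' u) \<in> P" by (rule P_intros(4)) (use p p' in auto)
    with p' show ?thesis unfolding F_def by auto
  qed
  define f where "f = arg_min degree F"
  have f: "F f" "\<And>g. F g \<Longrightarrow> degree f \<le> degree g"
    using arg_min_natI[of F _ degree] arg_min_nat_le[of F _ degree] \<open>\<exists>f. F f\<close> by (auto simp: f_def)
  define d where "d = degree f"
  define c where "c = lead_coeff f"
  have fA: "f \<in> polys_over A" and fu: "poly f u \<in> P" and cP: "c \<notin> P" and cA: "c \<in> A"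
    using f(1) by (auto simp: F_def c_def polys_over_def)
  have cB: "c \<in> B" using cA base_subset_extension by blast
  \<comment> \<open>No relation shorter than \<open>f\<close> survives modulo \<open>P\<close>:
    cutting off its leading terms in \<open>P\<close> would give a member of \<open>F\<close> of
    degree below \<open>d\<close>.\<close>
  have small: "coeff r i \<in> P" if r: "r \<in> polys_over A" "poly r u \<in> P" "\<forall>i\<ge>d. coeff r i = 0" for r i
  proof (rule ccontr)
    assume "coeff r i \<notin> P"
    then obtain p' where p': "p' \<in> polys_over A" "lead_coeff p' \<notin> P" "poly r u - poly p' u \<in> P"
      "lead_coeff p' = coeff r (degree p')"
      using strip_leading_coeffs[OF r(1)] by blast
    have "poly r u - (poly r u - poly p' u) \<in> P" by (rule P_intros(4)) (use r p' in auto)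
    then have "F p'" using p' by (auto simp: F_def)
    then have "d \<le> degree p'" using f(2) by (simp add: d_def)
    then show False using r(3) p'(2,4) P_intros(2) by auto
  qed
  have d1: "d \<ge> 1"
  proof (rule ccontr)
    assume "\<not> d \<ge> 1"
    then have "degree f = 0" by (simp add: d_def)
    then obtain a where "f = [:a:]" by (rule degree_eq_zeroE)
    then have "poly f u = c" by (simp add: c_def)
    then show False using fu cP by simp
  qed
  show ?thesis
  proof (rule algebraic)
    show "f \<in> polys_over A" by (fact fA)
    show "lead_coeff f \<notin> P" using cP by (simp add: c_def)
    show "degree f \<ge> 1" using d1 by (simp add: d_def)
  next
    fix p assume p: "p \<in> polys_over A" "poly p u \<in> P"
    obtain k q r where *: "q \<in> polys_over A" "r \<in> polys_over A" "smult (c ^ k) p = q * f + r"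
      "\<forall>i\<ge>d. coeff r i = 0"
      using pseudo_division_over[OF fA p(1)] unfolding c_def d_def by blast
    have "poly r u = poly (smult (c ^ k) p - q * f) u" using *(3) by simp
    also have "\<dots> = c ^ k * poly p u - poly q u * poly f u" by simp
    finally have "poly r u = c ^ k * poly p u - poly q u * poly f u" .
    also have "\<dots> \<in> P"
      using p fu *(1) by (intro P_intros(4,6) subring1_power[OF B cB] eval_in_extension)
    finally have "coeff r i \<in> P" for i using small *(2,4) by blast
    with * show "\<exists>k. \<exists>q\<in>polys_over A. \<exists>r\<in>polys_over A. smult (lead_coeff f ^ k) p = q * f + r \<and> (\<forall>i. coeff r i \<in> P)"
      unfolding c_def by blast
  next
    fix b assume b: "b \<in> B" "b \<notin> P"
    \<comment> \<open>Euclid's algorithm on \<open>f\<close> and a polynomial representing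
      \<open>b\<close>, replaced by minimality: the candidates represent multiples of
      \<open>b\<close> that are nonzero modulo \<open>P\<close>, and one of least degree plays the
      part of the gcd.\<close>
    define G where "G h \<longleftrightarrow> h \<in> polys_over A \<and> lead_coeff h \<notin> P \<and> poly h u \<notin> P
      \<and> (\<exists>s\<in>B. \<exists>j\<in>P. poly h u = s * b + j)" for h
    have mkG: "\<exists>h'. G h' \<and> coeff h (degree h') \<noteq> 0"
      if h: "h \<in> polys_over A" "poly h u \<notin> P" "s \<in> B" "j \<in> P" "poly h u = s * b + j" for h s j
    proof -
      obtain i where "coeff h i \<notin> P" using eval_in_ideal h(2) by blast
      then obtain h' where h': "h' \<in> polys_over A" "lead_coeff h' \<notin> P"
        "lead_coeff h' = coeff h (degree h')" "poly h u - poly h' u \<in> P"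
        using strip_leading_coeffs[OF h(1)] by blast
      have "poly h' u = s * b + (j - (poly h u - poly h' u))" using h(5) by simp
      moreover have "j - (poly h u - poly h' u) \<in> P" by (rule P_intros(4)[OF h(4) h'(4)])
      moreover have "poly h' u \<notin> P" using P_intros(3)[OF h'(4), of "poly h' u"] h(2) by auto
      ultimately have "G h'" using h' h unfolding G_def by blast
      moreover have "coeff h (degree h') \<noteq> 0" using h'(2,3) P_intros(2) by metis
      ultimately show ?thesis by blast
    qed
    have "\<exists>h. G h"
    proof -
      obtain h where h: "h \<in> polys_over A" "poly h u = b" using b(1) unfolding B_def by auto
      have "\<exists>h'. G h' \<and> coeff h (degree h') \<noteq> 0"
        by (rule mkG[OF h(1), of 1 0]) (use h(2) b subring1D(2)[OF B] P_intros(2) in auto)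
      then show ?thesis by blast
    qed
    define h where "h = arg_min degree G"
    have h: "G h" "\<And>g. G g \<Longrightarrow> degree h \<le> degree g"
      using arg_min_natI[of G _ degree] arg_min_nat_le[of G _ degree] \<open>\<exists>f. G f\<close> by (auto simp: h_def)
    define D where "D = degree h"
    define l where "l = lead_coeff h"
    obtain s j where hA: "h \<in> polys_over A" and l: "l \<notin> P" "l \<in> A" and sj: "s \<in> B" "j \<in> P"
      and hu: "poly h u = s * b + j" and huP: "poly h u \<notin> P"
      using h(1) unfolding G_def l_def by (auto simp: polys_over_def)
    have lB: "l \<in> B" using l base_subset_extension by blast
    \<comment> \<open>Modulo \<open>P\<close>, the remainder of \<open>h\<close> by \<open>f\<close>
      takes the value \<open>c ^ k * poly h u\<close>, which is still outside \<open>P\<close>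
      because \<open>P\<close> is prime. Stripping this remainder gives a candidate of degree below
      \<open>d\<close>.\<close>
    have "D < d"
    proof -
      obtain k q r where *: "q \<in> polys_over A" "r \<in> polys_over A"
        "smult (c ^ k) h = q * f + r" "\<forall>i\<ge>d. coeff r i = 0"
        using pseudo_division_over[OF fA hA] unfolding c_def d_def by blast
      have "poly r u = poly (smult (c ^ k) h - q * f) u" using *(3) by simp
      also have "\<dots> = c ^ k * poly h u - poly q u * poly f u" by simp
      finally have ru: "poly r u = c ^ k * poly h u - poly q u * poly f u" .
      have qf: "poly q u * poly f u \<in> P" using fu *(1) by (intro P_intros(6) eval_in_extension)
      have ck: "c ^ k \<in> B" by (rule subring1_power[OF B cB])
      have "poly r u \<notin> P"
      proof
        assume "poly r u \<in> P"
        then have "poly r u + poly q u * poly f u \<in> P" using qf by (intro P_intros(3))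
        then have "c ^ k * poly h u \<in> P" using ru by simp
        then have "c ^ k \<in> P" using prime[OF ck eval_in_extension[OF hA]] huP by blast
        then show False using prime_ideal_of_power[OF P B cB] cP by blast
      qed
      moreover have "poly r u = (c ^ k * s) * b + (c ^ k * j - poly q u * poly f u)"
        unfolding ru hu by (simp add: algebra_simps)
      moreover have "c ^ k * s \<in> B" "c ^ k * j - poly q u * poly f u \<in> P"
        using ck sj qf by (simp_all add: P_intros subring1D[OF B])
      ultimately obtain h' where "G h'" "coeff r (degree h') \<noteq> 0" using mkG[OF *(2)] by blast
      then have "D \<le> degree h'" "degree h' < d" using h(2) *(4) by (auto simp: D_def not_le[symmetric])
      then show ?thesis by simp
    qed
    \<comment> \<open>Otherwise divide \<open>f\<close> by \<open>h\<close>. The remainder is too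
      short to yield a candidate, so its value lies in \<open>P\<close>, and by \<open>small\<close>
      so do its coefficients; hence the value of \<open>q\<close> lies in \<open>P\<close>. All
      coefficients of \<open>q\<close> are then in \<open>P\<close> as well, which would force the
      leading coefficient \<open>l ^ k * c\<close> into \<open>P\<close>.\<close>
    have "D = 0"
    proof (rule ccontr)
      assume "D \<noteq> 0"
      obtain k q r where *: "q \<in> polys_over A" "r \<in> polys_over A"
        "smult (l ^ k) f = q * h + r" "\<forall>i\<ge>D. coeff r i = 0"
        using pseudo_division_over[OF hA fA] unfolding l_def D_def by blast
      have "poly r u = poly (smult (l ^ k) f - q * h) u" using *(3) by simp
      also have "\<dots> = l ^ k * poly f u - poly q u * poly h u" by simp
      finally have ru: "poly r u = l ^ k * poly f u - poly q u * poly h u" .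
      have lk: "l ^ k \<in> B" by (rule subring1_power[OF B lB])
      have qB: "poly q u \<in> B" by (rule eval_in_extension[OF *(1)])
      have ruP: "poly r u \<in> P"
      proof (rule ccontr)
        assume "poly r u \<notin> P"
        moreover have "poly r u = (- poly q u * s) * b + (l ^ k * poly f u - poly q u * j)"
          unfolding ru hu by (simp add: algebra_simps)
        moreover have "- poly q u * s \<in> B" "l ^ k * poly f u - poly q u * j \<in> P"
          using lk sj qB fu by (simp_all add: P_intros subring1D[OF B])
        ultimately obtain h' where "G h'" "coeff r (degree h') \<noteq> 0" using mkG[OF *(2)] by blast
        then have "D \<le> degree h'" "degree h' < D" using h(2) *(4) by (auto simp: D_def not_le[symmetric])
        then show False by simp
      qed
      have rP: "coeff r i \<in> P" for i
        by (rule small[OF *(2) ruP]) (use *(4) \<open>D < d\<close> in auto)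
      have "poly q u * poly h u = l ^ k * poly f u - poly r u" using ru by simp
      also have "\<dots> \<in> P" using lk fu ruP by (intro P_intros(4,6))
      finally have quP: "poly q u \<in> P" using prime[OF qB eval_in_extension[OF hA]] huP by blast
      have qP: "coeff q i \<in> P" for i
      proof (rule ccontr)
        assume "coeff q i \<notin> P"
        then obtain q' where q': "q' \<in> polys_over A" "lead_coeff q' \<notin> P"
          "\<forall>j>degree q'. coeff q j \<in> P" "lead_coeff q' = coeff q (degree q')" "poly q u - poly q' u \<in> P"
          using strip_leading_coeffs[OF *(1)] by blast
        have "poly q u - (poly q u - poly q' u) \<in> P" by (rule P_intros(4)[OF quP q'(5)])
        then have "F q'" using q' unfolding F_def by simp
        then have dq: "d \<le> degree q'" using f(2) by (simp add: d_def)
        \<comment> \<open>With a coefficient outside \<open>P\<close>, the polynomial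
          \<open>q\<close> has degree at least \<open>d\<close> modulo \<open>P\<close>, so
          \<open>q * h\<close> has top degree \<open>N > d\<close> modulo \<open>P\<close>. But at
          \<open>N\<close> the polynomial \<open>f\<close> has coefficient 0 and \<open>r\<close>
          has a coefficient in \<open>P\<close>.\<close>
        define N where "N = degree q' + D"
        have hB: "coeff h i \<in> B" for i using hA base_subset_extension by (auto simp: polys_over_def)
        have qB: "coeff q i \<in> B" for i using *(1) base_subset_extension by (auto simp: polys_over_def)
        have "coeff (q * h) N = (\<Sum>i\<le>N. coeff q i * coeff h (N - i))" by (rule coeff_mult)
        also have "\<dots> = coeff q (degree q') * coeff h D
            + (\<Sum>i\<in>{..N} - {degree q'}. coeff q i * coeff h (N - i))"
          by (subst sum.remove[of _ "degree q'"]) (auto simp: N_def)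
        finally have "coeff q (degree q') * l = coeff (q * h) N
            - (\<Sum>i\<in>{..N} - {degree q'}. coeff q i * coeff h (N - i))" by (simp add: l_def D_def)
        also have "\<dots> \<in> P"
        proof (rule P_intros(4))
          have "coeff (smult (l ^ k) f) N = 0" using dq \<open>D \<noteq> 0\<close> by (simp add: N_def d_def coeff_eq_0)
          then have "coeff (q * h) N = 0 - coeff r N" unfolding *(3) by (simp add: eq_neg_iff_add_eq_0)
          then show "coeff (q * h) N \<in> P" using P_intros(4)[OF P_intros(2) rP] by simp
          show "(\<Sum>i\<in>{..N} - {degree q'}. coeff q i * coeff h (N - i)) \<in> P"
          proof (rule ideal_of_sum[OF extension_ideal])
            fix i assume i: "i \<in> {..N} - {degree q'}"
            show "coeff q i * coeff h (N - i) \<in> P"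
            proof (cases "i > degree q'")
              case True
              then show ?thesis using q'(3) hB by (intro P_intros(5)) auto
            next
              case False
              then have "coeff h (N - i) = 0" using i by (auto simp: N_def D_def intro!: coeff_eq_0)
              then show ?thesis using P_intros(2) by simp
            qed
          qed
        qed
        finally show False using prime[OF qB lB] q'(2,4) l by auto
      qed
      have "coeff (q * h) d \<in> P"
        unfolding coeff_mult using qP hA base_subset_extension
        by (intro ideal_of_sum[OF extension_ideal] P_intros(5)) (auto simp: polys_over_def)
      then have "coeff (q * h + r) d \<in> P" using rP P_intros(3) by simp
      then have "l ^ k * c \<in> P" unfolding *(3)[symmetric] by (simp add: c_def d_def)
      then show False
        using prime[OF lk cB] cP prime_ideal_of_power[OF P B lB] l by blast
    qed
    then have "degree h = 0" by (simp add: D_def)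
    then obtain a where "h = [:a:]" by (rule degree_eq_zeroE)
    then have "poly h u = l" by (simp add: l_def)
    with l sj hu show "\<exists>e\<in>A - P. \<exists>s\<in>B. \<exists>j\<in>P. e = s * b + j"
      by (intro bexI[of _ l] bexI[of _ s] bexI[of _ j]) auto
  qed
qed

end
end

section \<open>Polynomial functions in one more variable\<close>

lemma subring1_polyfun: "subring1 (polyfun V)"
  unfolding subring1_def plus_fun_def times_fun_def fun_diff_def zero_fun_def one_fun_def
  by (intro conjI ballI polyfun_intros)

lemma poly_fun_apply: "poly p f z = poly (map_poly (\<lambda>c. c z) p) (f z)"
  by (induction p) (simp_all add: map_poly_pCons)

text \<open>The setting of \<open>prime_ideal_step\<close>: the functions in one more variable are
  the simple extension \<open>A[u]\<close>, with \<open>A = polyfun V\<close> and \<open>u\<close>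
  the new coordinate.\<close>

lemma polyfun_insert: "polyfun (insert v V) = (\<lambda>p. poly p (\<lambda>z. z v)) ` polys_over (polyfun V)"
proof (intro equalityI subsetI)
  note sub = subring1_polyfun[of V]
  have img: "poly (monom f n) (\<lambda>z. z v) \<in> (\<lambda>p. poly p (\<lambda>z. z v)) ` polys_over (polyfun V)"
    if "f \<in> polyfun V" for f n
    using that by (intro imageI polys_over_monom[OF sub])
  fix f :: "('a \<Rightarrow> 'b) \<Rightarrow> 'b"
  assume "f \<in> polyfun (insert v V)"
  then show "f \<in> (\<lambda>p. poly p (\<lambda>z. z v)) ` polys_over (polyfun V)"
  proof (induction rule: polyfun.induct)
    case (const c)
    show ?case using img[OF polyfun.const[of c], of 0] by (simp add: poly_monom)
  next
    case (var w)
    show ?case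
    proof (cases "w = v")
      case True
      then show ?thesis using img[OF polyfun.const[of 1], of 1]
        by (simp add: poly_monom one_fun_def[symmetric])
    next
      case False
      then show ?thesis using img[OF polyfun.var[of w], of 0] var by (simp add: poly_monom)
    qed
  next
    case (add f g)
    then obtain p q where "p \<in> polys_over (polyfun V)" "q \<in> polys_over (polyfun V)"
      "f = poly p (\<lambda>z. z v)" "g = poly q (\<lambda>z. z v)" by blast
    then show ?case
      by (intro image_eqI[of _ _ "p + q"]) (auto intro: polys_over_closed[OF sub])
  next
    case (mult f g)
    then obtain p q where "p \<in> polys_over (polyfun V)" "q \<in> polys_over (polyfun V)"
      "f = poly p (\<lambda>z. z v)" "g = poly q (\<lambda>z. z v)" by blast
    then show ?case
      by (intro image_eqI[of _ _ "p * q"]) (auto intro: polys_over_closed[OF sub])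
  qed
next
  fix f :: "('a \<Rightarrow> 'b) \<Rightarrow> 'b"
  assume "f \<in> (\<lambda>p. poly p (\<lambda>z. z v)) ` polys_over (polyfun V)"
  then obtain p where p: "p \<in> polys_over (polyfun V)" "f = poly p (\<lambda>z. z v)" by blast
  note sub = subring1_polyfun[of "insert v V"]
  have "coeff p i \<in> polyfun (insert v V)" for i
    using p(1) by (auto simp: polys_over_def intro: polyfun_mono)
  moreover have "(\<lambda>z. z v) \<in> polyfun (insert v V)" by (rule polyfun.var) simp
  ultimately show "f \<in> polyfun (insert v V)"
    unfolding p(2) poly_altdef by (intro subring1_sum[OF sub] subring1D(5)[OF sub] subring1_power[OF sub])
qed

text \<open>The coefficients do not involve \<open>v\<close>, so once the other coordinates are
  fixed at \<open>a\<close>, the choice of the coordinate at \<open>v\<close> is a problem about one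
  univariate polynomial over the field.\<close>

lemma poly_over_polyfun_apply:
  assumes "p \<in> polys_over (polyfun V)" "v \<notin> V"
  shows "poly p (\<lambda>z. z v) (a(v := t)) = poly (map_poly (\<lambda>c. c a) p) t"
proof -
  have "map_poly (\<lambda>c. c (a(v := t))) p = map_poly (\<lambda>c. c a) p"
  proof (rule poly_eqI)
    fix i
    have "coeff p i \<in> polyfun V" using assms(1) by (simp add: polys_over_def)
    then have "coeff p i (a(v := t)) = coeff p i a"
      by (rule polyfun_cong) (use assms(2) in auto)
    then show "coeff (map_poly (\<lambda>c. c (a(v := t))) p) i = coeff (map_poly (\<lambda>c. c a) p) i"
      by (simp add: coeff_map_poly)
  qed
  then show ?thesis by (simp add: poly_fun_apply)
qed

lemma prime_ideal_of_Int:
  assumes "prime_ideal_of B P" "subring1 A" "A \<subseteq> B"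
  shows "prime_ideal_of A (P \<inter> A)"
  unfolding prime_ideal_of_def ideal_of_def
  using assms unfolding prime_ideal_of_def ideal_of_def subring1_def
  by (intro conjI ballI impI IntI) blast+

text \<open>Avoiding a given \<open>b\<close> outside \<open>P\<close> is what makes the induction
  work: a zero of the prime in fewer variables extends to the new coordinate only if certain
  coefficients do not vanish at it.\<close>

lemma nullstellensatz_prime:
  fixes P :: "(('v \<Rightarrow> 'k::{alg_closed_field, field_char_0}) \<Rightarrow> 'k) set"
  assumes "finite V" "prime_ideal_of (polyfun V) P" "b \<in> polyfun V" "b \<notin> P"
  shows "\<exists>a. (\<forall>f\<in>P. f a = 0) \<and> b a \<noteq> 0"
  using assms
proof (induction V arbitrary: P b rule: finite_induct)
  case empty
  have const: "\<exists>c. f = (\<lambda>z. c)" if "f \<in> polyfun {}" for f :: "('v \<Rightarrow> 'k) \<Rightarrow> 'k"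
    using that by (induction rule: polyfun.induct) auto
  have id: "ideal_of (polyfun {}) P" using empty(1) by (simp add: prime_ideal_of_def)
  note P = ideal_ofD[OF id subring1_polyfun]
  have "f a = 0" if fP: "f \<in> P" for f a
  proof (rule ccontr)
    assume nz: "f a \<noteq> 0"
    obtain c where c: "f = (\<lambda>z. c)" using const fP P(1) by blast
    have "f * (\<lambda>z. inverse c) \<in> P" by (intro P(5) fP polyfun.const)
    moreover have "f * (\<lambda>z. inverse c) = 1" using nz c by (auto simp: fun_eq_iff)
    ultimately show False using empty(1) by (simp add: prime_ideal_of_def)
  qed
  moreover obtain c where c: "b = (\<lambda>z. c)" using const empty(2) by blast
  moreover have "c \<noteq> 0" using empty(3) P(2) c by (auto simp: zero_fun_def)
  ultimately show ?case by auto
next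
  case (insert v V)
  let ?A = "polyfun V :: (('v \<Rightarrow> 'k) \<Rightarrow> 'k) set" and ?u = "\<lambda>z :: 'v \<Rightarrow> 'k. z v"
  have A: "subring1 ?A" by (rule subring1_polyfun)
  have Bsub: "subring1 ((\<lambda>p. poly p ?u) ` polys_over ?A)"
    unfolding polyfun_insert[symmetric] by (rule subring1_polyfun)
  have prime: "prime_ideal_of ((\<lambda>p. poly p ?u) ` polys_over ?A) P"
    using insert.prems(1) unfolding polyfun_insert .
  have PA: "prime_ideal_of ?A (P \<inter> ?A)"
    by (rule prime_ideal_of_Int[OF insert.prems(1) A]) (auto intro: polyfun_mono)
  have id: "ideal_of (polyfun (insert v V)) P" using insert.prems(1) by (simp add: prime_ideal_of_def)
  note P = ideal_ofD[OF id subring1_polyfun]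
  have rep: "\<exists>p\<in>polys_over ?A. f = poly p ?u" if "f \<in> polyfun (insert v V)" for f
    using that unfolding polyfun_insert by blast
  have zero: "poly r ?u (a(v := t)) = 0"
    if "r \<in> polys_over ?A" "\<And>i. coeff r i \<in> P" "\<forall>f\<in>P \<inter> ?A. f a = 0" for r a t
  proof -
    have "map_poly (\<lambda>c. c a) r = 0"
      using that by (auto simp: poly_eq_iff coeff_map_poly polys_over_def)
    then show ?thesis using poly_over_polyfun_apply[OF that(1) insert.hyps(2)] by simp
  qed
  show ?case
  proof (cases rule: prime_ideal_step[OF A prime Bsub, case_names generic algebraic])
    case generic
    \<comment> \<open>In the generic case every extension of a zero \<open>a\<close> of the smaller
      prime is a zero of \<open>P\<close>. It remains to keep some coefficient of \<open>b\<close>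
      nonzero at \<open>a\<close> and to choose \<open>t\<close> outside the roots of the resulting
      polynomial.\<close>
    obtain p where p: "p \<in> polys_over ?A" "b = poly p ?u" using rep insert.prems(2) by blast
    have "\<exists>i. coeff p i \<notin> P"
      using eval_in_ideal[OF A prime Bsub, of p] p(2) insert.prems(3) by blast
    then obtain i where i: "coeff p i \<notin> P \<inter> ?A" "coeff p i \<in> ?A"
      using p(1) by (auto simp: polys_over_def)
    obtain a where a: "\<forall>f\<in>P \<inter> ?A. f a = 0" "coeff p i a \<noteq> 0"
      using insert.IH[OF PA i(2,1)] by blast
    have "coeff (map_poly (\<lambda>c. c a) p) i \<noteq> 0" using a(2) by (simp add: coeff_map_poly)
    then have "map_poly (\<lambda>c. c a) p \<noteq> 0" by auto
    then obtain t where "poly (map_poly (\<lambda>c. c a) p) t \<noteq> 0" using poly_all_0_iff_0 by blast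
    then have "b (a(v := t)) \<noteq> 0"
      using poly_over_polyfun_apply[OF p(1) insert.hyps(2)] p(2) by simp
    moreover have "f (a(v := t)) = 0" if fP: "f \<in> P" for f
    proof -
      obtain q where q: "q \<in> polys_over ?A" "f = poly q ?u" using rep fP P(1) by blast
      then show ?thesis using zero[OF q(1) _ a(1)] generic[OF q(1)] fP by simp
    qed
    ultimately show ?thesis by blast
  next
    case (algebraic f)
    let ?c = "lead_coeff f"
    have cA: "?c \<in> ?A" using algebraic(1) by (simp add: polys_over_def)
    obtain e s j where e: "e \<in> ?A" "e \<notin> P" and sj: "s \<in> polyfun (insert v V)" "j \<in> P" "e = s * b + j"
      using algebraic(5)[of b] insert.prems(2,3) unfolding polyfun_insert[symmetric] by blast
    \<comment> \<open>Both factors must stay nonzero at \<open>a\<close>: the leading coefficient,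
      so that \<open>f\<close> keeps a positive degree there and has a root \<open>t\<close>; and
      \<open>e\<close>, since \<open>e = s * b + j\<close> with \<open>j\<close> vanishing at the
      new point forces \<open>b\<close> to be nonzero.\<close>
    have "?c * e \<notin> P"
      using PA cA e algebraic(2) subring1D(5)[OF A cA e(1)] unfolding prime_ideal_of_def by blast
    then obtain a where a: "\<forall>f\<in>P \<inter> ?A. f a = 0" "(?c * e) a \<noteq> 0"
      using insert.IH[OF PA subring1D(5)[OF A cA e(1)]] by blast
    have ca: "?c a \<noteq> 0" "e a \<noteq> 0" using a(2) by auto
    let ?F = "map_poly (\<lambda>c. c a) f"
    have "coeff ?F (degree f) \<noteq> 0" using ca by (simp add: coeff_map_poly)
    then have "degree ?F \<ge> degree f" by (rule le_degree)
    then obtain t where t: "poly ?F t = 0"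
      using alg_closed_imp_poly_has_root[of ?F] algebraic(3) by auto
    have ft: "poly f ?u (a(v := t)) = 0"
      using poly_over_polyfun_apply[OF algebraic(1) insert.hyps(2)] t by simp
    have g0: "g (a(v := t)) = 0" if fP: "g \<in> P" for g
    proof -
      obtain p where p: "p \<in> polys_over ?A" "g = poly p ?u" using rep fP P(1) by blast
      obtain k q r where q: "q \<in> polys_over ?A" "r \<in> polys_over ?A"
        "smult (?c ^ k) p = q * f + r" "\<forall>i. coeff r i \<in> P"
        using algebraic(4)[OF p(1)] p(2) fP by blast
      have "?c ^ k * g = poly (smult (?c ^ k) p) ?u" using p(2) by simp
      also have "\<dots> = poly q ?u * poly f ?u + poly r ?u" unfolding q(3) by simp
      finally have "(?c ^ k * g) (a(v := t)) = 0"
        using ft zero[OF q(2) _ a(1)] q(4) by simp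
      moreover have "(?c ^ k) (a(v := t)) \<noteq> 0"
      proof -
        have "(?c ^ k) (a(v := t)) = (?c ^ k) a"
          by (rule polyfun_cong[OF subring1_power[OF A cA]]) (use insert.hyps(2) in auto)
        moreover have "(h ^ k) a = h a ^ k" for h :: "('v \<Rightarrow> 'k) \<Rightarrow> 'k"
          by (induction k) auto
        ultimately show ?thesis using ca by simp
      qed
      ultimately show ?thesis by simp
    qed
    have "e (a(v := t)) = e a"
      by (rule polyfun_cong[OF e(1)]) (use insert.hyps(2) in auto)
    then have "b (a(v := t)) \<noteq> 0" using sj(3) g0[OF sj(2)] ca by auto
    with g0 show ?thesis by blast
  qed
qed

section \<open>From proper ideals to prime ideals, and the Nullstellensatz\<close>

lemma maximal_ideal_extension:
  assumes B: "subring1 B" and J: "ideal_of B J" "1 \<notin> J"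
  shows "\<exists>P. prime_ideal_of B P \<and> J \<subseteq> P"
proof -
  define Ids where "Ids = {I. ideal_of B I \<and> J \<subseteq> I \<and> 1 \<notin> I}"
  have "\<exists>M\<in>Ids. \<forall>I\<in>Ids. M \<subseteq> I \<longrightarrow> I = M"
  proof (rule subset_Zorn_nonempty)
    show "Ids \<noteq> {}" using J by (auto simp: Ids_def)
    fix C assume chain: "C \<noteq> {}" "subset.chain Ids C"
    have sub: "ideal_of B I" "J \<subseteq> I" "1 \<notin> I" if "I \<in> C" for I
      using chain(2) that unfolding subset_chain_def Ids_def by blast+
    note I_intros = ideal_ofD[OF sub(1) B]
    have "ideal_of B (\<Union>C)"
      unfolding ideal_of_def
    proof (intro conjI ballI)
      show "\<Union>C \<subseteq> B" using I_intros(1) by blast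
      show "0 \<in> \<Union>C" using I_intros(2) chain(1) by blast
    next
      fix a b assume "a \<in> \<Union>C" "b \<in> \<Union>C"
      then obtain I I' where I: "I \<in> C" "a \<in> I" "I' \<in> C" "b \<in> I'" by blast
      have "I \<subseteq> I' \<or> I' \<subseteq> I" using chain(2) I(1,3) unfolding subset_chain_def by blast
      then have "a + b \<in> I' \<or> a + b \<in> I" using I I_intros(3) by blast
      with I show "a + b \<in> \<Union>C" by blast
    next
      fix a b assume "a \<in> \<Union>C" "b \<in> B"
      then obtain I where I: "I \<in> C" "a \<in> I" by blast
      then have "a * b \<in> I" using I_intros(5) \<open>b \<in> B\<close> by blast
      with I show "a * b \<in> \<Union>C" by blast
    qed
    moreover have "J \<subseteq> \<Union>C" "1 \<notin> \<Union>C" using sub chain(1) by blast+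
    ultimately show "\<Union>C \<in> Ids" unfolding Ids_def by simp
  qed
  then obtain P where "P \<in> Ids" and max: "\<forall>I\<in>Ids. P \<subseteq> I \<longrightarrow> I = P" by (rule bexE)
  then have P: "ideal_of B P" "J \<subseteq> P" "1 \<notin> P" by (auto simp: Ids_def)
  have max: "I = P" if "ideal_of B I" "P \<subseteq> I" "1 \<notin> I" for I
    using max that P(2) unfolding Ids_def by simp
  note PI = ideal_ofD[OF P(1) B] and BI = subring1D[OF B]
  have unit: "\<exists>i\<in>P. \<exists>s\<in>B. 1 = i + a * s" if a: "a \<in> B" "a \<notin> P" for a
  proof (rule ccontr)
    assume no: "\<not> ?thesis"
    define I where "I = {i + a * s | i s. i \<in> P \<and> s \<in> B}"
    have IB: "I \<subseteq> B" using PI(1) a BI by (auto simp: I_def)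
    have "x + y \<in> I" if xy: "x \<in> I" "y \<in> I" for x y
    proof -
      obtain i s i' s' where *: "i \<in> P" "s \<in> B" "x = i + a * s" "i' \<in> P" "s' \<in> B" "y = i' + a * s'"
        using xy unfolding I_def by blast
      then have "x + y = (i + i') + a * (s + s')" by (simp add: algebra_simps)
      then show ?thesis unfolding I_def using * PI(3) BI(3) by blast
    qed
    moreover have "x * b \<in> I" if xb: "x \<in> I" "b \<in> B" for x b
    proof -
      obtain i s where *: "i \<in> P" "s \<in> B" "x = i + a * s"
        using xb unfolding I_def by blast
      then have "x * b = i * b + a * (s * b)" by (simp add: algebra_simps)
      then show ?thesis unfolding I_def using * PI(5) BI(5) xb by blast
    qed
    moreover have PI': "P \<subseteq> I"
    proof
      fix i assume "i \<in> P"
      then have "i + a * 0 \<in> I" unfolding I_def using BI(1) by blast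
      then show "i \<in> I" by simp
    qed
    ultimately have "ideal_of B I" using IB PI(2) unfolding ideal_of_def by blast
    moreover have "1 \<notin> I" using no unfolding I_def by blast
    ultimately have "I = P" using max PI' by blast
    moreover have "0 + a * 1 \<in> I" unfolding I_def using PI(2) BI(2) by blast
    ultimately show False using a by simp
  qed
  have "a \<in> P \<or> b \<in> P" if ab: "a \<in> B" "b \<in> B" "a * b \<in> P" for a b
  proof (rule ccontr)
    assume "\<not> ?thesis"
    then obtain i s i' s' where *: "i \<in> P" "s \<in> B" "1 = i + a * s" "i' \<in> P" "s' \<in> B" "1 = i' + b * s'"
      using unit ab by meson
    have "1 = (i + a * s) * (i' + b * s')" using *(3,6) by simp
    also have "\<dots> = i * (i' + b * s') + (i' * (a * s) + (a * b) * (s * s'))"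
      by (simp add: algebra_simps)
    also have "\<dots> \<in> P"
      using PI(5)[OF *(1) BI(2)] PI(5)[OF *(4) BI(5)[OF ab(1) *(2)]]
        PI(5)[OF ab(3) BI(5)[OF *(2,5)]] PI(3) *(6) by metis
    finally show False using P(3) by simp
  qed
  then have "prime_ideal_of B P" using P unfolding prime_ideal_of_def by blast
  with P(2) show ?thesis by blast
qed

theorem weak_nullstellensatz:
  fixes J :: "(('v \<Rightarrow> 'k::{alg_closed_field, field_char_0}) \<Rightarrow> 'k) set"
  assumes "finite V" "ideal_of (polyfun V) J" "1 \<notin> J"
  shows "\<exists>a. \<forall>f\<in>J. f a = 0"
proof -
  obtain P where P: "prime_ideal_of (polyfun V) P" "J \<subseteq> P"
    using maximal_ideal_extension[OF subring1_polyfun assms(2,3)] by blast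
  then have "1 \<notin> P" by (simp add: prime_ideal_of_def)
  then show ?thesis
    using nullstellensatz_prime[OF assms(1) P(1) subring1D(2)[OF subring1_polyfun]] P(2) by blast
qed

section \<open>Symmetric and supersymmetric polynomial functions\<close>

abbreviation transp :: "'v \<Rightarrow> 'v \<Rightarrow> 'v \<Rightarrow> 'v" where "transp \<equiv> Transposition.transpose"

text \<open>For disjoint \<open>U\<close> and \<open>W\<close> this is the product of their
  symmetric groups, realised as permutations of the variables; it acts on points by
  composition.\<close>

definition block_perms :: "'v set \<Rightarrow> 'v set \<Rightarrow> ('v \<Rightarrow> 'v) set" where
  "block_perms U W = {\<pi>. \<pi> permutes (U \<union> W) \<and> \<pi> ` U = U \<and> \<pi> ` W = W}"

definition symalg :: "'v set \<Rightarrow> 'v set \<Rightarrow> (('v \<Rightarrow> 'a::comm_ring_1) \<Rightarrow> 'a) set" where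
  "symalg U W = {f \<in> polyfun (U \<union> W). \<forall>\<pi>\<in>block_perms U W. \<forall>z. f (z \<circ> \<pi>) = f z}"

definition supersym :: "'v set \<Rightarrow> 'v set \<Rightarrow> (('v \<Rightarrow> 'a::comm_ring_1) \<Rightarrow> 'a) set" where
  "supersym U W = {f \<in> symalg U W. \<forall>i\<in>U. \<forall>j\<in>W. \<forall>z s t. f (z(i := s, j := s)) = f (z(i := t, j := t))}"

lemma block_perms_comp: "\<pi> \<in> block_perms U W \<Longrightarrow> \<sigma> \<in> block_perms U W \<Longrightarrow> \<pi> \<circ> \<sigma> \<in> block_perms U W"
  unfolding block_perms_def mem_Collect_eq image_comp[symmetric] by (simp add: permutes_compose)

lemma transp_block_perms:
  assumes "a \<in> U \<and> b \<in> U \<or> a \<in> W \<and> b \<in> W" "U \<inter> W = {}"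
  shows "transp a b \<in> block_perms U W"
proof -
  have "transp a b permutes U \<union> W" using assms by (intro permutes_swap_id) auto
  moreover have "transp a b ` U = U" using assms by (cases "a \<in> U"; cases "b \<in> U") auto
  moreover have "transp a b ` W = W" using assms by (cases "a \<in> W"; cases "b \<in> W") auto
  ultimately show ?thesis by (simp add: block_perms_def)
qed

lemma block_perms_in:
  assumes "\<pi> \<in> block_perms U W"
  shows "x \<in> U \<Longrightarrow> \<pi> x \<in> U" "x \<in> W \<Longrightarrow> \<pi> x \<in> W" "inj \<pi>"
  using assms unfolding block_perms_def by (blast, blast, blast dest: permutes_inj)

text \<open>Together with \<open>block_perms_mono\<close> this identifies the stabiliser of
  \<open>p\<close> and \<open>q\<close> with the group belonging to the smaller blocks, under which
  the functions to be lifted are invariant.\<close>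

lemma block_perms_diff:
  assumes "\<pi> \<in> block_perms U W" "\<pi> p = p" "\<pi> q = q" "p \<in> U" "q \<in> W" "U \<inter> W = {}"
  shows "\<pi> \<in> block_perms (U - {p}) (W - {q})"
proof -
  have \<pi>: "\<pi> permutes (U \<union> W)" "\<pi> ` U = U" "\<pi> ` W = W" using assms(1) by (auto simp: block_perms_def)
  have "inj \<pi>" using \<pi>(1) by (rule permutes_inj)
  then have 1: "\<pi> ` (U - {p}) = U - {p}" "\<pi> ` (W - {q}) = W - {q}"
    using \<pi> assms by (simp_all add: image_set_diff)
  have "\<pi> permutes (U - {p} \<union> (W - {q}))"
  proof (rule permutes_superset[OF \<pi>(1)])
    show "\<pi> x = x" if "x \<in> U \<union> W - (U - {p} \<union> (W - {q}))" for x
      using that assms by auto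
  qed
  with 1 show ?thesis by (simp add: block_perms_def)
qed

lemma block_perms_mono:
  assumes "\<pi> \<in> block_perms (U - {p}) (W - {q})" "p \<in> U" "q \<in> W" "U \<inter> W = {}"
  shows "\<pi> \<in> block_perms U W" "\<pi> p = p" "\<pi> q = q"
proof -
  have \<pi>: "\<pi> permutes (U - {p} \<union> (W - {q}))" "\<pi> ` (U - {p}) = U - {p}" "\<pi> ` (W - {q}) = W - {q}"
    using assms(1) by (auto simp: block_perms_def)
  show pq: "\<pi> p = p" "\<pi> q = q" using permutes_not_in[OF \<pi>(1)] assms(2-4) by auto
  have "\<pi> ` insert p (U - {p}) = insert p (U - {p})" "\<pi> ` insert q (W - {q}) = insert q (W - {q})"
    using \<pi>(2,3) pq by (simp_all only: image_insert)
  moreover have "\<pi> permutes (U \<union> W)" by (rule permutes_subset[OF \<pi>(1)]) auto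
  ultimately show "\<pi> \<in> block_perms U W"
    using assms(2,3) by (simp add: block_perms_def insert_absorb)
qed

lemma symalgD: "f \<in> symalg U W \<Longrightarrow> f \<in> polyfun (U \<union> W)"
  "f \<in> symalg U W \<Longrightarrow> \<pi> \<in> block_perms U W \<Longrightarrow> f (z \<circ> \<pi>) = f z"
  by (auto simp: symalg_def)

lemma supersymD: "f \<in> supersym U W \<Longrightarrow> f \<in> symalg U W" "f \<in> supersym U W \<Longrightarrow> f \<in> polyfun (U \<union> W)"
  "f \<in> supersym U W \<Longrightarrow> i \<in> U \<Longrightarrow> j \<in> W \<Longrightarrow> f (z(i := s, j := s)) = f (z(i := t, j := t))"
  unfolding supersym_def symalg_def by blast+

text \<open>The block permutations carry every pair \<open>(i, j)\<close> to the fixed pair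
  \<open>(p, q)\<close>, so one substitution controls all of them.\<close>

lemma supersymI:
  assumes f: "f \<in> symalg U W" and pq: "p \<in> U" "q \<in> W" "U \<inter> W = {}"
    and indep: "\<And>z s t. f (z(p := s, q := s)) = f (z(p := t, q := t))"
  shows "f \<in> supersym U W"
  unfolding supersym_def
proof (intro CollectI conjI ballI allI f)
  fix i j z s t assume ij: "i \<in> U" "j \<in> W"
  let ?\<pi> = "transp i p \<circ> transp j q"
  have \<pi>: "?\<pi> \<in> block_perms U W"
    using ij pq by (intro block_perms_comp transp_block_perms) auto
  have *: "f (z(i := r, j := r)) = f ((z \<circ> ?\<pi>)(p := r, q := r))" for r
  proof -
    have "i \<noteq> j" "i \<noteq> q" "p \<noteq> j" "p \<noteq> q" using ij pq by auto
    then have "(z(i := r, j := r)) \<circ> ?\<pi> = (z \<circ> ?\<pi>)(p := r, q := r)"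
      by (auto simp: fun_eq_iff Transposition.transpose_def)
    then show ?thesis using symalgD(2)[OF f \<pi>] by metis
  qed
  show "f (z(i := s, j := s)) = f (z(i := t, j := t))"
    unfolding * by (rule indep)
qed

lemma symalg_intros:
  "(\<lambda>z. c) \<in> symalg U W"
  "f \<in> symalg U W \<Longrightarrow> g \<in> symalg U W \<Longrightarrow> (\<lambda>z. f z + g z) \<in> symalg U W"
  "f \<in> symalg U W \<Longrightarrow> g \<in> symalg U W \<Longrightarrow> (\<lambda>z. f z - g z) \<in> symalg U W"
  "f \<in> symalg U W \<Longrightarrow> g \<in> symalg U W \<Longrightarrow> (\<lambda>z. f z * g z) \<in> symalg U W"
  unfolding symalg_def by (simp_all add: polyfun_intros)

lemma supersym_intros:
  assumes "f \<in> supersym U W" "g \<in> supersym U W"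
  shows "(\<lambda>z. f z + g z) \<in> supersym U W" "(\<lambda>z. f z - g z) \<in> supersym U W" "(\<lambda>z. f z * g z) \<in> supersym U W"
proof -
  have "f (z(i := s, j := s)) = f (z(i := t, j := t))" "g (z(i := s, j := s)) = g (z(i := t, j := t))"
    if "i \<in> U" "j \<in> W" for i j z s t
    using supersymD(3) assms that by metis+
  then show "(\<lambda>z. f z + g z) \<in> supersym U W" "(\<lambda>z. f z - g z) \<in> supersym U W" "(\<lambda>z. f z * g z) \<in> supersym U W"
    using assms[THEN supersymD(1)] unfolding supersym_def
    by (intro CollectI conjI ballI allI symalg_intros; metis)+
qed

lemma supersym_const: "(\<lambda>z. c) \<in> supersym U W"
  by (simp add: supersym_def symalg_intros)

text \<open>For such \<open>P\<close> the function \<open>diffprod P\<close> is the Vandermonde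
  product of \<open>U\<close> up to sign. The variables carry no order, so the orientation is
  borrowed from an injection into the naturals.\<close>

lemma oriented_pairs:
  assumes "finite U"
  obtains P where "finite P" "P \<subseteq> U \<times> U" "oriented P"
    "\<And>a b. a \<in> U \<Longrightarrow> b \<in> U \<Longrightarrow> a \<noteq> b \<Longrightarrow> (a, b) \<in> P \<or> (b, a) \<in> P"
proof -
  obtain g :: "'a \<Rightarrow> nat" where g: "inj_on g U"
    using finite_imp_inj_to_nat_seg[OF assms] by blast
  define P where "P = {(a, b). a \<in> U \<and> b \<in> U \<and> g a < g b}"
  show ?thesis
  proof
    show "P \<subseteq> U \<times> U" by (auto simp: P_def)
    then show "finite P" by (rule finite_subset) (use assms in auto)
    show "oriented P" by (auto simp: oriented_def P_def)
    show "(a, b) \<in> P \<or> (b, a) \<in> P" if "a \<in> U" "b \<in> U" "a \<noteq> b" for a b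
      using that inj_onD[OF g, of a b] nat_neq_iff[of "g a" "g b"] by (auto simp: P_def)
  qed
qed

lemma diffprod_eq_0_iff:
  fixes z :: "'v \<Rightarrow> 'a::idom"
  shows "finite P \<Longrightarrow> diffprod P z = 0 \<longleftrightarrow> (\<exists>(a, b)\<in>P. z a = z b)"
  unfolding diffprod_def by (auto simp: prod_zero_iff split: prod.splits)

lemma diffprod_nonzero_iff_inj_on:
  fixes z :: "'v \<Rightarrow> 'a::idom"
  assumes "finite P" "P \<subseteq> U \<times> U" "oriented P"
    "\<And>a b. a \<in> U \<Longrightarrow> b \<in> U \<Longrightarrow> a \<noteq> b \<Longrightarrow> (a, b) \<in> P \<or> (b, a) \<in> P"
  shows "diffprod P z \<noteq> 0 \<longleftrightarrow> inj_on z U"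
proof -
  have "inj_on z U \<longleftrightarrow> (\<forall>(a, b)\<in>P. z a \<noteq> z b)"
    using assms(2-4) unfolding inj_on_def oriented_def by fastforce
  then show ?thesis using diffprod_eq_0_iff[OF assms(1)] by auto
qed

lemma generic_point_exists:
  assumes "finite U"
  shows "\<exists>z :: 'v \<Rightarrow> 'a::semiring_char_0. inj_on z U"
proof -
  obtain g :: "'v \<Rightarrow> nat" where "inj_on g U"
    using finite_imp_inj_to_nat_seg[OF assms] by blast
  then have "inj_on (\<lambda>x. of_nat (g x) :: 'a) U" by (auto simp: inj_on_def)
  then show ?thesis by blast
qed

text \<open>The points allowed in \<open>eq\<close> are those at which two Vandermonde products, one
  for each block, are both nonzero. Coordinates in different blocks may agree. At these points the
  denominators of the lift do not vanish.\<close>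

lemma polyfun_generic_density:
  fixes f :: "('v \<Rightarrow> 'a::field_char_0) \<Rightarrow> 'a"
  assumes "f \<in> polyfun V" "finite U" "finite W"
    and eq: "\<And>z. inj_on z U \<Longrightarrow> inj_on z W \<Longrightarrow> f z = 0"
  shows "f z = 0"
proof -
  obtain P where P: "finite P" "P \<subseteq> U \<times> U" "oriented P"
    "\<And>a b. a \<in> U \<Longrightarrow> b \<in> U \<Longrightarrow> a \<noteq> b \<Longrightarrow> (a, b) \<in> P \<or> (b, a) \<in> P"
    using oriented_pairs[OF assms(2)] by metis
  obtain P' where P': "finite P'" "P' \<subseteq> W \<times> W" "oriented P'"
    "\<And>a b. a \<in> W \<Longrightarrow> b \<in> W \<Longrightarrow> a \<noteq> b \<Longrightarrow> (a, b) \<in> P' \<or> (b, a) \<in> P'"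
    using oriented_pairs[OF assms(3)] by metis
  have iff: "diffprod P z * diffprod P' z \<noteq> 0 \<longleftrightarrow> inj_on z U \<and> inj_on z W" for z :: "'v \<Rightarrow> 'a"
    using diffprod_nonzero_iff_inj_on[OF P] diffprod_nonzero_iff_inj_on[OF P'] by auto
  obtain z0 :: "'v \<Rightarrow> 'a" where "inj_on z0 (U \<union> W)"
    using generic_point_exists[of "U \<union> W"] assms by blast
  then have z0: "inj_on z0 U" "inj_on z0 W" by (auto simp: inj_on_Un)
  have "diffprod P \<in> polyfun UNIV" "diffprod P' \<in> polyfun UNIV"
    by (intro polyfun_diffprod; simp)+
  then have "(\<lambda>z. diffprod P z * diffprod P' z) \<in> polyfun UNIV" by (rule polyfun.mult)
  then show ?thesis
    by (rule polyfun_density[OF assms(1)]) (use iff z0 eq in blast)+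
qed

text \<open>Since \<open>g\<close> is invariant under the swap of \<open>u\<close> and \<open>v\<close>, it cannot have a simple pole along \<open>z u = z v\<close>.\<close>

lemma polyfun_clear_poles:
  fixes g p :: "('v \<Rightarrow> 'a::field_char_0) \<Rightarrow> 'a"
  assumes fin: "finite U" "finite W"
    and P: "finite P" "P \<subseteq> U \<times> U \<union> W \<times> W" "oriented P"
    and g: "\<And>u v z. (u, v) \<in> P \<Longrightarrow> inj_on z U \<Longrightarrow> inj_on z W \<Longrightarrow> g (z \<circ> transp u v) = g z"
    and p: "p \<in> polyfun (U \<union> W)" and UW: "U \<inter> W = {}"
    and eq: "\<And>z. inj_on z U \<Longrightarrow> inj_on z W \<Longrightarrow> p z = diffprod P z * g z"
  shows "\<exists>e\<in>polyfun (U \<union> W). \<forall>z. inj_on z U \<longrightarrow> inj_on z W \<longrightarrow> e z = g z"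
proof -
  have P': "P \<subseteq> (U \<union> W) \<times> (U \<union> W)" using P(2) by auto
  have vanish: "p (z(u := z v)) = 0" if uv: "(u, v) \<in> P" for u v z
  proof -
    let ?t = "transp u v" and ?P = "P - {(u, v)}"
    define D where "D = (diffprod ?P :: ('v \<Rightarrow> 'a) \<Rightarrow> 'a)"
    have uvV: "u \<in> U \<union> W" "v \<in> U \<union> W" "u \<noteq> v" using uv P P' by (auto simp: oriented_def)
    have D: "D \<in> polyfun (U \<union> W)" unfolding D_def by (rule polyfun_diffprod) (use P' in auto)
    have split: "diffprod P z = (z u - z v) * D z" for z
      unfolding diffprod_def D_def prod.remove[OF P(1) uv] by simp
    have comp: "(\<lambda>z. f (z \<circ> ?t)) \<in> polyfun (U \<union> W)" if f: "f \<in> polyfun (U \<union> W)" for f :: "('v \<Rightarrow> 'a) \<Rightarrow> 'a"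
    proof (rule polyfun_subst[OF f])
      fix w assume "w \<in> U \<union> W"
      then have "?t w \<in> U \<union> W" using uvV by (auto simp: Transposition.transpose_def)
      then show "(\<lambda>z. (z \<circ> ?t) w) \<in> polyfun (U \<union> W)" by (auto intro: polyfun.var)
    qed
    \<comment> \<open>Eliminating \<open>g\<close> from the formulas for \<open>p\<close> at
      \<open>z\<close> and at the swapped point leaves this identity, since the factor
      \<open>z u - z v\<close> changes sign. Where \<open>z u = z v\<close> the two points coincide
      and it reads \<open>2 * p z * D z = 0\<close>.\<close>
    have sym: "p (z \<circ> ?t) * D z + p z * D (z \<circ> ?t) = 0" for z
    proof (rule polyfun_generic_density[OF _ fin, of "\<lambda>z. p (z \<circ> ?t) * D z + p z * D (z \<circ> ?t)"])
      show "(\<lambda>z. p (z \<circ> ?t) * D z + p z * D (z \<circ> ?t)) \<in> polyfun (U \<union> W)"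
        by (intro polyfun.add polyfun.mult comp p D)
      fix z :: "'v \<Rightarrow> 'a" assume z: "inj_on z U" "inj_on z W"
      have "?t \<in> block_perms U W" using uv P(2) UW by (intro transp_block_perms) auto
      then have t: "?t ` U = U" "?t ` W = W" by (auto simp: block_perms_def)
      have "inj_on (z \<circ> ?t) U" "inj_on (z \<circ> ?t) W"
        using z by (intro comp_inj_on; simp add: t del: transpose_image_eq)+
      then have 1: "p (z \<circ> ?t) = (z v - z u) * D (z \<circ> ?t) * g z"
        using eq[of "z \<circ> ?t"] split[of "z \<circ> ?t"] g[OF uv z] by simp
      have 2: "p z = (z u - z v) * D z * g z" using eq[OF z] split by simp
      show "p (z \<circ> ?t) * D z + p z * D (z \<circ> ?t) = 0" unfolding 1 2 by (simp add: algebra_simps)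
    qed
    have "(z(u := z v)) \<circ> ?t = z(u := z v)" for z :: "'v \<Rightarrow> 'a"
      by (auto simp: fun_eq_iff Transposition.transpose_def)
    then have 0: "D (z(u := z v)) * p (z(u := z v)) = 0" for z
      using sym[of "z(u := z v)"] by (simp add: mult.commute)
    have "oriented (insert (u, v) ?P)" "finite ?P" "?P \<subseteq> (U \<union> W) \<times> (U \<union> W)" "(u, v) \<notin> ?P"
      using uv P P' by (auto simp: insert_absorb)
    from diffprod_nonzero_on_hyperplane[OF this(2,3,1,4) uvV(1,2), where ?'a = 'a]
    obtain z0 :: "'v \<Rightarrow> 'a" where "D (z0(u := z0 v)) \<noteq> 0" unfolding D_def by blast
    then show ?thesis
      by (rule polyfun_mult_eq_0[OF polyfun_merge[OF p uvV(2)] polyfun_merge[OF D uvV(2)] _ 0])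
  qed
  obtain e where e: "e \<in> polyfun (U \<union> W)" "\<And>z. p z = diffprod P z * e z"
    using polyfun_dvd_diffprod[OF P(1) P' P(3) p vanish] by blast
  have "e z = g z" if z: "inj_on z U" "inj_on z W" for z
  proof -
    have "diffprod P z \<noteq> 0"
    proof
      assume "diffprod P z = 0"
      then obtain a b where ab: "(a, b) \<in> P" "z a = z b" using diffprod_eq_0_iff[OF P(1)] by blast
      then have "a \<noteq> b" "a \<in> U \<and> b \<in> U \<or> a \<in> W \<and> b \<in> W" using P by (auto simp: oriented_def)
      then show False using z ab(2) by (auto dest: inj_onD)
    qed
    then show ?thesis using eq[OF z] e(2)[of z] by simp
  qed
  with e(1) show ?thesis by blast
qed

section \<open>The lifting operator\<close>

text \<open>The denominators are those of Lagrange interpolation in the two blocks. The cross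
  differences in the numerator kill the weights with exactly one of \<open>i = p\<close>,
  \<open>j = q\<close> on the diagonal \<open>z p = z q\<close>. Division by zero gives 0, so the
  weight is meaningful only where coordinates within a block are distinct.\<close>

definition lift_weight :: "'v set \<Rightarrow> 'v set \<Rightarrow> 'v \<Rightarrow> 'v \<Rightarrow> ('v \<Rightarrow> 'a::field) \<Rightarrow> 'a" where
  "lift_weight U W i j z =
    ((\<Prod>j'\<in>W-{j}. z i - z j') * (\<Prod>i'\<in>U-{i}. z i' - z j)) /
    ((\<Prod>i'\<in>U-{i}. z i' - z i) * (\<Prod>j'\<in>W-{j}. z j - z j'))"

text \<open>The argument \<open>h\<close> takes the variables other than \<open>p\<close> and
  \<open>q\<close>. The transpositions move \<open>z p\<close> and \<open>z q\<close> to the places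
  \<open>i\<close> and \<open>j\<close>, so that \<open>h\<close> is fed exactly the coordinates
  other than \<open>z i\<close> and \<open>z j\<close>.\<close>

definition lift_sum :: "'v set \<Rightarrow> 'v set \<Rightarrow> 'v \<Rightarrow> 'v \<Rightarrow> (('v \<Rightarrow> 'a::field) \<Rightarrow> 'a) \<Rightarrow> ('v \<Rightarrow> 'a) \<Rightarrow> 'a" where
  "lift_sum U W p q h z =
    (\<Sum>i\<in>U. \<Sum>j\<in>W. h (z \<circ> (transp i p \<circ> transp j q)) * lift_weight U W i j z)"

definition contract_sum :: "'v set \<Rightarrow> 'v set \<Rightarrow> (('v \<Rightarrow> 'a::field) \<Rightarrow> 'a) \<Rightarrow> ('v \<Rightarrow> 'a) \<Rightarrow> 'a" where
  "contract_sum U W f z = (\<Sum>i\<in>U. \<Sum>j\<in>W. f (z(i := 0, j := 0)) * lift_weight U W i j z)"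

lemma polyfun_fix_two:
  assumes "f \<in> polyfun V" "V - {p, q} \<subseteq> V'"
  shows "(\<lambda>z. f (z(p := s, q := s))) \<in> polyfun V'"
proof (rule polyfun_subst[OF assms(1)])
  fix v assume "v \<in> V"
  then consider "v = q" | "v = p" "v \<noteq> q" | "v \<in> V'" "v \<noteq> p" "v \<noteq> q" using assms(2) by blast
  then show "(\<lambda>z. (z(p := s, q := s)) v) \<in> polyfun V'"
    by cases (auto intro: polyfun_intros)
qed

lemma prod_Diff_reindex:
  assumes "inj \<pi>" "\<pi> ` S = S"
  shows "(\<Prod>x\<in>S - {a}. g (\<pi> x)) = (\<Prod>x\<in>S - {\<pi> a}. g x)"
proof (rule prod.reindex_bij_betw)
  have "\<pi> ` (S - {a}) = S - {\<pi> a}" using assms by (simp add: image_set_diff)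
  then show "bij_betw \<pi> (S - {a}) (S - {\<pi> a})"
    unfolding bij_betw_def using assms(1) inj_on_subset by blast
qed

lemma lift_weight_perm:
  assumes "\<pi> \<in> block_perms U W"
  shows "lift_weight U W i j (z \<circ> \<pi>) = lift_weight U W (\<pi> i) (\<pi> j) z"
proof -
  have \<pi>: "inj \<pi>" "\<pi> ` U = U" "\<pi> ` W = W"
    using assms by (auto simp: block_perms_def dest: permutes_inj)
  show ?thesis
    unfolding lift_weight_def o_def
    using prod_Diff_reindex[OF \<pi>(1,2), of "\<lambda>x. z x - z (\<pi> j)" i] prod_Diff_reindex[OF \<pi>(1,3), of "\<lambda>x. z (\<pi> i) - z x" j]
      prod_Diff_reindex[OF \<pi>(1,2), of "\<lambda>x. z x - z (\<pi> i)" i] prod_Diff_reindex[OF \<pi>(1,3), of "\<lambda>x. z (\<pi> j) - z x" j]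
    by simp
qed

section \<open>The lift from the smaller blocks\<close>

context
  fixes U W :: "'v set" and p q :: 'v
  assumes fin: "finite U" "finite W" and UW: "U \<inter> W = {}" and pq: "p \<in> U" "q \<in> W"
begin

lemma lift_sum_perm:
  assumes h: "h \<in> symalg (U - {p}) (W - {q})" and \<pi>: "\<pi> \<in> block_perms U W"
  shows "lift_sum U W p q h (z \<circ> \<pi>) = lift_sum U W p q h z"
proof -
  have bij: "bij_betw \<pi> U U" "bij_betw \<pi> W W"
    using \<pi> by (auto simp: block_perms_def bij_betw_def dest: permutes_inj_on)
  have "h ((z \<circ> \<pi>) \<circ> (transp i p \<circ> transp j q)) = h (z \<circ> (transp (\<pi> i) p \<circ> transp (\<pi> j) q))"
    if ij: "i \<in> U" "j \<in> W" for i j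
  proof -
    let ?t = "transp i p \<circ> transp j q" and ?t' = "transp (\<pi> i) p \<circ> transp (\<pi> j) q"
    \<comment> \<open>The two ways of feeding \<open>h\<close> differ by this block permutation. It
      fixes \<open>p\<close> and \<open>q\<close>, so \<open>h\<close> is invariant under
      it.\<close>
    define \<rho> where "\<rho> = ?t' \<circ> (\<pi> \<circ> ?t)"
    have \<pi>ij: "\<pi> i \<in> U" "\<pi> j \<in> W" using block_perms_in[OF \<pi>] ij by auto
    have "\<rho> \<in> block_perms U W"
      unfolding \<rho>_def using ij \<pi>ij pq UW \<pi>
      by (intro block_perms_comp transp_block_perms) simp_all
    moreover have ne: "p \<noteq> j" "p \<noteq> q" "i \<noteq> q" "\<pi> i \<noteq> q" "\<pi> j \<noteq> p" "\<pi> i \<noteq> \<pi> j" "i \<noteq> j"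
      using ij \<pi>ij pq UW by auto
    then have "\<rho> p = p" "\<rho> q = q"
      by (simp_all add: \<rho>_def Transposition.transpose_def)
    ultimately have "\<rho> \<in> block_perms (U - {p}) (W - {q})"
      using pq UW by (intro block_perms_diff)
    then have "h (z \<circ> ?t' \<circ> \<rho>) = h (z \<circ> ?t')" by (rule symalgD(2)[OF h])
    moreover have "?t' \<circ> ?t' = id"
      using ne by (auto simp: fun_eq_iff Transposition.transpose_def)
    then have "?t' \<circ> \<rho> = \<pi> \<circ> ?t" unfolding \<rho>_def by (metis comp_assoc id_comp)
    then have "z \<circ> ?t' \<circ> \<rho> = (z \<circ> \<pi>) \<circ> ?t" by (metis comp_assoc)
    ultimately show ?thesis by simp
  qed
  then have "lift_sum U W p q h (z \<circ> \<pi>)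
      = (\<Sum>i\<in>U. \<Sum>j\<in>W. h (z \<circ> (transp (\<pi> i) p \<circ> transp (\<pi> j) q)) * lift_weight U W (\<pi> i) (\<pi> j) z)"
    unfolding lift_sum_def by (intro sum.cong refl) (simp add: lift_weight_perm[OF \<pi>])
  also have "\<dots> = (\<Sum>i\<in>U. \<Sum>j\<in>W. h (z \<circ> (transp (\<pi> i) p \<circ> transp j q)) * lift_weight U W (\<pi> i) j z)"
    by (intro sum.cong refl sum.reindex_bij_betw[OF bij(2), of "\<lambda>j. h (z \<circ> (transp (\<pi> _) p \<circ> transp j q)) * lift_weight U W (\<pi> _) j z"])
  also have "\<dots> = lift_sum U W p q h z"
    unfolding lift_sum_def
    by (rule sum.reindex_bij_betw[OF bij(1), of "\<lambda>i. \<Sum>j\<in>W. h (z \<circ> (transp i p \<circ> transp j q)) * lift_weight U W i j z"])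
  finally show ?thesis .
qed

text \<open>The product of the two Vandermonde products is a common denominator of all weights,
  since the denominator of each weight is a subproduct of it up to sign. The symmetry of the whole
  sum then removes the poles by \<open>polyfun_clear_poles\<close>.\<close>

lemma lift_sum_polyfun:
  fixes h :: "('v \<Rightarrow> 'a::field_char_0) \<Rightarrow> 'a"
  assumes h: "h \<in> symalg (U - {p}) (W - {q})"
  shows "\<exists>e\<in>polyfun (U \<union> W). \<forall>z. inj_on z U \<longrightarrow> inj_on z W \<longrightarrow> e z = lift_sum U W p q h z"
proof -
  let ?V = "U \<union> W"
  obtain P where P: "finite P" "P \<subseteq> U \<times> U" "oriented P"
    "\<And>a b. a \<in> U \<Longrightarrow> b \<in> U \<Longrightarrow> a \<noteq> b \<Longrightarrow> (a, b) \<in> P \<or> (b, a) \<in> P"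
    using oriented_pairs[OF fin(1)] by metis
  obtain R where R: "finite R" "R \<subseteq> W \<times> W" "oriented R"
    "\<And>a b. a \<in> W \<Longrightarrow> b \<in> W \<Longrightarrow> a \<noteq> b \<Longrightarrow> (a, b) \<in> R \<or> (b, a) \<in> R"
    using oriented_pairs[OF fin(2)] by metis
  have factor: "\<exists>c\<in>polyfun ?V. \<forall>z :: 'v \<Rightarrow> 'a. diffprod P z = diffprod Q z * c z"
    if P: "finite P" "P \<subseteq> ?V \<times> ?V"
      and Q: "finite Q" "Q \<subseteq> ?V \<times> ?V" "oriented Q" "\<And>a b. (a, b) \<in> Q \<Longrightarrow> (a, b) \<in> P \<or> (b, a) \<in> P"
    for P Q :: "('v \<times> 'v) set"
  proof (rule polyfun_dvd_diffprod[OF Q(1-3) polyfun_diffprod[OF P(2)]])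
    show "diffprod P (z(u := z v)) = 0" if "(u, v) \<in> Q" for u v and z :: "'v \<Rightarrow> 'a"
      unfolding diffprod_eq_0_iff[OF P(1)] using Q(4)[OF that] by (cases "u = v") fastforce+
  qed
  have num: "\<exists>c\<in>polyfun ?V. \<forall>z :: 'v \<Rightarrow> 'a. diffprod P z = (\<Prod>i'\<in>U-{i}. z i' - z i) * c z" if i: "i \<in> U" for i
  proof -
    have "\<exists>c\<in>polyfun ?V. \<forall>z :: 'v \<Rightarrow> 'a. diffprod P z = diffprod ((\<lambda>i'. (i', i)) ` (U - {i})) z * c z"
    proof (rule factor)
      show "(a, b) \<in> P \<or> (b, a) \<in> P" if "(a, b) \<in> (\<lambda>i'. (i', i)) ` (U - {i})" for a b
        by (rule P(4)) (use that i in auto)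
    qed (use P(1,2) i fin in \<open>auto simp: oriented_def\<close>)
    then show ?thesis by (simp add: diffprod_def prod.reindex inj_on_def)
  qed
  have den: "\<exists>c\<in>polyfun ?V. \<forall>z :: 'v \<Rightarrow> 'a. diffprod R z = (\<Prod>j'\<in>W-{j}. z j - z j') * c z" if j: "j \<in> W" for j
  proof -
    have "\<exists>c\<in>polyfun ?V. \<forall>z :: 'v \<Rightarrow> 'a. diffprod R z = diffprod (Pair j ` (W - {j})) z * c z"
    proof (rule factor)
      show "(a, b) \<in> R \<or> (b, a) \<in> R" if "(a, b) \<in> Pair j ` (W - {j})" for a b
        by (rule R(4)) (use that j in auto)
    qed (use R(1,2) j fin in \<open>auto simp: oriented_def\<close>)
    then show ?thesis by (simp add: diffprod_def prod.reindex inj_on_def)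
  qed
  obtain C where C: "\<And>i. i \<in> U \<Longrightarrow> C i \<in> polyfun ?V"
    "\<And>i z. i \<in> U \<Longrightarrow> diffprod P (z :: 'v \<Rightarrow> 'a) = (\<Prod>i'\<in>U-{i}. z i' - z i) * C i z"
    using num by metis
  obtain D where D: "\<And>j. j \<in> W \<Longrightarrow> D j \<in> polyfun ?V"
    "\<And>j z. j \<in> W \<Longrightarrow> diffprod R (z :: 'v \<Rightarrow> 'a) = (\<Prod>j'\<in>W-{j}. z j - z j') * D j z"
    using den by metis
  define N where "N = (\<lambda>z. \<Sum>i\<in>U. \<Sum>j\<in>W. h (z \<circ> (transp i p \<circ> transp j q)) *
    ((\<Prod>j'\<in>W-{j}. z i - z j') * (\<Prod>i'\<in>U-{i}. z i' - z j)) * (C i z * D j z))"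
  have dPR: "diffprod (P \<union> R) z = diffprod P z * diffprod R z" for z :: "'v \<Rightarrow> 'a"
    unfolding diffprod_def using P(1,2) R(1,2) UW by (intro prod.union_disjoint) auto
  show ?thesis
  proof (rule polyfun_clear_poles[OF fin])
    show "finite (P \<union> R)" "P \<union> R \<subseteq> U \<times> U \<union> W \<times> W" using P R by auto
    show "oriented (P \<union> R)" using P(2,3) R(2,3) UW unfolding oriented_def by blast
    show "lift_sum U W p q h (z \<circ> transp u v) = lift_sum U W p q h z"
      if "(u, v) \<in> P \<union> R" for u v z
      by (rule lift_sum_perm[OF h], rule transp_block_perms[OF _ UW]) (use that P(2) R(2) in auto)
    show "U \<inter> W = {}" by (rule UW)
    have "(\<lambda>z. h (z \<circ> (transp i p \<circ> transp j q))) \<in> polyfun ?V" if ij: "i \<in> U" "j \<in> W" for i j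
    proof (rule polyfun_subst[OF symalgD(1)[OF h]])
      fix x assume x: "x \<in> U - {p} \<union> (W - {q})"
      have b: "transp i p \<circ> transp j q \<in> block_perms U W"
        using ij pq UW by (intro block_perms_comp transp_block_perms) simp_all
      have "(transp i p \<circ> transp j q) x \<in> ?V"
        using x block_perms_in(1,2)[OF b, of x] by (cases "x \<in> U") simp_all
      then have "(\<lambda>z. z ((transp i p \<circ> transp j q) x)) \<in> polyfun ?V" by (rule polyfun.var)
      then show "(\<lambda>z. (z \<circ> (transp i p \<circ> transp j q)) x) \<in> polyfun ?V" by simp
    qed
    then show "N \<in> polyfun ?V"
      unfolding N_def using C(1) D(1)
      by (intro polyfun_sum polyfun.mult polyfun_prod polyfun_diff polyfun.var) simp_all
    show "N z = diffprod (P \<union> R) z * lift_sum U W p q h z" if z: "inj_on z U" "inj_on z W" for z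
      unfolding N_def lift_sum_def dPR sum_distrib_left
    proof (intro sum.cong refl)
      fix i j assume ij: "i \<in> U" "j \<in> W"
      have "(\<Prod>i'\<in>U-{i}. z i' - z i) \<noteq> 0" "(\<Prod>j'\<in>W-{j}. z j - z j') \<noteq> 0"
        using z ij fin by (auto simp: prod_zero_iff dest: inj_onD)
      then show "h (z \<circ> (transp i p \<circ> transp j q)) * ((\<Prod>j'\<in>W-{j}. z i - z j') * (\<Prod>i'\<in>U-{i}. z i' - z j)) *
            (C i z * D j z)
          = diffprod P z * diffprod R z * (h (z \<circ> (transp i p \<circ> transp j q)) * lift_weight U W i j z)"
        unfolding C(2)[OF ij(1)] D(2)[OF ij(2)] lift_weight_def by (simp add: field_simps)
    qed
  qed
qed

text \<open>This is \<open>\<rho> \<circ> E = 1 + E \<circ> \<rho>\<close>, for every generic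
  \<open>t\<close> and not only at 0, so that it also yields the supersymmetry of the lift. The pair
  \<open>(p, q)\<close> has weight 1; weights with exactly one of \<open>p\<close>, \<open>q\<close>
  contain the factor \<open>z p - z q = 0\<close>; in the others the four factors with
  \<open>t\<close> cancel, and supersymmetry of \<open>h\<close> replaces \<open>t\<close> by
  0.\<close>

lemma lift_sum_on_diagonal:
  fixes h :: "('v \<Rightarrow> 'a::field_char_0) \<Rightarrow> 'a"
  assumes h: "h \<in> supersym (U - {p}) (W - {q})"
    and z: "inj_on z (U - {p})" "inj_on z (W - {q})"
    and t: "t \<notin> z ` (U - {p})" "t \<notin> z ` (W - {q})"
  shows "lift_sum U W p q h (z(p := t, q := t)) = h z + contract_sum (U - {p}) (W - {q}) h z"
proof -
  let ?U = "U - {p}" and ?W = "W - {q}" and ?z = "z(p := t, q := t)"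
  define T where "T i j = h (?z \<circ> (transp i p \<circ> transp j q)) * lift_weight U W i j ?z" for i j
  have pnq: "p \<noteq> q" using pq UW by auto
  have Ueq: "U = insert p ?U" and Weq: "W = insert q ?W" using pq by auto
  have zU: "?z x = z x" if "x \<in> ?U" for x using that pq UW by auto
  have zW: "?z x = z x" if "x \<in> ?W" for x using that pq UW by auto
  have hz: "h ?z = h z"
    by (rule polyfun_cong[OF supersymD(2)[OF h]]) (use pq UW in auto)
  have nz: "(\<Prod>x\<in>?U. z x - t) \<noteq> 0" "(\<Prod>x\<in>?W. t - z x) \<noteq> 0"
    using t fin by (auto simp: prod_zero_iff)
  have "T p q = h z"
  proof -
    have "lift_weight U W p q ?z = ((\<Prod>x\<in>?W. t - z x) * (\<Prod>x\<in>?U. z x - t)) / ((\<Prod>x\<in>?U. z x - t) * (\<Prod>x\<in>?W. t - z x))"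
    proof -
      have P: "(\<Prod>x\<in>?W. ?z y - ?z x) = (\<Prod>x\<in>?W. t - z x)" "(\<Prod>x\<in>?U. ?z x - ?z y) = (\<Prod>x\<in>?U. z x - t)"
        if "y = p \<or> y = q" for y
      proof -
        have y: "?z y = t" using that pnq by auto
        then show "(\<Prod>x\<in>?W. ?z y - ?z x) = (\<Prod>x\<in>?W. t - z x)" "(\<Prod>x\<in>?U. ?z x - ?z y) = (\<Prod>x\<in>?U. z x - t)"
          unfolding y by (intro prod.cong refl; simp only: zU zW)+
      qed
      show ?thesis using P[of p] P[of q] unfolding lift_weight_def by (simp del: fun_upd_apply)
    qed
    then show ?thesis using nz hz by (simp add: T_def)
  qed
  moreover have "T p j = 0" if j: "j \<in> ?W" for j
  proof -
    have "(\<Prod>x\<in>W - {j}. ?z p - ?z x) = 0"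
      using j pq fin pnq by (intro prod_zero) (auto intro!: bexI[of _ q])
    then show ?thesis unfolding T_def lift_weight_def by (simp del: fun_upd_apply)
  qed
  moreover have "T i q = 0" if i: "i \<in> ?U" for i
  proof -
    have "(\<Prod>x\<in>U - {i}. ?z x - ?z q) = 0"
      using i pq fin pnq by (intro prod_zero) (auto intro!: bexI[of _ p])
    then show ?thesis unfolding T_def lift_weight_def by (simp del: fun_upd_apply)
  qed
  moreover have "T i j = h (z(i := 0, j := 0)) * lift_weight ?U ?W i j z" if i: "i \<in> ?U" and j: "j \<in> ?W" for i j
  proof -
    have ne: "i \<noteq> p" "j \<noteq> q" "i \<noteq> q" "j \<noteq> p" "i \<noteq> j" using i j pq UW by auto
    have "h (?z \<circ> (transp i p \<circ> transp j q)) = h (z(i := t, j := t))"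
    proof (rule polyfun_cong[OF supersymD(2)[OF h]])
      fix x assume "x \<in> ?U \<union> ?W"
      then have "x \<noteq> p" "x \<noteq> q" using pq UW by auto
      then show "(?z \<circ> (transp i p \<circ> transp j q)) x = (z(i := t, j := t)) x"
        using ne pnq by (auto simp: Transposition.transpose_def)
    qed
    also have "\<dots> = h (z(i := 0, j := 0))" by (rule supersymD(3)[OF h i j])
    finally have 1: "h (?z \<circ> (transp i p \<circ> transp j q)) = h (z(i := 0, j := 0))" .
    have sets: "W - {j} = insert q (?W - {j})" "U - {i} = insert p (?U - {i})"
      using pq ne by auto
    have zi: "?z i = z i" "?z j = z j" using ne by auto
    have prods: "(\<Prod>x\<in>W - {j}. ?z i - ?z x) = (z i - t) * (\<Prod>x\<in>?W - {j}. z i - z x)"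
      "(\<Prod>x\<in>U - {i}. ?z x - ?z j) = (t - z j) * (\<Prod>x\<in>?U - {i}. z x - z j)"
      "(\<Prod>x\<in>U - {i}. ?z x - ?z i) = (t - z i) * (\<Prod>x\<in>?U - {i}. z x - z i)"
      "(\<Prod>x\<in>W - {j}. ?z j - ?z x) = (z j - t) * (\<Prod>x\<in>?W - {j}. z j - z x)"
      unfolding sets zi using fin zU zW pnq
      by (subst prod.insert; auto simp del: fun_upd_apply intro!: prod.cong; simp)+
    have "(z i - t) * (t - z j) = (t - z i) * (z j - t)" by (simp add: algebra_simps)
    moreover have "t - z i \<noteq> 0" "z j - t \<noteq> 0" using t i j by auto
    ultimately have "lift_weight U W i j ?z = lift_weight ?U ?W i j z"
      unfolding lift_weight_def prods by (simp add: divide_simps)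
    with 1 show ?thesis unfolding T_def by simp
  qed
  ultimately have T: "T p q = h z" "\<And>j. j \<in> ?W \<Longrightarrow> T p j = 0" "\<And>i. i \<in> ?U \<Longrightarrow> T i q = 0"
    "\<And>i j. i \<in> ?U \<Longrightarrow> j \<in> ?W \<Longrightarrow> T i j = h (z(i := 0, j := 0)) * lift_weight ?U ?W i j z"
    by blast+
  have W: "(\<Sum>j\<in>W. T i j) = T i q + (\<Sum>j\<in>?W. T i j)" for i
    by (rule sum.remove[OF fin(2) pq(2)])
  have "lift_sum U W p q h ?z = (\<Sum>i\<in>U. \<Sum>j\<in>W. T i j)" by (simp add: lift_sum_def T_def)
  also have "\<dots> = (T p q + (\<Sum>j\<in>?W. T p j)) + (\<Sum>i\<in>?U. T i q + (\<Sum>j\<in>?W. T i j))"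
    unfolding W by (rule sum.remove[OF fin(1) pq(1)])
  also have "\<dots> = h z + contract_sum ?U ?W h z"
    unfolding contract_sum_def using T by simp
  finally show ?thesis .
qed

lemma lift_exists:
  fixes h :: "('v \<Rightarrow> 'a::field_char_0) \<Rightarrow> 'a"
  assumes h: "h \<in> supersym (U - {p}) (W - {q})"
  obtains e where "e \<in> supersym U W"
    "\<And>z. inj_on z U \<Longrightarrow> inj_on z W \<Longrightarrow> e z = lift_sum U W p q h z"
    "\<And>z. inj_on z (U - {p}) \<Longrightarrow> inj_on z (W - {q}) \<Longrightarrow>
      e (z(p := 0, q := 0)) = h z + contract_sum (U - {p}) (W - {q}) h z"
proof -
  let ?U = "U - {p}" and ?W = "W - {q}"
  have hs: "h \<in> symalg ?U ?W" using h by (rule supersymD)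
  obtain e where e: "e \<in> polyfun (U \<union> W)" "\<And>z. inj_on z U \<Longrightarrow> inj_on z W \<Longrightarrow> e z = lift_sum U W p q h z"
    using lift_sum_polyfun[OF hs] by blast
  have curve: "(\<lambda>z. e (z(p := s, q := s))) \<in> polyfun (U \<union> W)" for s
    by (rule polyfun_fix_two[OF e(1)]) auto
  have diag: "e (z(p := s, q := s)) = h z + contract_sum ?U ?W h z"
    if z: "inj_on z ?U" "inj_on z ?W" for z s
  proof -
    \<comment> \<open>The sum formula may fail where \<open>t\<close> collides with another
      coordinate, possibly at \<open>t = 0\<close>. But \<open>e\<close> is polynomial along the
      diagonal and takes the same value for all but finitely many \<open>t\<close>, so it is
      constant there.\<close>
    have "\<exists>P. \<forall>t. e (z(p := t, q := t)) = poly P t"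
    proof (rule polyfun_along_curve[OF e(1)])
      fix v
      consider "v = p \<or> v = q" | "v \<noteq> p" "v \<noteq> q" by blast
      then show "\<exists>P. \<forall>t. (z(p := t, q := t)) v = poly P t"
      proof cases
        case 1
        then show ?thesis by (intro exI[of _ "[:0, 1:]"]) auto
      next
        case 2
        then show ?thesis by (intro exI[of _ "[:z v:]"]) simp
      qed
    qed
    then obtain P where "\<forall>t. e (z(p := t, q := t)) = poly P t" by (rule exE)
    then have P: "\<And>t. e (z(p := t, q := t)) = poly P t" by (rule spec)
    let ?c = "h z + contract_sum ?U ?W h z" and ?F = "z ` ?U \<union> z ` ?W"
    have eq: "poly P t = ?c" if t: "t \<notin> ?F" for t
    proof -
      let ?z = "z(p := t, q := t)"
      have zU: "?z x = z x" if "x \<in> ?U" for x using that pq UW by auto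
      have zW: "?z x = z x" if "x \<in> ?W" for x using that pq UW by auto
      have "inj_on ?z ?U" "inj_on ?z ?W"
        using z inj_on_cong[of ?U ?z z, OF zU] inj_on_cong[of ?W ?z z, OF zW] by blast+
      moreover have im: "?z ` ?U = z ` ?U" "?z ` ?W = z ` ?W"
        by (rule image_cong[OF refl zU], assumption) (rule image_cong[OF refl zW], assumption)
      have "?z p = t" "?z q = t" by auto
      then have "?z p \<notin> ?z ` ?U" "?z q \<notin> ?z ` ?W"
        using t by (simp_all only: im Un_iff de_Morgan_disj not_False_eq_True)
      ultimately have "inj_on ?z (insert p ?U)" "inj_on ?z (insert q ?W)"
        by (simp_all only: inj_on_insert Diff_insert_absorb Diff_idemp simp_thms)
      then have *: "inj_on ?z U" "inj_on ?z W" using pq by (simp_all only: insert_Diff)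
      show ?thesis
        using P[of t] e(2)[OF *] lift_sum_on_diagonal[OF h z, of t] t by simp
    qed
    have "P - [:?c:] = 0"
    proof (rule ccontr)
      assume "P - [:?c:] \<noteq> 0"
      then have "finite {t. poly (P - [:?c:]) t = 0}" by (rule poly_roots_finite)
      moreover have "UNIV \<subseteq> {t. poly (P - [:?c:]) t = 0} \<union> ?F" using eq by auto
      ultimately have "finite (UNIV :: 'a set)"
        using fin by (meson finite_Diff finite_UnI finite_imageI finite_subset)
      then show False using infinite_UNIV_char_0 by blast
    qed
    then have "poly (P - [:?c:]) s = 0" by simp
    then show ?thesis using P[of s] by simp
  qed
  show ?thesis
  proof
    show "e \<in> supersym U W"
    proof (rule supersymI[OF _ pq UW])
      show "e \<in> symalg U W"
        unfolding symalg_def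
      proof (intro CollectI conjI ballI allI e(1))
        fix \<pi> z assume \<pi>: "\<pi> \<in> block_perms U W"
        have "e (z \<circ> \<pi>) - e z = 0"
        proof (rule polyfun_generic_density[OF _ fin, of "\<lambda>z. e (z \<circ> \<pi>) - e z"])
          have "(\<lambda>z. (z \<circ> \<pi>) v) \<in> polyfun (U \<union> W)" if "v \<in> U \<union> W" for v
            using block_perms_in(1,2)[OF \<pi>, of v] that by (auto intro: polyfun.var)
          then show "(\<lambda>z. e (z \<circ> \<pi>) - e z) \<in> polyfun (U \<union> W)"
            by (intro polyfun_diff polyfun_subst[OF e(1)] e(1))
          fix z :: "'v \<Rightarrow> 'a" assume z: "inj_on z U" "inj_on z W"
          have \<pi>': "\<pi> ` U = U" "\<pi> ` W = W" "inj \<pi>" using \<pi> by (auto simp: block_perms_def dest: permutes_inj)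
          have "inj_on (z \<circ> \<pi>) U" "inj_on (z \<circ> \<pi>) W"
            using z \<pi>' by (intro comp_inj_on; simp add: inj_on_subset[OF \<pi>'(3)])+
          then show "e (z \<circ> \<pi>) - e z = 0"
            using e(2)[of "z \<circ> \<pi>"] e(2)[OF z] lift_sum_perm[OF hs \<pi>] by simp
        qed
        then show "e (z \<circ> \<pi>) = e z" by simp
      qed
      fix z :: "'v \<Rightarrow> 'a" and s t
      have "e (z(p := s, q := s)) - e (z(p := t, q := t)) = 0"
      proof (rule polyfun_generic_density[OF _ fin, of "\<lambda>z. e (z(p := s, q := s)) - e (z(p := t, q := t))"])
        show "(\<lambda>z. e (z(p := s, q := s)) - e (z(p := t, q := t))) \<in> polyfun (U \<union> W)"
          by (intro polyfun_diff curve)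
        fix z :: "'v \<Rightarrow> 'a" assume "inj_on z U" "inj_on z W"
        then have "inj_on z ?U" "inj_on z ?W" by (auto intro: inj_on_subset)
        from diag[OF this] show "e (z(p := s, q := s)) - e (z(p := t, q := t)) = 0" by simp
      qed
      then show "e (z(p := s, q := s)) = e (z(p := t, q := t))" by simp
    qed
  qed (fact e(2), fact diag)
qed

section \<open>Restriction to the smaller blocks\<close>

lemma restrict_supersym:
  fixes f :: "('v \<Rightarrow> 'a::comm_ring_1) \<Rightarrow> 'a"
  assumes f: "f \<in> supersym U W"
  shows "(\<lambda>z. f (z(p := 0, q := 0))) \<in> supersym (U - {p}) (W - {q})"
  unfolding supersym_def symalg_def
proof (intro CollectI conjI ballI allI)
  have f': "f \<in> symalg U W" "f \<in> polyfun (U \<union> W)" using f by (rule supersymD)+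
  show "(\<lambda>z. f (z(p := 0, q := 0))) \<in> polyfun (U - {p} \<union> (W - {q}))"
    by (rule polyfun_fix_two[OF f'(2)]) auto
  fix z :: "'v \<Rightarrow> 'a"
  {
    fix \<pi> assume "\<pi> \<in> block_perms (U - {p}) (W - {q})"
    note \<pi> = block_perms_mono[OF this pq UW]
    have inj: "inj \<pi>" by (rule block_perms_in(3)[OF \<pi>(1)])
    then have "\<pi> x = p \<longleftrightarrow> x = p" "\<pi> x = q \<longleftrightarrow> x = q" for x
      using \<pi>(2,3) by (metis injD)+
    then have "(z \<circ> \<pi>)(p := 0, q := 0) = z(p := 0, q := 0) \<circ> \<pi>"
      by (auto simp: fun_eq_iff)
    then show "f ((z \<circ> \<pi>)(p := 0, q := 0)) = f (z(p := 0, q := 0))"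
      using symalgD(2)[OF f'(1) \<pi>(1)] by simp
  next
    fix i j s t assume ij: "i \<in> U - {p}" "j \<in> W - {q}"
    then have "i \<noteq> p" "j \<noteq> q" "i \<noteq> q" "j \<noteq> p" using pq UW by auto
    then have "(z(i := r, j := r))(p := 0, q := 0) = (z(p := 0, q := 0))(i := r, j := r)" for r
      by (auto simp: fun_eq_iff)
    then show "f ((z(i := s, j := s))(p := 0, q := 0)) = f ((z(i := t, j := t))(p := 0, q := 0))"
      using supersymD(3)[OF f, of i j] ij by simp
  }
qed

lemma supersym_at_zeros:
  assumes f: "f \<in> supersym U W" and ij: "i \<in> U" "j \<in> W"
  shows "f (z(i := 0, j := 0)) = f ((z \<circ> (transp i p \<circ> transp j q))(p := 0, q := 0))"
proof -
  let ?\<pi> = "transp i p \<circ> transp j q"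
  have \<pi>: "?\<pi> \<in> block_perms U W"
    using ij pq UW by (intro block_perms_comp transp_block_perms) simp_all
  have "i \<noteq> j" "i \<noteq> q" "p \<noteq> j" "p \<noteq> q" using ij pq UW by auto
  then have "(z(i := 0, j := 0)) \<circ> ?\<pi> = (z \<circ> ?\<pi>)(p := 0, q := 0)"
    by (auto simp: fun_eq_iff Transposition.transpose_def)
  then show ?thesis using symalgD(2)[OF supersymD(1)[OF f] \<pi>] by metis
qed

end

text \<open>If \<open>E\<close> denotes the lifting operator and \<open>\<rho>\<close> the restriction to \<open>z p = z q = 0\<close>, then
  \<open>\<rho> \<circ> E = 1 + E \<circ> \<rho>\<close>, so the eigenvalues of \<open>E \<circ> \<rho>\<close> are natural numbers and \<open>c + E \<circ> \<rho>\<close> is invertible.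
  \<open>contract_sum\<close> is the composition \<open>E \<circ> \<rho>\<close>.\<close>

lemma contract_sum_solvable:
  fixes f :: "('v \<Rightarrow> 'a::field_char_0) \<Rightarrow> 'a"
  assumes "finite U" "finite W" "U \<inter> W = {}" "c > 0" "f \<in> supersym U W"
  shows "\<exists>g\<in>supersym U W. \<forall>z. inj_on z U \<longrightarrow> inj_on z W \<longrightarrow> of_nat c * g z + contract_sum U W g z = f z"
  using assms
proof (induction "card U" arbitrary: U W c f rule: less_induct)
  case less
  have scale: "(\<lambda>z. g z * inverse (of_nat c)) \<in> supersym U W" if "g \<in> supersym U W" for g
    by (rule supersym_intros(3)[OF that supersym_const])
  have c: "of_nat c * inverse (of_nat c :: 'a) = 1" using less.prems(4) by simp
  show ?case
  proof (cases "U = {} \<or> W = {}")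
    case True
    then have "contract_sum U W g z = 0" for g :: "('v \<Rightarrow> 'a) \<Rightarrow> 'a" and z
      by (auto simp: contract_sum_def)
    then show ?thesis using scale[OF less.prems(5)] less.prems(4)
      by (intro bexI[of _ "\<lambda>z. f z * inverse (of_nat c)"]) simp_all
  next
    case False
    then obtain p q where pq: "p \<in> U" "q \<in> W" by blast
    let ?U = "U - {p}" and ?W = "W - {q}" and ?\<rho> = "\<lambda>f z. f (z(p := 0, q := 0))"
    note ctx = less.prems(1-3) pq
    have "card ?U < card U" using pq less.prems(1) by (intro psubset_card_mono) auto
    then have "\<exists>h\<in>supersym ?U ?W. \<forall>z. inj_on z ?U \<longrightarrow> inj_on z ?W \<longrightarrow>
        of_nat (Suc c) * h z + contract_sum ?U ?W h z = ?\<rho> f z"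
      using less.prems(1-3) by (intro less.hyps restrict_supersym[OF ctx less.prems(5)]) auto
    then obtain h where h: "h \<in> supersym ?U ?W"
      "\<And>z. inj_on z ?U \<Longrightarrow> inj_on z ?W \<Longrightarrow> of_nat (Suc c) * h z + contract_sum ?U ?W h z = ?\<rho> f z"
      by blast
    obtain e where e: "e \<in> supersym U W"
      "\<And>z. inj_on z U \<Longrightarrow> inj_on z W \<Longrightarrow> e z = lift_sum U W p q h z"
      "\<And>z. inj_on z ?U \<Longrightarrow> inj_on z ?W \<Longrightarrow> ?\<rho> e z = h z + contract_sum ?U ?W h z"
      by (rule lift_exists[OF ctx h(1)]) blast
    \<comment> \<open>The original equation solved for \<open>g\<close> under the expectation that
      \<open>g\<close> restricts to \<open>h\<close>, with \<open>e\<close> for the lift of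
      \<open>h\<close>. That expectation is verified below, at the points obtained by permuting
      \<open>z\<close>.\<close>
    define g where "g = (\<lambda>z. (f z - e z) * inverse (of_nat c))"
    have "g \<in> supersym U W" unfolding g_def by (intro scale supersym_intros less.prems(5) e(1))
    moreover have "of_nat c * g z + contract_sum U W g z = f z" if z: "inj_on z U" "inj_on z W" for z
    proof -
      have "g (z(i := 0, j := 0)) = h (z \<circ> (transp i p \<circ> transp j q))" if ij: "i \<in> U" "j \<in> W" for i j
      proof -
        let ?\<pi> = "transp i p \<circ> transp j q"
        have \<pi>: "?\<pi> \<in> block_perms U W"
          using ij pq less.prems(3) by (intro block_perms_comp transp_block_perms) simp_all
        have \<pi>': "?\<pi> ` U = U" "?\<pi> ` W = W" "inj ?\<pi>" using \<pi> by (auto simp: block_perms_def dest: permutes_inj)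
        have "inj_on (z \<circ> ?\<pi>) U" "inj_on (z \<circ> ?\<pi>) W"
          using z \<pi>' by (intro comp_inj_on[of ?\<pi>]; simp add: inj_on_subset[OF \<pi>'(3)] del: o_apply)+
        then have w: "inj_on (z \<circ> ?\<pi>) ?U" "inj_on (z \<circ> ?\<pi>) ?W" by (auto intro: inj_on_subset)
        have "f (z(i := 0, j := 0)) - e (z(i := 0, j := 0)) = ?\<rho> f (z \<circ> ?\<pi>) - ?\<rho> e (z \<circ> ?\<pi>)"
          using supersym_at_zeros[OF ctx less.prems(5) ij] supersym_at_zeros[OF ctx e(1) ij] by metis
        also have "\<dots> = of_nat c * h (z \<circ> ?\<pi>)"
          unfolding e(3)[OF w] h(2)[OF w, symmetric] by (simp add: algebra_simps)
        finally show ?thesis unfolding g_def using c by (simp add: mult.commute mult.left_commute)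
      qed
      then have "contract_sum U W g z = lift_sum U W p q h z"
        unfolding contract_sum_def lift_sum_def by (intro sum.cong refl) simp
      then have "contract_sum U W g z = e z" using e(2)[OF z] by simp
      moreover have "of_nat c * g z = (f z - e z) * (of_nat c * inverse (of_nat c))"
        unfolding g_def by (simp only: mult_ac)
      ultimately show ?thesis unfolding c by simp
    qed
    ultimately show ?thesis by blast
  qed
qed

text \<open>The preimage of \<open>f\<close> is the lift of the \<open>g\<close> with
  \<open>g + E (\<rho> g) = f\<close>: restricting that lift gives back
  \<open>g + E (\<rho> g)\<close>.\<close>

lemma restrict_supersym_surj:
  fixes f :: "('v \<Rightarrow> 'a::field_char_0) \<Rightarrow> 'a"
  assumes ctx: "finite U" "finite W" "U \<inter> W = {}" "p \<in> U" "q \<in> W"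
    and f: "f \<in> supersym (U - {p}) (W - {q})"
  shows "\<exists>e\<in>supersym U W. \<forall>z. e (z(p := 0, q := 0)) = f z"
proof -
  let ?U = "U - {p}" and ?W = "W - {q}"
  have fin: "finite ?U" "finite ?W" "?U \<inter> ?W = {}" using ctx by auto
  obtain g where g: "g \<in> supersym ?U ?W"
    "\<And>z. inj_on z ?U \<Longrightarrow> inj_on z ?W \<Longrightarrow> of_nat 1 * g z + contract_sum ?U ?W g z = f z"
    using contract_sum_solvable[OF fin zero_less_one f] by blast
  obtain e where e: "e \<in> supersym U W"
    "\<And>z. inj_on z ?U \<Longrightarrow> inj_on z ?W \<Longrightarrow> e (z(p := 0, q := 0)) = g z + contract_sum ?U ?W g z"
    by (rule lift_exists[OF ctx g(1)]) blast
  have "e (z(p := 0, q := 0)) - f z = 0" for z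
  proof (rule polyfun_generic_density[OF _ fin(1,2), of "\<lambda>z. e (z(p := 0, q := 0)) - f z"])
    show "(\<lambda>z. e (z(p := 0, q := 0)) - f z) \<in> polyfun (?U \<union> ?W)"
      using restrict_supersym[OF ctx e(1)] f by (intro polyfun_diff supersymD(2))
    show "e (z(p := 0, q := 0)) - f z = 0" if "inj_on z ?U" "inj_on z ?W" for z
      using e(2)[OF that] g(2)[OF that] by simp
  qed
  then have "\<forall>z. e (z(p := 0, q := 0)) = f z" by simp
  then show ?thesis using e(1) by (rule bexI)
qed

section \<open>Ideals of the algebra of supersymmetric polynomial functions\<close>

definition crossdiff :: "'v set \<Rightarrow> 'v set \<Rightarrow> ('v \<Rightarrow> 'a::comm_ring_1) \<Rightarrow> 'a" where
  "crossdiff U W z = (\<Prod>i\<in>U. \<Prod>j\<in>W. z i - z j)"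

definition block_sum :: "'v set \<Rightarrow> 'v set \<Rightarrow> (('v \<Rightarrow> 'a::comm_ring_1) \<Rightarrow> 'a) \<Rightarrow> ('v \<Rightarrow> 'a) \<Rightarrow> 'a" where
  "block_sum U W F z = (\<Sum>\<pi>\<in>block_perms U W. F (z \<circ> \<pi>))"

lemma subring1_supersym: "subring1 (supersym U W)"
  unfolding subring1_def plus_fun_def times_fun_def fun_diff_def zero_fun_def one_fun_def
  by (intro conjI ballI supersym_const supersym_intros)

lemma block_perms_bij:
  assumes "\<pi> \<in> block_perms U W"
  shows "bij_betw \<pi> U U" "bij_betw \<pi> W W"
  using assms by (auto simp: block_perms_def bij_betw_def dest: permutes_inj_on)

lemma finite_block_perms: "finite U \<Longrightarrow> finite W \<Longrightarrow> finite (block_perms U W)"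
  by (rule finite_subset[of _ "{\<pi>. \<pi> permutes (U \<union> W)}"])
    (auto simp: block_perms_def intro: finite_permutations)

lemma id_block_perms: "id \<in> block_perms U W"
  by (auto simp: block_perms_def permutes_id)

lemma polyfun_comp_block_perm:
  assumes "f \<in> polyfun (U \<union> W)" "\<pi> \<in> block_perms U W"
  shows "(\<lambda>z. f (z \<circ> \<pi>)) \<in> polyfun (U \<union> W)"
proof (rule polyfun_subst[OF assms(1)])
  show "(\<lambda>z. (z \<circ> \<pi>) v) \<in> polyfun (U \<union> W)" if "v \<in> U \<union> W" for v
    using block_perms_in(1,2)[OF assms(2), of v] that by (auto intro: polyfun.var)
qed

lemma block_sum_symalg:
  assumes "F \<in> polyfun (U \<union> W)"
  shows "block_sum U W F \<in> symalg U W"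
  unfolding symalg_def
proof (intro CollectI conjI ballI allI)
  show "block_sum U W F \<in> polyfun (U \<union> W)"
    unfolding block_sum_def[abs_def] by (intro polyfun_sum polyfun_comp_block_perm[OF assms])
  fix \<sigma> z assume \<sigma>: "\<sigma> \<in> block_perms U W"
  then have perm: "\<sigma> permutes (U \<union> W)" by (simp add: block_perms_def)
  have im: "\<sigma> ` U = U" "\<sigma> ` W = W" using \<sigma> by (simp_all add: block_perms_def)
  have "inv_into UNIV \<sigma> ` U = U" "inv_into UNIV \<sigma> ` W = W"
    using image_inv_f_f[OF permutes_inj[OF perm], of U] image_inv_f_f[OF permutes_inj[OF perm], of W]
    unfolding im by simp_all
  then have inv: "inv_into UNIV \<sigma> \<in> block_perms U W"
    using permutes_inv[OF perm] by (simp add: block_perms_def)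
  have "block_sum U W F (z \<circ> \<sigma>) = (\<Sum>\<pi>\<in>block_perms U W. F (z \<circ> (\<sigma> \<circ> \<pi>)))"
    by (simp add: block_sum_def comp_assoc)
  also have "\<dots> = block_sum U W F z"
    unfolding block_sum_def
  proof (rule sum.reindex_bij_witness[of _ "\<lambda>\<pi>. inv_into UNIV \<sigma> \<circ> \<pi>" "\<lambda>\<pi>. \<sigma> \<circ> \<pi>"])
    fix \<pi> :: "'a \<Rightarrow> 'a"
    show "inv_into UNIV \<sigma> \<circ> (\<sigma> \<circ> \<pi>) = \<pi>" "\<sigma> \<circ> (inv_into UNIV \<sigma> \<circ> \<pi>) = \<pi>"
      using permutes_inv_o[OF perm] by (simp_all add: comp_assoc[symmetric])
  qed (simp_all add: block_perms_comp \<sigma> inv)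
  finally show "block_sum U W F (z \<circ> \<sigma>) = block_sum U W F z" .
qed

lemma block_sum_mult_symalg:
  assumes "f \<in> symalg U W"
  shows "block_sum U W (\<lambda>z. f z * F z) z = f z * block_sum U W F z"
  unfolding block_sum_def sum_distrib_left using symalgD(2)[OF assms] by (intro sum.cong) simp_all

lemma crossdiff_symalg: "crossdiff U W \<in> symalg U W"
  unfolding symalg_def
proof (intro CollectI conjI ballI allI)
  show "crossdiff U W \<in> polyfun (U \<union> W)"
    unfolding crossdiff_def[abs_def] by (intro polyfun_prod polyfun_diff polyfun.var) auto
  fix \<pi> z assume \<pi>: "\<pi> \<in> block_perms U W"
  have "crossdiff U W (z \<circ> \<pi>) = (\<Prod>i\<in>U. \<Prod>j\<in>W. z (\<pi> i) - z (\<pi> j))"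
    by (simp add: crossdiff_def)
  also have "\<dots> = (\<Prod>i\<in>U. \<Prod>j\<in>W. z (\<pi> i) - z j)"
    by (intro prod.cong refl prod.reindex_bij_betw[OF block_perms_bij(2)[OF \<pi>]])
  also have "\<dots> = crossdiff U W z"
    unfolding crossdiff_def by (rule prod.reindex_bij_betw[OF block_perms_bij(1)[OF \<pi>]])
  finally show "crossdiff U W (z \<circ> \<pi>) = crossdiff U W z" .
qed

lemma crossdiff_eq_0:
  assumes "finite U" "finite W" "i \<in> U" "j \<in> W" "z i = z j"
  shows "crossdiff U W z = 0"
proof -
  have "(\<Prod>j\<in>W. z i - z j) = 0" using assms by (intro prod_zero) auto
  then show ?thesis unfolding crossdiff_def using assms(1,3) by (intro prod_zero) blast+
qed

text \<open>The product is 0 on every diagonal \<open>z i = z j\<close>, hence constant along it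
  whatever the symmetric factor does.\<close>

lemma crossdiff_mult_supersym:
  assumes "finite U" "finite W" "U \<inter> W = {}" "g \<in> symalg U W"
  shows "(\<lambda>z. crossdiff U W z * g z) \<in> supersym U W"
  unfolding supersym_def
proof (intro CollectI conjI ballI allI symalg_intros crossdiff_symalg assms(4))
  fix i j s t and z :: "'a \<Rightarrow> 'b" assume ij: "i \<in> U" "j \<in> W"
  have "crossdiff U W (z(i := r, j := r)) = 0" for r
    by (rule crossdiff_eq_0[OF assms(1,2) ij]) simp
  then show "crossdiff U W (z(i := s, j := s)) * g (z(i := s, j := s))
      = crossdiff U W (z(i := t, j := t)) * g (z(i := t, j := t))" by simp
qed

text \<open>On a diagonal \<open>z i = z j\<close> the value of \<open>f\<close> does not depend on
  the common coordinate, and with that coordinate 0 it is, up to a block permutation, a value of the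
  restriction. So \<open>f\<close> vanishes on all diagonals and is divisible by their product; the
  quotient is symmetric because \<open>crossdiff\<close> can be cancelled.\<close>

lemma restrict_supersym_kernel:
  fixes f :: "('v \<Rightarrow> 'a::field_char_0) \<Rightarrow> 'a"
  assumes ctx: "finite U" "finite W" "U \<inter> W = {}" "p \<in> U" "q \<in> W"
    and f: "f \<in> supersym U W" and zero: "\<And>z. f (z(p := 0, q := 0)) = 0"
  shows "\<exists>g\<in>symalg U W. f = (\<lambda>z. crossdiff U W z * g z)"
proof -
  have cd: "crossdiff U W = (diffprod (U \<times> W) :: ('v \<Rightarrow> 'a) \<Rightarrow> 'a)"
    by (simp add: crossdiff_def diffprod_def prod.cartesian_product fun_eq_iff)
  have "\<exists>g\<in>polyfun (U \<union> W). \<forall>z. f z = diffprod (U \<times> W) z * g z"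
  proof (rule polyfun_dvd_diffprod)
    show "oriented (U \<times> W)" using ctx(3) by (auto simp: oriented_def)
    show "f \<in> polyfun (U \<union> W)" using f by (rule supersymD)
    fix i j and z :: "'v \<Rightarrow> 'a" assume "(i, j) \<in> U \<times> W"
    then have ij: "i \<in> U" "j \<in> W" by auto
    then have "i \<noteq> j" using ctx(3) by auto
    then have "z(i := z j) = z(i := z j, j := z j)" by (auto simp: fun_eq_iff)
    then have "f (z(i := z j)) = f (z(i := 0, j := 0))" using supersymD(3)[OF f ij] by metis
    also have "\<dots> = 0" unfolding supersym_at_zeros[OF ctx f ij] by (rule zero)
    finally show "f (z(i := z j)) = 0" .
  qed (use ctx in auto)
  then obtain g where g: "g \<in> polyfun (U \<union> W)" "\<And>z. f z = crossdiff U W z * g z"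
    unfolding cd by blast
  obtain z0 :: "'v \<Rightarrow> 'a" where z0: "inj_on z0 (U \<union> W)"
    using generic_point_exists[of "U \<union> W"] ctx by blast
  have "z0 i \<noteq> z0 j" if "i \<in> U" "j \<in> W" for i j
    using inj_onD[OF z0, of i j] that ctx(3) by blast
  then have z0: "crossdiff U W z0 \<noteq> 0"
    unfolding crossdiff_def using ctx by (simp add: prod_zero_iff)
  have "g \<in> symalg U W"
    unfolding symalg_def
  proof (intro CollectI conjI ballI allI g(1))
    fix \<pi> and z :: "'v \<Rightarrow> 'a" assume \<pi>: "\<pi> \<in> block_perms U W"
    have "g (z \<circ> \<pi>) - g z = 0"
    proof (rule polyfun_mult_eq_0[of "\<lambda>z. g (z \<circ> \<pi>) - g z", OF _ symalgD(1)[OF crossdiff_symalg] z0])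
      show "(\<lambda>z. g (z \<circ> \<pi>) - g z) \<in> polyfun (U \<union> W)"
        by (intro polyfun_diff polyfun_comp_block_perm g(1) \<pi>)
      fix z
      have "crossdiff U W z * g (z \<circ> \<pi>) = f (z \<circ> \<pi>)"
        unfolding g(2) symalgD(2)[OF crossdiff_symalg \<pi>] by (rule refl)
      also have "\<dots> = crossdiff U W z * g z"
        unfolding symalgD(2)[OF supersymD(1)[OF f] \<pi>] by (rule g(2))
      finally show "crossdiff U W z * (g (z \<circ> \<pi>) - g z) = 0" by (simp add: right_diff_distrib)
    qed
    then show "g (z \<circ> \<pi>) = g z" by simp
  qed
  with g(2) show ?thesis by (intro bexI[of _ g]) (simp add: fun_eq_iff)
qed

text \<open>The Nullstellensatz is applied not to the ideal generated by \<open>N\<close> but to an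
  ideal \<open>J\<close> containing \<open>N\<close> and tailored to the conclusion: its members are
  brought into \<open>N\<close> by averaging and multiplying by \<open>crossdiff\<close>. It then
  suffices that 1 belongs to \<open>J\<close>.\<close>

lemma crossdiff_multiples_in_ideal:
  fixes N :: "(('v \<Rightarrow> 'k::{alg_closed_field, field_char_0}) \<Rightarrow> 'k) set"
  assumes ctx: "finite U" "finite W" "U \<inter> W = {}"
    and N: "ideal_of (supersym U W) N"
    and no_zero: "\<not> (\<exists>a. \<forall>f\<in>N. f a = 0)" and b: "b \<in> symalg U W"
  shows "(\<lambda>z. crossdiff U W z * b z) \<in> N"
proof -
  let ?V = "U \<union> W" and ?B = "block_sum U W :: (('v \<Rightarrow> 'k) \<Rightarrow> 'k) \<Rightarrow> _"
  note NI = ideal_ofD[OF N subring1_supersym, unfolded plus_fun_def times_fun_def zero_fun_def]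
  \<comment> \<open>Quantifying over all \<open>s\<close> makes \<open>J\<close> an ideal, although averaging is only linear over symmetric functions.\<close>
  define J where "J = {F \<in> polyfun ?V. \<forall>s\<in>polyfun ?V. \<forall>b\<in>symalg U W.
    (\<lambda>z. crossdiff U W z * b z * ?B (\<lambda>z. F z * s z) z) \<in> N}"
  have JD: "(\<lambda>z. crossdiff U W z * b z * ?B (\<lambda>z. F z * s z) z) \<in> N"
    if "F \<in> J" "s \<in> polyfun ?V" "b \<in> symalg U W" for F s b
    using that by (simp add: J_def)
  have "ideal_of (polyfun ?V) J"
    unfolding ideal_of_def plus_fun_def times_fun_def zero_fun_def
  proof (intro conjI ballI)
    show "J \<subseteq> polyfun ?V" by (auto simp: J_def)
    show "(\<lambda>z. 0) \<in> J" unfolding J_def using NI(2) by (simp add: polyfun.const block_sum_def)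
  next
    fix F G assume FG: "F \<in> J" "G \<in> J"
    have "(\<lambda>z. crossdiff U W z * b z * ?B (\<lambda>z. (F z + G z) * s z) z) \<in> N"
      if "s \<in> polyfun ?V" "b \<in> symalg U W" for s b
    proof -
      have "?B (\<lambda>z. (F z + G z) * s z) z = ?B (\<lambda>z. F z * s z) z + ?B (\<lambda>z. G z * s z) z" for z
        by (simp add: block_sum_def distrib_right sum.distrib)
      then show ?thesis
        using NI(3)[of "\<lambda>z. crossdiff U W z * b z * ?B (\<lambda>z. F z * s z) z"
            "\<lambda>z. crossdiff U W z * b z * ?B (\<lambda>z. G z * s z) z"] FG that
        by (simp add: J_def distrib_left)
    qed
    then show "(\<lambda>z. F z + G z) \<in> J" using FG unfolding J_def by (simp add: polyfun.add)
  next
    fix F g :: "('v \<Rightarrow> 'k) \<Rightarrow> 'k" assume F: "F \<in> J" and g: "g \<in> polyfun ?V"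
    have "(\<lambda>z. crossdiff U W z * b z * ?B (\<lambda>z. F z * g z * s z) z) \<in> N"
      if "s \<in> polyfun ?V" "b \<in> symalg U W" for s b
    proof -
      have "(\<lambda>z. g z * s z) \<in> polyfun ?V" using g that(1) by (rule polyfun.mult)
      from JD[OF F this that(2)] show ?thesis by (simp add: mult.assoc)
    qed
    then show "(\<lambda>z. F z * g z) \<in> J" using F g unfolding J_def by (simp add: polyfun.mult)
  qed
  moreover have "N \<subseteq> J"
  proof
    fix f assume f: "f \<in> N"
    then have fs: "f \<in> symalg U W" using NI(1) supersymD(1) by blast
    have "(\<lambda>z. crossdiff U W z * b z * ?B (\<lambda>z. f z * s z) z) \<in> N"
      if "s \<in> polyfun ?V" "b \<in> symalg U W" for s b
    proof -
      have "(\<lambda>z. f z * (crossdiff U W z * (b z * ?B s z))) \<in> N"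
        by (intro NI(5) f crossdiff_mult_supersym ctx symalg_intros block_sum_symalg that)
      then show ?thesis by (simp add: block_sum_mult_symalg[OF fs] mult_ac)
    qed
    then show "f \<in> J" using fs unfolding J_def by (simp add: symalgD(1))
  qed
  ultimately have "1 \<in> J" using weak_nullstellensatz[of ?V J] ctx no_zero by blast
  note J1 = JD[OF this[unfolded one_fun_def]]
  let ?n = "of_nat (card (block_perms U W)) :: 'k"
  have "card (block_perms U W) \<noteq> 0"
    using finite_block_perms[OF ctx(1,2)] id_block_perms[of U W] by (metis card_eq_0_iff empty_iff)
  then have "?n \<noteq> 0" by simp
  \<comment> \<open>The sum of 1 over the group is the order of the group, for which
    \<open>b\<close> is corrected in advance.\<close>
  have "(\<lambda>z. b z * inverse ?n) \<in> symalg U W" by (intro symalg_intros b)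
  from J1[OF polyfun.const[of 1] this]
  have "(\<lambda>z. crossdiff U W z * (b z * inverse ?n) * ?n) \<in> N" by (simp add: block_sum_def)
  then show ?thesis using \<open>?n \<noteq> 0\<close> by (simp add: mult.assoc)
qed

theorem supersym_ideal_common_zero:
  fixes N :: "(('v \<Rightarrow> 'k::{alg_closed_field, field_char_0}) \<Rightarrow> 'k) set"
  assumes "finite U" "finite W" "U \<inter> W = {}" "ideal_of (supersym U W) N" "(\<lambda>z. 1) \<notin> N"
  shows "\<exists>a. \<forall>f\<in>N. f a = 0"
  using assms
proof (induction "card U" arbitrary: U W N rule: less_induct)
  case less
  note NI = ideal_ofD[OF less.prems(4) subring1_supersym, unfolded plus_fun_def times_fun_def zero_fun_def]
  show ?case
  proof (rule ccontr)
    assume no_zero: "\<not> ?case"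
    note multiples = crossdiff_multiples_in_ideal[OF less.prems(1-4) no_zero]
    \<comment> \<open>With an empty block \<open>crossdiff\<close> is 1, so its multiples already
      put 1 into \<open>N\<close>; this is the base of the induction.\<close>
    have "U \<noteq> {}" "W \<noteq> {}"
    proof -
      have "U \<noteq> {} \<and> W \<noteq> {}"
      proof (rule ccontr)
        assume "\<not> (U \<noteq> {} \<and> W \<noteq> {})"
        then have "crossdiff U W z = 1" for z :: "'v \<Rightarrow> 'k" by (auto simp: crossdiff_def)
        then show False using multiples[OF symalg_intros(1)[of 1]] less.prems(5) by simp
      qed
      then show "U \<noteq> {}" "W \<noteq> {}" by auto
    qed
    then obtain p q where pq: "p \<in> U" "q \<in> W" by blast
    note ctx = less.prems(1-3) pq
    let ?U = "U - {p}" and ?W = "W - {q}"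
    define \<rho> :: "(('v \<Rightarrow> 'k) \<Rightarrow> 'k) \<Rightarrow> ('v \<Rightarrow> 'k) \<Rightarrow> 'k" where "\<rho> = (\<lambda>f z. f (z(p := 0, q := 0)))"
    have ctx': "finite ?U" "finite ?W" "?U \<inter> ?W = {}" using ctx by auto
    have "ideal_of (supersym ?U ?W) (\<rho> ` N)"
      unfolding ideal_of_def plus_fun_def times_fun_def zero_fun_def
    proof (intro conjI ballI)
      show "\<rho> ` N \<subseteq> supersym ?U ?W"
      proof (rule image_subsetI)
        fix f assume "f \<in> N"
        then have "f \<in> supersym U W" using NI(1) by blast
        then show "\<rho> f \<in> supersym ?U ?W" unfolding \<rho>_def by (rule restrict_supersym[OF ctx])
      qed
      show "(\<lambda>z. 0) \<in> \<rho> ` N"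
        by (rule image_eqI[OF _ NI(2)]) (simp add: \<rho>_def)
    next
      fix f g assume "f \<in> \<rho> ` N" "g \<in> \<rho> ` N"
      then obtain f' g' where *: "f' \<in> N" "g' \<in> N" "f = \<rho> f'" "g = \<rho> g'" by blast
      show "(\<lambda>z. f z + g z) \<in> \<rho> ` N"
        by (rule image_eqI[OF _ NI(3)[OF *(1,2)]]) (simp add: \<rho>_def *(3,4))
    next
      fix f g :: "('v \<Rightarrow> 'k) \<Rightarrow> 'k" assume "f \<in> \<rho> ` N" and g: "g \<in> supersym ?U ?W"
      then obtain f' where *: "f' \<in> N" "f = \<rho> f'" by blast
      \<comment> \<open>Surjectivity of the restriction is what makes the image of \<open>N\<close>
        closed under multiplication by the whole smaller algebra.\<close>
      obtain g' where g': "g' \<in> supersym U W" "\<forall>z. g' (z(p := 0, q := 0)) = g z"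
        using restrict_supersym_surj[OF ctx g] by blast
      show "(\<lambda>z. f z * g z) \<in> \<rho> ` N"
        by (rule image_eqI[OF _ NI(5)[OF *(1) g'(1)]]) (simp add: \<rho>_def *(2) g'(2))
    qed
    \<comment> \<open>If \<open>\<rho> f = 1\<close>, then \<open>1 - f\<close> restricts to 0, so
      it is a symmetric multiple of \<open>crossdiff\<close> and lies in \<open>N\<close>; adding
      \<open>f\<close> gives 1.\<close>
    moreover have "(\<lambda>z. 1) \<notin> \<rho> ` N"
    proof
      assume "(\<lambda>z. 1) \<in> \<rho> ` N"
      then obtain f where f: "f \<in> N" "\<rho> f = (\<lambda>z. 1)" by (elim imageE) simp
      have "(\<lambda>z. 1 - f z) \<in> supersym U W"
        using f(1) NI(1) by (intro supersym_intros supersym_const) blast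
      moreover have "1 - f (z(p := 0, q := 0)) = 0" for z
        using fun_cong[OF f(2), of z] by (simp add: \<rho>_def)
      ultimately obtain g where g: "g \<in> symalg U W" "(\<lambda>z. 1 - f z) = (\<lambda>z. crossdiff U W z * g z)"
        using restrict_supersym_kernel[OF ctx, of "\<lambda>z. 1 - f z"] by blast
      have "(\<lambda>z. 1 - f z) \<in> N" unfolding g(2) by (rule multiples[OF g(1)])
      from NI(3)[OF this f(1)] show False using less.prems(5) by simp
    qed
    moreover have "card ?U < card U" using ctx by (intro psubset_card_mono) auto
    ultimately have "\<exists>a. \<forall>f\<in>\<rho> ` N. f a = 0" using ctx' by (intro less.hyps)
    then obtain a where "\<forall>f\<in>\<rho> ` N. f a = 0" by blast
    then have "\<forall>f\<in>N. f (a(p := 0, q := 0)) = 0" by (simp add: \<rho>_def)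
    then show False using no_zero by blast
  qed
qed

section \<open>Polynomials and polynomial functions\<close>

definition is_hom :: "('a::comm_ring_1 \<Rightarrow> 'b::comm_ring_1) \<Rightarrow> bool" where
  "is_hom \<phi> \<longleftrightarrow> \<phi> 1 = 1 \<and> (\<forall>a b. \<phi> (a + b) = \<phi> a + \<phi> b) \<and> (\<forall>a b. \<phi> (a * b) = \<phi> a * \<phi> b)"

lemma is_homD:
  assumes "is_hom \<phi>"
  shows "\<phi> 1 = 1" "\<phi> (a + b) = \<phi> a + \<phi> b" "\<phi> (a * b) = \<phi> a * \<phi> b" "\<phi> 0 = 0" "\<phi> (- a) = - \<phi> a"
    "\<phi> (a - b) = \<phi> a - \<phi> b" "\<phi> (a ^ k) = \<phi> a ^ k"
proof -
  show *: "\<phi> 1 = 1" "\<phi> (a + b) = \<phi> a + \<phi> b" "\<phi> (a * b) = \<phi> a * \<phi> b" for a b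
    using assms unfolding is_hom_def by blast+
  show 0: "\<phi> 0 = 0" using *(2)[of 0 0] by simp
  show minus: "\<phi> (- a) = - \<phi> a" for a
    using *(2)[of a "- a"] 0 by (simp add: eq_neg_iff_add_eq_0 add.commute)
  show "\<phi> (a - b) = \<phi> a - \<phi> b" using *(2)[of a "- b"] minus by simp
  show "\<phi> (a ^ k) = \<phi> a ^ k" by (induction k) (simp_all add: *)
qed

lemma is_hom_sum: "is_hom \<phi> \<Longrightarrow> \<phi> (\<Sum>i\<in>I. f i) = (\<Sum>i\<in>I. \<phi> (f i))"
  by (induction I rule: infinite_finite_induct) (simp_all add: is_homD)

lemma is_hom_prod: "is_hom \<phi> \<Longrightarrow> \<phi> (\<Prod>i\<in>I. f i) = (\<Prod>i\<in>I. \<phi> (f i))"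
  by (induction I rule: infinite_finite_induct) (simp_all add: is_homD)

lemma is_hom_id: "is_hom (\<lambda>c. c)" by (simp add: is_hom_def)

definition mon :: "('v \<Rightarrow> 'r::comm_ring_1) \<Rightarrow> ('v \<Rightarrow>\<^sub>0 nat) \<Rightarrow> 'r" where
  "mon x e = (\<Prod>v\<in>Poly_Mapping.keys e. x v ^ Poly_Mapping.lookup e v)"

lemma mon_superset:
  assumes "finite V" "Poly_Mapping.keys e \<subseteq> V"
  shows "mon x e = (\<Prod>v\<in>V. x v ^ Poly_Mapping.lookup e v)"
  unfolding mon_def using assms by (intro prod.mono_neutral_left) (auto simp: in_keys_iff)

lemma mon_add: "mon x (e + e') = mon x e * mon x e'"
proof -
  let ?V = "Poly_Mapping.keys e \<union> Poly_Mapping.keys e'"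
  have "finite ?V" "Poly_Mapping.keys (e + e') \<subseteq> ?V" by (simp_all add: keys_add)
  then show ?thesis
    using mon_superset[of ?V e x] mon_superset[of ?V e' x] mon_superset[of ?V "e + e'" x]
    by (simp add: lookup_add power_add prod.distrib)
qed

lemma mon_mult: "mon (\<lambda>v. x v * y v) e = mon x e * mon y e"
  by (simp add: mon_def power_mult_distrib prod.distrib)

lemma mp_eval_mon: "mp_eval \<phi> x p = (\<Sum>e\<in>Poly_Mapping.keys p. \<phi> (Poly_Mapping.lookup p e) * mon x e)"
  by (simp add: mp_eval_def mon_def)

lemma mp_eval_superset:
  assumes "is_hom \<phi>" "finite K" "Poly_Mapping.keys p \<subseteq> K"
  shows "mp_eval \<phi> x p = (\<Sum>e\<in>K. \<phi> (Poly_Mapping.lookup p e) * mon x e)"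
  unfolding mp_eval_mon using assms
  by (intro sum.mono_neutral_left) (auto simp: in_keys_iff is_homD)

lemma mp_eval_add:
  assumes "is_hom \<phi>"
  shows "mp_eval \<phi> x (p + q) = mp_eval \<phi> x p + mp_eval \<phi> x q"
proof -
  let ?K = "Poly_Mapping.keys p \<union> Poly_Mapping.keys q"
  have "finite ?K" "Poly_Mapping.keys (p + q) \<subseteq> ?K" by (simp_all add: keys_add)
  then show ?thesis
    using mp_eval_superset[OF assms, of ?K p x] mp_eval_superset[OF assms, of ?K q x]
      mp_eval_superset[OF assms, of ?K "p + q" x]
    by (simp add: lookup_add is_homD[OF assms] distrib_right sum.distrib)
qed

lemma mp_eval_single: "is_hom \<phi> \<Longrightarrow> mp_eval \<phi> x (Poly_Mapping.single e c) = \<phi> c * mon x e"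
  by (cases "c = 0") (simp_all add: mp_eval_mon is_homD)

lemma mp_eval_sum:
  assumes "is_hom \<phi>"
  shows "mp_eval \<phi> x (\<Sum>i\<in>I. f i) = (\<Sum>i\<in>I. mp_eval \<phi> x (f i))"
proof (induction I rule: infinite_finite_induct)
  case (insert i I)
  then show ?case by (simp add: mp_eval_add[OF assms])
qed (simp_all add: mp_eval_mon)

lemma sum_single_lookup: "(\<Sum>e\<in>Poly_Mapping.keys p. Poly_Mapping.single e (Poly_Mapping.lookup p e)) = p"
proof (rule poly_mapping_eqI)
  fix k
  have "Poly_Mapping.lookup (\<Sum>e\<in>Poly_Mapping.keys p. Poly_Mapping.single e (Poly_Mapping.lookup p e)) k
      = (\<Sum>e\<in>Poly_Mapping.keys p. if e = k then Poly_Mapping.lookup p e else 0)"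
    by (simp add: lookup_sum lookup_single when_def)
  also have "\<dots> = Poly_Mapping.lookup p k"
    by (simp add: in_keys_iff)
  finally show "Poly_Mapping.lookup (\<Sum>e\<in>Poly_Mapping.keys p. Poly_Mapping.single e (Poly_Mapping.lookup p e)) k
      = Poly_Mapping.lookup p k" .
qed

lemma mp_eval_mult:
  assumes "is_hom \<phi>"
  shows "mp_eval \<phi> x (p * q) = mp_eval \<phi> x p * mp_eval \<phi> x q"
proof -
  let ?s = "\<lambda>p e. Poly_Mapping.single e (Poly_Mapping.lookup p e)"
  have "p * q = (\<Sum>e\<in>Poly_Mapping.keys p. ?s p e) * (\<Sum>e\<in>Poly_Mapping.keys q. ?s q e)"
    by (simp only: sum_single_lookup)
  also have "\<dots> = (\<Sum>e\<in>Poly_Mapping.keys p. \<Sum>e'\<in>Poly_Mapping.keys q.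
      Poly_Mapping.single (e + e') (Poly_Mapping.lookup p e * Poly_Mapping.lookup q e'))"
    by (simp only: sum_product mult_single)
  finally have "mp_eval \<phi> x (p * q) = (\<Sum>e\<in>Poly_Mapping.keys p. \<Sum>e'\<in>Poly_Mapping.keys q.
      (\<phi> (Poly_Mapping.lookup p e) * mon x e) * (\<phi> (Poly_Mapping.lookup q e') * mon x e'))"
    by (simp add: mp_eval_sum[OF assms] mp_eval_single[OF assms] is_homD[OF assms] mon_add mult_ac)
  also have "\<dots> = mp_eval \<phi> x p * mp_eval \<phi> x q"
    by (simp only: mp_eval_mon sum_product)
  finally show ?thesis .
qed

lemma mp_eval_hom:
  assumes "is_hom \<phi>" shows "is_hom (mp_eval \<phi> x)"
proof -
  have "mp_eval \<phi> x 1 = 1"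
    using mp_eval_single[OF assms, of x 0 1] by (simp add: is_homD[OF assms] mon_def)
  then show ?thesis
    unfolding is_hom_def using mp_eval_add[OF assms] mp_eval_mult[OF assms] by blast
qed

lemma mp_eval_Const: "is_hom \<phi> \<Longrightarrow> mp_eval \<phi> x (Const c) = \<phi> c"
  by (simp add: Const_def mp_eval_single mon_def)

lemma mp_eval_Var: "is_hom \<phi> \<Longrightarrow> mp_eval \<phi> x (Var v) = x v"
  by (simp add: Var_def mp_eval_single mon_def is_homD)

lemma hom_mp_eval:
  assumes "is_hom \<psi>"
  shows "\<psi> (mp_eval \<phi> x p) = mp_eval (\<lambda>c. \<psi> (\<phi> c)) (\<lambda>v. \<psi> (x v)) p"
  unfolding mp_eval_def by (simp add: is_hom_sum[OF assms] is_hom_prod[OF assms] is_homD[OF assms])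

lemma is_hom_Const: "is_hom (Const :: 'a::comm_ring_1 \<Rightarrow> ('v, 'a) mpoly)"
  unfolding is_hom_def Const_def by (simp add: single_add mult_single single_one)

lemma is_hom_value: "is_hom (\<lambda>p. mp_value p z)"
  by (rule mp_eval_hom[OF is_hom_id])

lemma is_hom_subst: "is_hom (mp_subst s)"
  by (rule mp_eval_hom[OF is_hom_Const])

lemmas value_hom = is_homD[OF is_hom_value] is_hom_sum[OF is_hom_value] is_hom_prod[OF is_hom_value]
  mp_eval_Var[OF is_hom_id] mp_eval_Const[OF is_hom_id]

lemma value_subst: "mp_value (mp_subst s p) z = mp_value p (\<lambda>v. mp_value (s v) z)"
  by (simp add: hom_mp_eval[OF is_hom_value] mp_eval_Const[OF is_hom_id])

text \<open>The monomials are distinct characters, so Dedekind's argument applies.\<close>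

lemma mon_independent:
  fixes c :: "('v \<Rightarrow>\<^sub>0 nat) \<Rightarrow> 'a::field_char_0"
  assumes "finite K" "\<And>x. (\<Sum>e\<in>K. c e * mon x e) = 0" "e \<in> K"
  shows "c e = 0"
  using assms
proof (induction K arbitrary: c e rule: finite_induct)
  case (insert e0 K)
  have K0: "c e = 0" if e: "e \<in> K" for e
  proof -
    have "e \<noteq> e0" using insert.hyps e by blast
    then obtain v where v: "Poly_Mapping.lookup e v \<noteq> Poly_Mapping.lookup e0 v"
      by (meson poly_mapping_eqI)
    define a :: "'v \<Rightarrow> 'a" where "a = (\<lambda>_. 1)(v := 2)"
    have mon_a: "mon a d = 2 ^ Poly_Mapping.lookup d v" for d
    proof -
      have "mon a d = (\<Prod>w\<in>insert v (Poly_Mapping.keys d). a w ^ Poly_Mapping.lookup d w)"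
        by (rule mon_superset) auto
      also have "\<dots> = 2 ^ Poly_Mapping.lookup d v * (\<Prod>w\<in>Poly_Mapping.keys d - {v}. a w ^ Poly_Mapping.lookup d w)"
        by (simp add: prod.insert_remove a_def)
      also have "(\<Prod>w\<in>Poly_Mapping.keys d - {v}. a w ^ Poly_Mapping.lookup d w) = 1"
        by (intro prod.neutral) (simp add: a_def)
      finally show ?thesis by simp
    qed
    have "(\<Sum>d\<in>K. (c d * (mon a d - mon a e0)) * mon x d) = 0" for x
    proof -
      have "(\<Sum>d\<in>K. (c d * (mon a d - mon a e0)) * mon x d)
          = (\<Sum>d\<in>insert e0 K. (c d * (mon a d - mon a e0)) * mon x d)"
        using insert.hyps by simp
      also have "\<dots> = (\<Sum>d\<in>insert e0 K. c d * mon (\<lambda>v. x v * a v) d - mon a e0 * (c d * mon x d))"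
        unfolding mon_mult by (intro sum.cong refl) (simp add: algebra_simps)
      also have "\<dots> = (\<Sum>d\<in>insert e0 K. c d * mon (\<lambda>v. x v * a v) d)
          - mon a e0 * (\<Sum>d\<in>insert e0 K. c d * mon x d)"
        by (simp only: sum_subtractf sum_distrib_left)
      also have "\<dots> = 0" unfolding insert.prems(1) by simp
      finally show ?thesis .
    qed
    from insert.IH[OF this e] have "c e * (mon a e - mon a e0) = 0" .
    moreover have "mon a e \<noteq> mon a e0"
    proof
      assume "mon a e = mon a e0"
      then have "(of_nat (2 ^ Poly_Mapping.lookup e v) :: 'a) = of_nat (2 ^ Poly_Mapping.lookup e0 v)"
        by (simp add: mon_a)
      then have "(2::nat) ^ Poly_Mapping.lookup e v = 2 ^ Poly_Mapping.lookup e0 v"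
        unfolding of_nat_eq_iff .
      with v show False by simp
    qed
    ultimately show ?thesis by simp
  qed
  have "c e0 = 0"
  proof -
    have "(\<Sum>d\<in>K. c d * mon (\<lambda>_. 1) d) = 0" using K0 by simp
    moreover have "(\<Sum>d\<in>insert e0 K. c d * mon (\<lambda>_. 1) d) = c e0 * mon (\<lambda>_. 1) e0 + (\<Sum>d\<in>K. c d * mon (\<lambda>_. 1) d)"
      using insert.hyps by simp
    ultimately have "c e0 * mon (\<lambda>_. 1) e0 = 0" using insert.prems(1)[of "\<lambda>_. 1"] by simp
    then show ?thesis by (simp add: mon_def)
  qed
  with K0 insert.prems(2) show ?case by blast
qed simp

lemma mp_value_inject:
  fixes p q :: "('v, 'a::field_char_0) mpoly"
  assumes "\<And>z. mp_value p z = mp_value q z"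
  shows "p = q"
proof -
  have "mp_value (p - q) x = 0" for x
    using assms[of x] by (simp add: value_hom)
  then have "(\<Sum>e\<in>Poly_Mapping.keys (p - q). Poly_Mapping.lookup (p - q) e * mon x e) = 0" for x
    unfolding mp_eval_mon .
  from mon_independent[OF finite_keys this]
  have "Poly_Mapping.lookup (p - q) e = 0" for e
    by (cases "e \<in> Poly_Mapping.keys (p - q)") (simp_all add: in_keys_iff)
  then show ?thesis by (intro poly_mapping_eqI) (simp add: lookup_minus)
qed

definition mpoly_in :: "'v set \<Rightarrow> ('v, 'a::comm_ring_1) mpoly set" where
  "mpoly_in V = {f. \<forall>e\<in>Poly_Mapping.keys f. Poly_Mapping.keys e \<subseteq> V}"

lemma mp_value_polyfun:
  assumes "f \<in> mpoly_in V" shows "mp_value f \<in> polyfun V"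
proof -
  have "(\<lambda>z. \<Sum>e\<in>Poly_Mapping.keys f. Poly_Mapping.lookup f e *
      (\<Prod>v\<in>Poly_Mapping.keys e. z v ^ Poly_Mapping.lookup e v)) \<in> polyfun V"
    using assms unfolding mpoly_in_def
    by (intro polyfun_sum polyfun.mult polyfun.const polyfun_prod polyfun_power polyfun.var) blast
  then show ?thesis unfolding mp_eval_def[abs_def] .
qed

lemma polyfun_mp_value:
  assumes "F \<in> polyfun V" shows "\<exists>f\<in>mpoly_in V. mp_value f = F"
  using assms
proof (induction rule: polyfun.induct)
  case (const c)
  have "Const c \<in> mpoly_in V" by (simp add: mpoly_in_def Const_def)
  then show ?case by (rule bexI[rotated]) (simp add: value_hom fun_eq_iff)
next
  case (var v)
  then have "Var v \<in> mpoly_in V" by (simp add: mpoly_in_def Var_def)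
  then show ?case by (rule bexI[rotated]) (simp add: value_hom fun_eq_iff)
next
  case (add F G)
  then obtain f g where *: "f \<in> mpoly_in V" "mp_value f = F" "g \<in> mpoly_in V" "mp_value g = G" by blast
  have "f + g \<in> mpoly_in V" using * keys_add[of f g] unfolding mpoly_in_def by blast
  then show ?case by (rule bexI[rotated]) (simp add: value_hom fun_eq_iff *(2,4)[symmetric])
next
  case (mult F G)
  then obtain f g where *: "f \<in> mpoly_in V" "mp_value f = F" "g \<in> mpoly_in V" "mp_value g = G" by blast
  have "f * g \<in> mpoly_in V"
    unfolding mpoly_in_def
  proof (intro CollectI ballI)
    fix e assume "e \<in> Poly_Mapping.keys (f * g)"
    then obtain a b where ab: "e = a + b" "a \<in> Poly_Mapping.keys f" "b \<in> Poly_Mapping.keys g"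
      using keys_mult[of f g] by blast
    then show "Poly_Mapping.keys e \<subseteq> V"
      using *(1,3) keys_add[of a b] unfolding mpoly_in_def by blast
  qed
  then show ?case by (rule bexI[rotated]) (simp add: value_hom fun_eq_iff *(2,4)[symmetric])
qed

section \<open>Symmetry and the substitution condition in terms of values\<close>

fun hperm :: "(nat \<Rightarrow> nat) \<Rightarrow> (nat \<Rightarrow> nat) \<Rightarrow> hvar \<Rightarrow> hvar" where
  "hperm \<sigma> \<tau> (H i) = H (\<sigma> i)"
| "hperm \<sigma> \<tau> (H' j) = H' (\<tau> j)"

abbreviation Hs :: "nat \<Rightarrow> hvar set" where "Hs m \<equiv> H ` {1..m}"
abbreviation Hs' :: "nat \<Rightarrow> hvar set" where "Hs' n \<equiv> H' ` {1..n}"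

lemma S_h_eq: "S_h m n = mpoly_in (Hs m \<union> Hs' n)"
  by (simp add: S_h_def mpoly_in_def hvars_def)

lemma value_permute_vars:
  "mp_value (mp_subst (permute_vars \<sigma> \<tau>) f) z = mp_value f (z \<circ> hperm \<sigma> \<tau>)"
proof -
  have "(\<lambda>v. mp_value (permute_vars \<sigma> \<tau> v) z) = z \<circ> hperm \<sigma> \<tau>"
  proof
    show "mp_value (permute_vars \<sigma> \<tau> v) z = (z \<circ> hperm \<sigma> \<tau>) v" for v
      by (cases v) (simp_all add: value_hom)
  qed
  then show ?thesis by (simp add: value_subst)
qed

lemma separately_symmetric_iff:
  fixes f :: "(hvar, 'k::field_char_0) mpoly"
  shows "separately_symmetric m n f \<longleftrightarrow>
    (\<forall>\<sigma> \<tau> z. \<sigma> permutes {1..m} \<longrightarrow> \<tau> permutes {1..n} \<longrightarrow> mp_value f (z \<circ> hperm \<sigma> \<tau>) = mp_value f z)"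
proof
  assume L: "separately_symmetric m n f"
  show "\<forall>\<sigma> \<tau> z. \<sigma> permutes {1..m} \<longrightarrow> \<tau> permutes {1..n} \<longrightarrow> mp_value f (z \<circ> hperm \<sigma> \<tau>) = mp_value f z"
  proof (intro allI impI)
    fix \<sigma> \<tau> and z :: "hvar \<Rightarrow> 'k"
    assume \<sigma>: "\<sigma> permutes {1..m}" and \<tau>: "\<tau> permutes {1..n}"
    have split: "z \<circ> hperm \<sigma> \<tau> = (z \<circ> hperm \<sigma> id) \<circ> hperm id \<tau>"
    proof
      show "(z \<circ> hperm \<sigma> \<tau>) v = ((z \<circ> hperm \<sigma> id) \<circ> hperm id \<tau>) v" for v by (cases v) simp_all
    qed
    have inv: "mp_subst (permute_vars \<sigma> id) f = f" "mp_subst (permute_vars id \<tau>) f = f"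
      using L \<sigma> \<tau> unfolding separately_symmetric_def by blast+
    show "mp_value f (z \<circ> hperm \<sigma> \<tau>) = mp_value f z"
      using value_permute_vars[where \<sigma> = id and \<tau> = \<tau> and f = f and z = "z \<circ> hperm \<sigma> id"]
        value_permute_vars[where \<sigma> = \<sigma> and \<tau> = id and f = f and z = z]
      unfolding split inv by simp
  qed
next
  assume R: "\<forall>\<sigma> \<tau> z. \<sigma> permutes {1..m} \<longrightarrow> \<tau> permutes {1..n} \<longrightarrow> mp_value f (z \<circ> hperm \<sigma> \<tau>) = mp_value f z"
  have "mp_subst (permute_vars \<sigma> \<tau>) f = f" if "\<sigma> permutes {1..m}" "\<tau> permutes {1..n}" for \<sigma> \<tau>
    by (rule mp_value_inject) (use R that in \<open>simp add: value_permute_vars\<close>)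
  then show "separately_symmetric m n f"
    unfolding separately_symmetric_def by (simp add: permutes_id)
qed

lemma hperm_block_perms:
  assumes "\<sigma> permutes {1..m}" "\<tau> permutes {1..n}"
  shows "hperm \<sigma> \<tau> \<in> block_perms (Hs m) (Hs' n)"
proof -
  have "hperm \<sigma> \<tau> ` Hs m = H ` \<sigma> ` {1..m}" "hperm \<sigma> \<tau> ` Hs' n = H' ` \<tau> ` {1..n}"
    by (simp_all add: image_image)
  then have im: "hperm \<sigma> \<tau> ` Hs m = Hs m" "hperm \<sigma> \<tau> ` Hs' n = Hs' n"
    using assms by (simp_all add: permutes_image)
  have inj: "inj (hperm \<sigma> \<tau>)"
  proof (rule injI)
    fix v w assume "hperm \<sigma> \<tau> v = hperm \<sigma> \<tau> w"
    then show "v = w"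
      using permutes_inj[OF assms(1)] permutes_inj[OF assms(2)]
      by (cases v; cases w) (simp_all add: inj_eq)
  qed
  have "hperm \<sigma> \<tau> permutes (Hs m \<union> Hs' n)"
  proof (rule bij_imp_permutes)
    have "hperm \<sigma> \<tau> ` (Hs m \<union> Hs' n) = Hs m \<union> Hs' n" unfolding image_Un im ..
    then show "bij_betw (hperm \<sigma> \<tau>) (Hs m \<union> Hs' n) (Hs m \<union> Hs' n)"
      using inj_on_subset[OF inj subset_UNIV] by (simp only: bij_betw_def)
    fix v assume v: "v \<notin> Hs m \<union> Hs' n"
    show "hperm \<sigma> \<tau> v = v"
    proof (cases v)
      case (H i)
      then have "i \<notin> {1..m}" using v by blast
      from permutes_not_in[OF assms(1) this] show ?thesis unfolding H by simp
    next
      case (H' j)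
      then have "j \<notin> {1..n}" using v by blast
      from permutes_not_in[OF assms(2) this] show ?thesis unfolding H' by simp
    qed
  qed
  with im show ?thesis by (simp add: block_perms_def)
qed

lemma permutes_of_image:
  assumes "inj h" "inj \<pi>" "\<pi> ` h ` S = h ` S" "\<And>i. h (\<sigma> i) = \<pi> (h i)" "\<And>i. i \<notin> S \<Longrightarrow> \<pi> (h i) = h i"
  shows "\<sigma> permutes S"
proof (rule bij_imp_permutes)
  have "h ` \<sigma> ` S = h ` S" using assms(3,4) by (simp add: image_image)
  then have "\<sigma> ` S = S" using assms(1) by (simp add: inj_image_eq_iff)
  moreover have "inj_on \<sigma> S"
  proof (rule inj_onI)
    fix i j assume "\<sigma> i = \<sigma> j"
    then have "\<pi> (h i) = \<pi> (h j)" by (simp only: assms(4)[symmetric])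
    then have "h i = h j" by (rule injD[OF assms(2)])
    then show "i = j" by (rule injD[OF assms(1)])
  qed
  ultimately show "bij_betw \<sigma> S S" by (simp add: bij_betw_def)
  show "\<sigma> i = i" if "i \<notin> S" for i
    by (rule injD[OF assms(1)]) (simp only: assms(4) assms(5)[OF that])
qed

lemma block_perms_hperm:
  assumes "\<pi> \<in> block_perms (Hs m) (Hs' n)"
  obtains \<sigma> \<tau> where "\<sigma> permutes {1..m}" "\<tau> permutes {1..n}" "\<pi> = hperm \<sigma> \<tau>"
proof -
  have \<pi>: "\<pi> permutes (Hs m \<union> Hs' n)" "\<pi> ` Hs m = Hs m" "\<pi> ` Hs' n = Hs' n"
    using assms by (simp_all add: block_perms_def)
  have inj: "inj \<pi>" using \<pi>(1) by (rule permutes_inj)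
  have fix_out: "\<pi> v = v" if "v \<notin> Hs m \<union> Hs' n" for v using permutes_not_in[OF \<pi>(1) that] .
  have "\<exists>k. H k = \<pi> (H i)" for i
  proof (cases "i \<in> {1..m}")
    case True
    then have "\<pi> (H i) \<in> \<pi> ` Hs m" by blast
    then show ?thesis unfolding \<pi>(2) by auto
  next
    case False
    then have "\<pi> (H i) = H i" by (intro fix_out) auto
    then show ?thesis by metis
  qed
  then obtain \<sigma> where \<sigma>: "\<And>i. H (\<sigma> i) = \<pi> (H i)" by metis
  have "\<exists>k. H' k = \<pi> (H' j)" for j
  proof (cases "j \<in> {1..n}")
    case True
    then have "\<pi> (H' j) \<in> \<pi> ` Hs' n" by blast
    then show ?thesis unfolding \<pi>(3) by auto
  next
    case False
    then have "\<pi> (H' j) = H' j" by (intro fix_out) auto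
    then show ?thesis by metis
  qed
  then obtain \<tau> where \<tau>: "\<And>j. H' (\<tau> j) = \<pi> (H' j)" by metis
  show ?thesis
  proof
    show "\<sigma> permutes {1..m}"
      by (rule permutes_of_image[of H \<pi>, OF _ inj \<pi>(2) \<sigma> fix_out]) (auto simp: inj_def)
    show "\<tau> permutes {1..n}"
      by (rule permutes_of_image[of H' \<pi>, OF _ inj \<pi>(3) \<tau> fix_out]) (auto simp: inj_def)
    show "\<pi> = hperm \<sigma> \<tau>"
    proof
      show "\<pi> v = hperm \<sigma> \<tau> v" for v by (cases v) (simp_all add: \<sigma> \<tau>)
    qed
  qed
qed

text \<open>Evaluation at the constant polynomial \<open>Const s\<close> and then at
  \<open>z\<close> is a ring homomorphism, so it may be computed on the generators. It trades the
  formal variable \<open>t\<close> for a scalar \<open>s\<close>.\<close>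

lemma value_subst_t:
  fixes f :: "(hvar, 'k::field_char_0) mpoly"
  shows "mp_value (poly (subst_t c f) (Const s)) z = mp_value f (z(H 1 := s, H' 1 := c * s))"
proof -
  let ?\<psi> = "\<lambda>P. mp_value (poly P (Const s)) z"
  have "is_hom ?\<psi>"
    unfolding is_hom_def by (simp add: value_hom)
  from hom_mp_eval[OF this]
  have "?\<psi> (subst_t c f) = mp_eval (\<lambda>a. ?\<psi> [:Const a:])
      (\<lambda>v. ?\<psi> (if v = H 1 then [:0, 1:] else if v = H' 1 then [:0, Const c:] else [:Var v:])) f"
    unfolding subst_t_def .
  moreover have "(\<lambda>a. ?\<psi> [:Const a:]) = (\<lambda>a. a)" by (simp add: value_hom)
  moreover have "(\<lambda>v. ?\<psi> (if v = H 1 then [:0, 1:] else if v = H' 1 then [:0, Const c:] else [:Var v:]))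
      = z(H 1 := s, H' 1 := c * s)"
    by (auto simp: fun_eq_iff value_hom mult.commute)
  ultimately show ?thesis by (simp only:)
qed

lemma subst_indep_iff:
  fixes f :: "(hvar, 'k::field_char_0) mpoly"
  shows "subst_indep m n c f \<longleftrightarrow> (m \<ge> 1 \<and> n \<ge> 1 \<longrightarrow>
    (\<forall>z s t. mp_value f (z(H 1 := s, H' 1 := c * s)) = mp_value f (z(H 1 := t, H' 1 := c * t))))"
proof -
  let ?P = "subst_t c f"
  have "degree ?P = 0 \<longleftrightarrow>
    (\<forall>z s t. mp_value f (z(H 1 := s, H' 1 := c * s)) = mp_value f (z(H 1 := t, H' 1 := c * t)))"
  proof
    assume "degree ?P = 0"
    then obtain a where "?P = [:a:]" by (rule degree_eq_zeroE)
    then show "\<forall>z s t. mp_value f (z(H 1 := s, H' 1 := c * s)) = mp_value f (z(H 1 := t, H' 1 := c * t))"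
      unfolding value_subst_t[symmetric] by simp
  next
    assume R: "\<forall>z s t. mp_value f (z(H 1 := s, H' 1 := c * s)) = mp_value f (z(H 1 := t, H' 1 := c * t))"
    have "coeff ?P i = 0" if i: "i > 0" for i
    proof (rule mp_value_inject)
      fix z :: "hvar \<Rightarrow> 'k"
      \<comment> \<open>The polynomial in \<open>t\<close> with its coefficients evaluated at
        \<open>z\<close>. Over an infinite field it is constant as soon as its values are, so each
        higher coefficient vanishes at every \<open>z\<close> and is therefore the zero
        polynomial.\<close>
      define Q where "Q = (\<Sum>i\<le>degree ?P. monom (mp_value (coeff ?P i) z) i)"
      have Q: "poly Q s = mp_value (poly ?P (Const s)) z" for s
        by (simp add: Q_def poly_sum poly_monom poly_altdef[of ?P] value_hom)
      define b where "b = poly Q 0"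
      have "poly Q s = b" for s
        unfolding b_def Q value_subst_t using R by blast
      then have "\<forall>s. poly (Q - [:b:]) s = 0" by simp
      then have "Q - [:b:] = 0" unfolding poly_all_0_iff_0 .
      then have "Q = [:b:]" by simp
      then have "coeff Q i = 0" using i by (cases i) simp_all
      moreover have "coeff Q i = mp_value (coeff ?P i) z"
        by (cases "i \<le> degree ?P") (simp_all add: Q_def coeff_sum coeff_monom coeff_eq_0 value_hom)
      ultimately show "mp_value (coeff ?P i) z = mp_value 0 z" by (simp add: value_hom)
    qed
    then have "lead_coeff ?P = 0" if "degree ?P \<noteq> 0" using that by blast
    then show "degree ?P = 0" by (cases "?P = 0") auto
  qed
  then show ?thesis unfolding subst_indep_def by simp
qed

lemma mpoly_in_iff:
  fixes f :: "('v, 'a::field_char_0) mpoly"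
  shows "f \<in> mpoly_in V \<longleftrightarrow> mp_value f \<in> polyfun V"
proof
  assume "mp_value f \<in> polyfun V"
  then obtain g where g: "g \<in> mpoly_in V" "mp_value g = mp_value f" using polyfun_mp_value by blast
  have "g = f" by (rule mp_value_inject) (rule fun_cong[OF g(2)])
  with g(1) show "f \<in> mpoly_in V" by simp
qed (rule mp_value_polyfun)

text \<open>With \<open>c = -1\<close> this is \<open>I_gl\<close>; with \<open>c = 1\<close> it
  consists of the polynomials that give \<open>J_h\<close> when the variables are replaced by their
  squares.\<close>

definition symmetric_polys :: "'k \<Rightarrow> nat \<Rightarrow> nat \<Rightarrow> (hvar, 'k::comm_ring_1) mpoly set" where
  "symmetric_polys c m n = {f \<in> S_h m n. separately_symmetric m n f \<and> subst_indep m n c f}"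

text \<open>Scaling the second block by \<open>c\<close> turns the substitution \<open>s\<close>,
  \<open>c * s\<close> into equal values, the normalisation used in \<open>supersym\<close>. For
  \<open>c * c = 1\<close> it is its own inverse.\<close>

definition flip :: "'k::comm_ring_1 \<Rightarrow> (hvar \<Rightarrow> 'k) \<Rightarrow> hvar \<Rightarrow> 'k" where
  "flip c z v = (case v of H i \<Rightarrow> z v | H' j \<Rightarrow> c * z v)"

lemma flip_flip: "c * c = 1 \<Longrightarrow> flip c (flip c z) = z"
  by (auto simp: flip_def fun_eq_iff mult.assoc[symmetric] split: hvar.splits)

lemma flip_hperm: "flip c (z \<circ> hperm \<sigma> \<tau>) = flip c z \<circ> hperm \<sigma> \<tau>"
  by (auto simp: flip_def fun_eq_iff split: hvar.splits)

lemma flip_update: "flip c (z(H i := s, H' j := t)) = (flip c z)(H i := s, H' j := c * t)"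
  by (auto simp: flip_def fun_eq_iff split: hvar.splits)

lemma polyfun_flip:
  assumes "f \<in> polyfun V" shows "(\<lambda>z. f (flip c z)) \<in> polyfun V"
proof (rule polyfun_subst[OF assms])
  show "(\<lambda>z. flip c z v) \<in> polyfun V" if "v \<in> V" for v
    unfolding flip_def using that by (cases v) (simp_all add: polyfun_intros)
qed

lemma symmetric_polys_iff:
  fixes f :: "(hvar, 'k::field_char_0) mpoly"
  assumes c: "c * c = 1"
  shows "f \<in> symmetric_polys c m n \<longleftrightarrow> (\<lambda>z. mp_value f (flip c z)) \<in> supersym (Hs m) (Hs' n)"
proof
  let ?F = "\<lambda>z. mp_value f (flip c z)"
  assume f: "f \<in> symmetric_polys c m n"
  have "?F \<in> polyfun (Hs m \<union> Hs' n)"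
    using f unfolding symmetric_polys_def S_h_eq mpoly_in_iff by (intro polyfun_flip) blast
  moreover have "?F (z \<circ> \<pi>) = ?F z" if \<pi>: "\<pi> \<in> block_perms (Hs m) (Hs' n)" for \<pi> z
  proof -
    obtain \<sigma> \<tau> where "\<sigma> permutes {1..m}" "\<tau> permutes {1..n}" "\<pi> = hperm \<sigma> \<tau>"
      by (rule block_perms_hperm[OF \<pi>])
    then show ?thesis
      using f unfolding symmetric_polys_def by (simp add: flip_hperm separately_symmetric_iff)
  qed
  ultimately have sym: "?F \<in> symalg (Hs m) (Hs' n)" by (simp add: symalg_def)
  show "?F \<in> supersym (Hs m) (Hs' n)"
  proof (cases "m \<ge> 1 \<and> n \<ge> 1")
    case True
    show ?thesis
    proof (rule supersymI[OF sym, of "H 1" "H' 1"])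
      have "\<forall>z s t. mp_value f (z(H 1 := s, H' 1 := c * s)) = mp_value f (z(H 1 := t, H' 1 := c * t))"
        using f True unfolding symmetric_polys_def by (simp add: subst_indep_iff)
      then show "?F (z(H 1 := s, H' 1 := s)) = ?F (z(H 1 := t, H' 1 := t))" for z s t
        unfolding flip_update by blast
    qed (use True in auto)
  next
    case False
    then have "Hs m = {} \<or> Hs' n = {}" by (cases m; cases n) auto
    with sym show ?thesis unfolding supersym_def by blast
  qed
next
  let ?F = "\<lambda>z. mp_value f (flip c z)"
  assume F: "?F \<in> supersym (Hs m) (Hs' n)"
  have f: "mp_value f z = ?F (flip c z)" for z by (simp add: flip_flip[OF c])
  have "(\<lambda>z. ?F (flip c z)) \<in> polyfun (Hs m \<union> Hs' n)" by (rule polyfun_flip[OF supersymD(2)[OF F]])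
  then have "f \<in> S_h m n" unfolding S_h_eq mpoly_in_iff by (simp add: flip_flip[OF c])
  moreover have "separately_symmetric m n f"
    unfolding separately_symmetric_iff
  proof (intro allI impI)
    fix \<sigma> \<tau> and z :: "hvar \<Rightarrow> 'k" assume "\<sigma> permutes {1..m}" "\<tau> permutes {1..n}"
    then show "mp_value f (z \<circ> hperm \<sigma> \<tau>) = mp_value f z"
      unfolding f[of z] f[of "z \<circ> hperm \<sigma> \<tau>"] flip_hperm[of c z]
      by (intro symalgD(2)[OF supersymD(1)[OF F]] hperm_block_perms)
  qed
  moreover have "subst_indep m n c f"
    unfolding subst_indep_iff
  proof (intro impI allI)
    fix z s t assume mn: "1 \<le> m \<and> 1 \<le> n"
    have *: "mp_value f (z(H 1 := s, H' 1 := c * s)) = ?F ((flip c z)(H 1 := s, H' 1 := s))" for s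
      by (simp only: flip_update flip_flip[OF c])
    show "mp_value f (z(H 1 := s, H' 1 := c * s)) = mp_value f (z(H 1 := t, H' 1 := c * t))"
      unfolding * by (rule supersymD(3)[OF F]) (use mn in auto)
  qed
  ultimately show "f \<in> symmetric_polys c m n" by (simp add: symmetric_polys_def)
qed

lemma symmetric_polys_exists:
  fixes G :: "(hvar \<Rightarrow> 'k::field_char_0) \<Rightarrow> 'k"
  assumes c: "c * c = 1" and G: "G \<in> supersym (Hs m) (Hs' n)"
  obtains g where "g \<in> symmetric_polys c m n" "\<And>z. mp_value g (flip c z) = G z"
proof -
  obtain g where g: "mp_value g = (\<lambda>z. G (flip c z))"
    using polyfun_mp_value[OF polyfun_flip[OF supersymD(2)[OF G]]] by blast
  have *: "mp_value g (flip c z) = G z" for z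
    using fun_cong[OF g, of "flip c z"] by (simp add: flip_flip[OF c])
  then have "(\<lambda>z. mp_value g (flip c z)) \<in> supersym (Hs m) (Hs' n)" using G by simp
  then show ?thesis using that * symmetric_polys_iff[OF c] by blast
qed

lemma subring1_symmetric_polys:
  assumes c: "c * c = (1 :: 'k::field_char_0)"
  shows "subring1 (symmetric_polys c m n)"
  unfolding subring1_def symmetric_polys_iff[OF c]
  by (intro conjI ballI; simp add: value_hom supersym_const supersym_intros symmetric_polys_iff[OF c])

lemma Hs_disjoint: "Hs m \<inter> Hs' n = {}" by auto

lemma symmetric_polys_common_zero:
  fixes N :: "(hvar, 'k::{alg_closed_field, field_char_0}) mpoly set"
  assumes c: "c * c = 1" and N: "ideal_of (symmetric_polys c m n) N" "1 \<notin> N"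
  shows "\<exists>\<mu>. \<forall>f\<in>N. mp_value f \<mu> = 0"
proof -
  define ev where "ev f = (\<lambda>z. mp_value f (flip c z))" for f :: "(hvar, 'k) mpoly"
  note NI = ideal_ofD[OF N(1) subring1_symmetric_polys[OF c]]
  have "\<exists>a. \<forall>f\<in>ev ` N. f a = 0"
  proof (rule supersym_ideal_common_zero)
    show "finite (Hs m)" "finite (Hs' n)" by simp_all
    show "Hs m \<inter> Hs' n = {}" by (rule Hs_disjoint)
    show "ideal_of (supersym (Hs m) (Hs' n)) (ev ` N)"
      unfolding ideal_of_def plus_fun_def times_fun_def zero_fun_def
    proof (intro conjI ballI)
      show "ev ` N \<subseteq> supersym (Hs m) (Hs' n)"
        using NI(1) unfolding ev_def by (auto simp: symmetric_polys_iff[OF c])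
      show "(\<lambda>x. 0) \<in> ev ` N" by (rule image_eqI[OF _ NI(2)]) (simp add: ev_def value_hom)
    next
      fix f g assume "f \<in> ev ` N" "g \<in> ev ` N"
      then obtain f' g' where *: "f' \<in> N" "g' \<in> N" "f = ev f'" "g = ev g'" by blast
      show "(\<lambda>z. f z + g z) \<in> ev ` N"
        by (rule image_eqI[OF _ NI(3)[OF *(1,2)]]) (simp add: ev_def value_hom *(3,4))
    next
      fix f g :: "(hvar \<Rightarrow> 'k) \<Rightarrow> 'k" assume "f \<in> ev ` N" and g: "g \<in> supersym (Hs m) (Hs' n)"
      then obtain f' where *: "f' \<in> N" "f = ev f'" by blast
      obtain g' where g': "g' \<in> symmetric_polys c m n" "\<And>z. mp_value g' (flip c z) = g z"
        using symmetric_polys_exists[OF c g] by blast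
      show "(\<lambda>z. f z * g z) \<in> ev ` N"
        by (rule image_eqI[OF _ NI(5)[OF *(1) g'(1)]]) (simp add: ev_def value_hom *(2) g'(2))
    qed
    show "(\<lambda>z. 1) \<notin> ev ` N"
    proof
      assume "(\<lambda>z. 1) \<in> ev ` N"
      then obtain f where f: "f \<in> N" "ev f = (\<lambda>z. 1)" by (elim imageE) simp
      have "f = 1"
      proof (rule mp_value_inject)
        fix z
        have "mp_value f z = ev f (flip c z)" by (simp add: ev_def flip_flip[OF c])
        then show "mp_value f z = mp_value 1 z" by (simp add: f(2) value_hom)
      qed
      with f(1) N(2) show False by simp
    qed
  qed
  then show ?thesis by (auto simp: ev_def)
qed

section \<open>The orthosymplectic algebras\<close>

abbreviation sq :: "(hvar, 'k::comm_ring_1) mpoly \<Rightarrow> (hvar, 'k) mpoly" where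
  "sq \<equiv> mp_subst (\<lambda>v. Var v ^ 2)"

lemma value_sq: "mp_value (sq f) z = mp_value f (\<lambda>v. z v ^ 2)"
  by (simp add: value_subst value_hom)

lemmas sq_hom = is_homD[OF is_hom_subst[of "\<lambda>v. Var v ^ 2"]]

lemma J_h_eq: "J_h m n = sq ` symmetric_polys 1 m n"
  by (simp add: J_h_def symmetric_polys_def)

lemma square_roots:
  fixes z :: "'v \<Rightarrow> 'k::alg_closed_field"
  shows "\<exists>w. \<forall>v. w v ^ 2 = z v"
proof (rule choice, rule allI)
  show "\<exists>y. y ^ 2 = z v" for v by (rule nth_root_exists) simp
qed

text \<open>The preimage of \<open>M\<close> under \<open>sq\<close> is a proper ideal of the
  supersymmetric polynomials. It has a common zero, and coordinatewise square roots of that point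
  serve as \<open>\<mu>\<close>. The ring \<open>B\<close> is left open to cover both
  orthosymplectic series.\<close>

lemma ideal_common_zero_on_J_h:
  fixes M :: "(hvar, 'k::{alg_closed_field, field_char_0}) mpoly set"
  assumes B: "subring1 B" "J_h m n \<subseteq> B" and M: "ideal_of B M" "1 \<notin> M"
  shows "\<exists>\<mu>. \<forall>g\<in>symmetric_polys 1 m n. sq g \<in> M \<longrightarrow> mp_value (sq g) \<mu> = 0"
proof -
  let ?A = "symmetric_polys 1 m n :: (hvar, 'k) mpoly set"
  define N where "N = {g \<in> ?A. sq g \<in> M}"
  note A = subring1D[OF subring1_symmetric_polys[of "1 :: 'k" m n, simplified]] and MI = ideal_ofD[OF M(1) B(1)]
  have "ideal_of ?A N"
    unfolding ideal_of_def
  proof (intro conjI ballI)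
    show "N \<subseteq> ?A" by (auto simp: N_def)
    show "0 \<in> N" using A(1) MI(2) by (simp add: N_def sq_hom)
    show "f + g \<in> N" if "f \<in> N" "g \<in> N" for f g
      using that A(3) MI(3) by (simp add: N_def sq_hom)
    show "f * g \<in> N" if "f \<in> N" "g \<in> ?A" for f g
    proof -
      have "sq g \<in> B" using that(2) B(2) unfolding J_h_eq by blast
      then show ?thesis using that A(5) MI(5) by (simp add: N_def sq_hom)
    qed
  qed
  moreover have "1 \<notin> N" using M(2) by (simp add: N_def sq_hom)
  ultimately obtain a where a: "\<forall>f\<in>N. mp_value f a = 0"
    using symmetric_polys_common_zero[of 1 m n N] by auto
  obtain \<mu> where \<mu>: "\<forall>v. \<mu> v ^ 2 = a v" using square_roots[of a] by blast
  have "mp_value (sq g) \<mu> = 0" if "g \<in> ?A" "sq g \<in> M" for g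
    using a that by (simp add: value_sq \<mu> N_def)
  then show ?thesis by blast
qed

section \<open>Functions even in each variable\<close>

lemma polyfun_even_odd:
  fixes F :: "('v \<Rightarrow> 'a::comm_ring_1) \<Rightarrow> 'a"
  assumes "F \<in> polyfun V" "v \<in> V"
  shows "\<exists>A\<in>polyfun V. \<exists>B\<in>polyfun V. \<forall>z. F z = A (z(v := z v ^ 2)) + z v * B (z(v := z v ^ 2))"
  using assms(1)
proof (induction rule: polyfun.induct)
  case (const c)
  show ?case
    by (intro bexI[of _ "\<lambda>_. c"] bexI[of _ "\<lambda>_. 0"]) (simp_all add: polyfun.const)
next
  case (var w)
  show ?case
  proof (cases "w = v")
    case True
    show ?thesis
      by (intro bexI[of _ "\<lambda>_. 0"] bexI[of _ "\<lambda>_. 1"]) (simp_all add: polyfun.const True)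
  next
    case False
    then show ?thesis using var
      by (intro bexI[of _ "\<lambda>z. z w"] bexI[of _ "\<lambda>_. 0"]) (simp_all add: polyfun.const polyfun.var)
  qed
next
  case (add F G)
  then obtain A B C D where *: "A \<in> polyfun V" "B \<in> polyfun V" "C \<in> polyfun V" "D \<in> polyfun V"
    "\<forall>z. F z = A (z(v := z v ^ 2)) + z v * B (z(v := z v ^ 2))"
    "\<forall>z. G z = C (z(v := z v ^ 2)) + z v * D (z(v := z v ^ 2))" by blast
  show ?case
  proof (rule bexI[of _ "\<lambda>z. A z + C z"], rule bexI[of _ "\<lambda>z. B z + D z"], rule allI)
    show "F z + G z = (A (z(v := z v ^ 2)) + C (z(v := z v ^ 2)))
        + z v * (B (z(v := z v ^ 2)) + D (z(v := z v ^ 2)))" for z :: "'v \<Rightarrow> 'a"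
      unfolding *(5)[rule_format, of z] *(6)[rule_format, of z] by (simp only: algebra_simps)
  qed (intro polyfun.add *)+
next
  case (mult F G)
  then obtain A B C D where *: "A \<in> polyfun V" "B \<in> polyfun V" "C \<in> polyfun V" "D \<in> polyfun V"
    "\<forall>z. F z = A (z(v := z v ^ 2)) + z v * B (z(v := z v ^ 2))"
    "\<forall>z. G z = C (z(v := z v ^ 2)) + z v * D (z(v := z v ^ 2))" by blast
  show ?case
  \<comment> \<open>In the product of the two odd parts \<open>z v\<close> occurs squared, and
    \<open>z v ^ 2\<close> is the coordinate at \<open>v\<close> of the updated point; hence the
    bare \<open>z v\<close> in the even witness.\<close>
  proof (rule bexI[of _ "\<lambda>z. A z * C z + z v * (B z * D z)"], rule bexI[of _ "\<lambda>z. A z * D z + B z * C z"], rule allI)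
    fix z :: "'v \<Rightarrow> 'a"
    let ?z = "z(v := z v ^ 2)"
    have "F z * G z = (A ?z * C ?z + z v ^ 2 * (B ?z * D ?z)) + z v * (A ?z * D ?z + B ?z * C ?z)"
      unfolding *(5)[rule_format, of z] *(6)[rule_format, of z]
      by (simp only: algebra_simps power2_eq_square)
    then show "F z * G z = (A ?z * C ?z + ?z v * (B ?z * D ?z)) + z v * (A ?z * D ?z + B ?z * C ?z)"
      by simp
  qed (intro polyfun.add polyfun.mult polyfun.var assms(2) *)+
qed

lemma polyfun_even_step:
  fixes F :: "('v \<Rightarrow> 'a::field_char_0) \<Rightarrow> 'a"
  assumes "F \<in> polyfun V" "v \<in> V" and even: "\<And>z. F (z(v := - z v)) = F z"
  shows "\<exists>A\<in>polyfun V. \<forall>z. F z = A (z(v := z v ^ 2))"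
proof -
  obtain A B where AB: "A \<in> polyfun V"
    "\<forall>z. F z = A (z(v := z v ^ 2)) + z v * B (z(v := z v ^ 2))"
    using polyfun_even_odd[OF assms(1,2)] by blast
  have "F z = A (z(v := z v ^ 2))" for z
  proof -
    have 1: "F z = A (z(v := z v ^ 2)) + z v * B (z(v := z v ^ 2))" using AB(2) by blast
    have 2: "F z = A (z(v := z v ^ 2)) - z v * B (z(v := z v ^ 2))"
      using AB(2)[rule_format, of "z(v := - z v)"] even[of z] by simp
    have "F z + F z = (A (z(v := z v ^ 2)) + z v * B (z(v := z v ^ 2)))
        + (A (z(v := z v ^ 2)) - z v * B (z(v := z v ^ 2)))"
      by (rule arg_cong2[of _ _ _ _ "(+)", OF 1 2])
    then have "2 * F z = 2 * A (z(v := z v ^ 2))" by (simp only: mult_2) simp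
    then show ?thesis by simp
  qed
  with AB(1) show ?thesis by blast
qed

lemma polyfun_even:
  fixes F :: "('v \<Rightarrow> 'k::{alg_closed_field, field_char_0}) \<Rightarrow> 'k"
  assumes "F \<in> polyfun V" "finite S" "S \<subseteq> V" "\<And>v z. v \<in> S \<Longrightarrow> F (z(v := - z v)) = F z"
  shows "\<exists>A\<in>polyfun V. \<forall>z. F z = A (\<lambda>x. if x \<in> S then z x ^ 2 else z x)"
  using assms(2-4)
proof (induction S rule: finite_induct)
  case empty
  show ?case by (rule bexI[OF _ assms(1)]) simp
next
  case (insert v S)
  let ?s = "\<lambda>z :: 'v \<Rightarrow> 'k. \<lambda>x. if x \<in> S then z x ^ 2 else z x"
  obtain A where A: "A \<in> polyfun V" "\<forall>z. F z = A (?s z)"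
    using insert.IH insert.prems by auto
  \<comment> \<open>Evenness passes from \<open>F\<close> to \<open>A\<close> because every point
    arises from some \<open>w\<close> by squaring the coordinates in \<open>S\<close>, the field
    being algebraically closed.\<close>
  have "A (z(v := - z v)) = A z" for z
  proof -
    obtain r where r: "\<forall>x. r x ^ 2 = z x" using square_roots[of z] by blast
    define w where "w x = (if x \<in> S then r x else z x)" for x
    have "?s w = z" "?s (w(v := - w v)) = z(v := - z v)"
      using insert.hyps by (auto simp: w_def r fun_eq_iff)
    then show ?thesis
      using A(2)[rule_format, of w] A(2)[rule_format, of "w(v := - w v)"] insert.prems(2)[of v w] by simp
  qed
  then obtain B where B: "B \<in> polyfun V" "\<forall>z. A z = B (z(v := z v ^ 2))"
    using polyfun_even_step[OF A(1), of v] insert.prems(1) by auto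
  have "F z = B (\<lambda>x. if x \<in> insert v S then z x ^ 2 else z x)" for z
  proof -
    have "(?s z)(v := ?s z v ^ 2) = (\<lambda>x. if x \<in> insert v S then z x ^ 2 else z x)"
      using insert.hyps by (auto simp: fun_eq_iff)
    then show ?thesis using A(2)[rule_format, of z] B(2)[rule_format, of "?s z"] by simp
  qed
  with B(1) show ?case by blast
qed

lemma W'_invariants_value:
  fixes g :: "(hvar, 'k::comm_ring_1) mpoly"
  assumes "g \<in> W'_invariants m n" "\<sigma> permutes {1..m}" "\<tau> permutes {1..n}" "\<And>v. s v \<in> {1, -1}"
  shows "mp_value g (\<lambda>v. s v * z (hperm \<sigma> \<tau> v)) = mp_value g z"
proof -
  have "mp_subst (\<lambda>v. Const (s v) * permute_vars \<sigma> \<tau> v) g = g"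
    using assms unfolding W'_invariants_def by blast
  then have "mp_value g z = mp_value (mp_subst (\<lambda>v. Const (s v) * permute_vars \<sigma> \<tau> v) g) z" by simp
  also have "\<dots> = mp_value g (\<lambda>v. s v * mp_value (permute_vars \<sigma> \<tau> v) z)"
    by (simp add: value_subst value_hom)
  also have "(\<lambda>v. s v * mp_value (permute_vars \<sigma> \<tau> v) z) = (\<lambda>v. s v * z (hperm \<sigma> \<tau> v))"
  proof
    show "s v * mp_value (permute_vars \<sigma> \<tau> v) z = s v * z (hperm \<sigma> \<tau> v)" for v
      by (cases v) (simp_all add: value_hom)
  qed
  finally show ?thesis by simp
qed

text \<open>The sign changes make an invariant even in each variable, hence a function of the
  squares; the permutation symmetry of that function is tested on square roots of the
  coordinates.\<close>

lemma W'_invariants_symalg: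
  fixes g :: "(hvar, 'k::{alg_closed_field, field_char_0}) mpoly"
  assumes g: "g \<in> W'_invariants m n"
  obtains G where "G \<in> symalg (Hs m) (Hs' n)" "\<And>z. mp_value g z = G (\<lambda>v. z v ^ 2)"
proof -
  let ?V = "Hs m \<union> Hs' n"
  have hperm_id: "hperm id id v = v" for v by (cases v) simp_all
  have "mp_value g \<in> polyfun ?V"
    using g unfolding W'_invariants_def S_h_eq mpoly_in_iff by blast
  moreover have "mp_value g (z(v := - z v)) = mp_value g z" for v z
  proof -
    have "(\<lambda>x. (if x = v then - 1 else 1) * z (hperm id id x)) = z(v := - z v)"
      by (auto simp: fun_eq_iff hperm_id)
    then show ?thesis
      using W'_invariants_value[OF g permutes_id permutes_id, of "\<lambda>x. if x = v then - 1 else 1" z] by simp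
  qed
  ultimately obtain A where A: "A \<in> polyfun ?V"
    "\<forall>z. mp_value g z = A (\<lambda>x. if x \<in> ?V then z x ^ 2 else z x)"
    using polyfun_even[of "mp_value g" ?V ?V] by blast
  have A2: "mp_value g z = A (\<lambda>x. z x ^ 2)" for z
    unfolding A(2)[rule_format, of z] by (rule polyfun_cong[OF A(1)]) simp
  have "A (z \<circ> \<pi>) = A z" if \<pi>: "\<pi> \<in> block_perms (Hs m) (Hs' n)" for \<pi> z
  proof -
    obtain \<sigma> \<tau> where \<pi>: "\<sigma> permutes {1..m}" "\<tau> permutes {1..n}" "\<pi> = hperm \<sigma> \<tau>"
      by (rule block_perms_hperm[OF \<pi>])
    obtain w where w: "\<forall>x. w x ^ 2 = z x" using square_roots[of z] by blast
    have "A (z \<circ> \<pi>) = mp_value g (w \<circ> \<pi>)" unfolding A2 by (simp add: w o_def)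
    also have "\<dots> = mp_value g w"
      using W'_invariants_value[OF g \<pi>(1,2), of "\<lambda>_. 1" w] by (simp add: \<pi>(3) o_def)
    also have "\<dots> = A z" unfolding A2 by (simp add: w)
    finally show ?thesis .
  qed
  then have "A \<in> symalg (Hs m) (Hs' n)" using A(1) by (simp add: symalg_def)
  then show ?thesis using that A2 by blast
qed

section \<open>Norms and common zeros for osp(2m,2n)\<close>

lemma flip_1: "flip 1 z = z"
  by (auto simp: flip_def fun_eq_iff split: hvar.splits)

lemma value_\<Phi>:
  "mp_value (\<Phi> m n) z = (\<Prod>i=1..m. z (H i)) * crossdiff (Hs m) (Hs' n) (\<lambda>v. z v ^ 2)"
proof -
  have "crossdiff (Hs m) (Hs' n) (\<lambda>v. z v ^ 2) = (\<Prod>i=1..m. \<Prod>j=1..n. z (H i) ^ 2 - z (H' j) ^ 2)"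
    unfolding crossdiff_def by (simp add: prod.reindex inj_on_def)
  then show ?thesis by (simp add: \<Phi>_def value_hom)
qed

lemma prod_Hs_symalg: "(\<lambda>z. \<Prod>i\<in>Hs m. z i) \<in> symalg (Hs m) (Hs' n)"
  unfolding symalg_def
proof (intro CollectI conjI ballI allI)
  show "(\<lambda>z. \<Prod>i\<in>Hs m. z i) \<in> polyfun (Hs m \<union> Hs' n)" by (intro polyfun_prod polyfun.var) simp
  show "(\<Prod>i\<in>Hs m. (z \<circ> \<pi>) i) = (\<Prod>i\<in>Hs m. z i)" if "\<pi> \<in> block_perms (Hs m) (Hs' n)" for \<pi> and z :: "hvar \<Rightarrow> 'a"
    using prod.reindex_bij_betw[OF block_perms_bij(1)[OF that], of z] by simp
qed

text \<open>\<open>sq k\<close> is the norm of \<open>f + \<Phi> g\<close> with respect to the sign change \<open>\<Phi> \<mapsto> - \<Phi>\<close>.\<close>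

lemma osp_even_norm:
  fixes f g :: "(hvar, 'k::{alg_closed_field, field_char_0}) mpoly"
  assumes f: "f \<in> J_h m n" and g: "g \<in> W'_invariants m n"
  obtains k where "k \<in> symmetric_polys 1 m n" "sq k = (f + \<Phi> m n * g) * (f - \<Phi> m n * g)"
proof -
  let ?U = "Hs m" and ?W = "Hs' n"
  obtain f0 where f0: "f0 \<in> symmetric_polys 1 m n" "f = sq f0" using f unfolding J_h_eq by blast
  obtain G where G: "G \<in> symalg ?U ?W" "\<And>z. mp_value g z = G (\<lambda>v. z v ^ 2)"
    using W'_invariants_symalg[OF g] by blast
  \<comment> \<open>In terms of the squares, the square of \<open>\<Phi> m n * g\<close> is the
    product of the \<open>z i\<close>, times \<open>crossdiff\<close> squared, times
    \<open>G\<close> squared. One factor \<open>crossdiff\<close> is kept apart, so that symmetry of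
    the remaining factor \<open>R\<close> suffices for supersymmetry.\<close>
  define R :: "(hvar \<Rightarrow> 'k) \<Rightarrow> 'k" where "R = (\<lambda>z. (\<Prod>i\<in>?U. z i) * (crossdiff ?U ?W z * (G z * G z)))"
  define K where "K = (\<lambda>z. mp_value f0 z * mp_value f0 z - crossdiff ?U ?W z * R z)"
  have "R \<in> symalg ?U ?W"
    unfolding R_def by (intro symalg_intros prod_Hs_symalg crossdiff_symalg G(1))
  moreover have "mp_value f0 \<in> supersym ?U ?W"
    using f0(1) symmetric_polys_iff[of 1 f0 m n] by (simp add: flip_1)
  ultimately have "K \<in> supersym ?U ?W"
    unfolding K_def by (intro supersym_intros crossdiff_mult_supersym Hs_disjoint) simp_all
  then obtain k where k: "k \<in> symmetric_polys 1 m n" "\<And>z. mp_value k z = K z"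
    using symmetric_polys_exists[of 1 K m n] by (auto simp: flip_1)
  have "sq k = (f + \<Phi> m n * g) * (f - \<Phi> m n * g)"
  proof (rule mp_value_inject)
    fix z :: "hvar \<Rightarrow> 'k"
    let ?z = "\<lambda>v. z v ^ 2"
    have "(\<Prod>i\<in>?U. ?z i) = (\<Prod>i=1..m. z (H i)) ^ 2"
      by (simp add: prod.reindex inj_on_def prod_power_distrib)
    then have "mp_value (sq k) z = mp_value f0 ?z * mp_value f0 ?z
        - ((\<Prod>i=1..m. z (H i)) * crossdiff ?U ?W ?z * G ?z) ^ 2"
      unfolding value_sq k(2) K_def R_def by (simp add: power2_eq_square mult_ac)
    also have "\<dots> = (mp_value f z + mp_value (\<Phi> m n) z * mp_value g z) * (mp_value f z - mp_value (\<Phi> m n) z * mp_value g z)"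
      unfolding f0(2) value_sq value_\<Phi> G(2) by (simp add: power2_eq_square algebra_simps)
    finally show "mp_value (sq k) z = mp_value ((f + \<Phi> m n * g) * (f - \<Phi> m n * g)) z"
      by (simp add: value_hom)
  qed
  with k(1) show ?thesis by (rule that)
qed

lemma W'_invariants_uminus:
  "g \<in> W'_invariants m n \<Longrightarrow> - g \<in> W'_invariants m n"
  unfolding W'_invariants_def S_h_def
  by (auto simp: is_homD(5)[OF is_hom_subst] in_keys_iff)

lemma osp_even_common_zero:
  fixes M :: "(hvar, 'k::{alg_closed_field, field_char_0}) mpoly set"
  assumes B: "subring1 (I_osp_even m n :: (hvar, 'k) mpoly set)"
    and M: "ideal_of (I_osp_even m n) M" "1 \<notin> M"
  shows "\<exists>\<mu>. \<forall>f\<in>M. mp_value f \<mu> = 0"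
proof -
  note MI = ideal_ofD[OF M(1) B]
  have sym1: "(\<lambda>z. mp_value k z) \<in> supersym (Hs m) (Hs' n) \<longleftrightarrow> k \<in> symmetric_polys 1 m n" for k :: "(hvar, 'k) mpoly"
    using symmetric_polys_iff[of 1 k m n] by (simp add: flip_1)
  have W0: "0 \<in> W'_invariants m n"
    by (simp add: W'_invariants_def S_h_def is_homD(4)[OF is_hom_subst])
  have "J_h m n \<subseteq> I_osp_even m n"
  proof
    fix f assume "f \<in> J_h m n"
    then have "f + \<Phi> m n * 0 \<in> I_osp_even m n" unfolding I_osp_even_def using W0 by blast
    then show "f \<in> I_osp_even m n" by simp
  qed
  then obtain \<mu> where \<mu>: "\<And>g. g \<in> symmetric_polys 1 m n \<Longrightarrow> sq g \<in> M \<Longrightarrow> mp_value (sq g) \<mu> = 0"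
    using ideal_common_zero_on_J_h[OF B _ M] by blast
  have rep: "\<exists>f g. f \<in> J_h m n \<and> g \<in> W'_invariants m n \<and> h = f + \<Phi> m n * g" if "h \<in> M" for h
    using that MI(1) unfolding I_osp_even_def by blast
  show ?thesis
  proof (cases "m = 0")
    \<comment> \<open>Here \<open>\<Phi>\<close> is 1 and there is no sign to change. With an empty
      block every symmetric function is supersymmetric, so each \<open>h\<close> in \<open>M\<close>
      is itself some \<open>sq k\<close>.\<close>
    case True
    have "mp_value h \<mu> = 0" if h: "h \<in> M" for h
    proof -
      obtain f g where fg: "f \<in> J_h m n" "g \<in> W'_invariants m n" "h = f + \<Phi> m n * g" using rep[OF h] by blast
      obtain f0 where f0: "f0 \<in> symmetric_polys 1 m n" "f = sq f0" using fg(1) unfolding J_h_eq by blast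
      obtain G where G: "G \<in> symalg (Hs m) (Hs' n)" "\<And>z. mp_value g z = G (\<lambda>v. z v ^ 2)"
        using W'_invariants_symalg[OF fg(2)] by blast
      have "G \<in> supersym (Hs m) (Hs' n)" using G(1) True by (simp add: supersym_def)
      moreover have "(\<lambda>z. mp_value f0 z) \<in> supersym (Hs m) (Hs' n)" using f0(1) sym1 by blast
      ultimately have "(\<lambda>z. mp_value f0 z + G z) \<in> supersym (Hs m) (Hs' n)" by (intro supersym_intros)
      then obtain k where k: "k \<in> symmetric_polys 1 m n" "\<And>z. mp_value k z = mp_value f0 z + G z"
        using symmetric_polys_exists[of 1 "\<lambda>z. mp_value f0 z + G z" m n] by (auto simp: flip_1)
      have "sq k = h"
        by (rule mp_value_inject) (simp add: value_sq k(2) fg(3) f0(2) value_hom G(2) \<Phi>_def True)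
      then show ?thesis using \<mu>[OF k(1)] h by simp
    qed
    then show ?thesis by blast
  next
    case False
    \<comment> \<open>Changing one sign negates \<open>\<Phi>\<close> and fixes all squares, so it
      exchanges the values of the two factors of the norm.\<close>
    let ?\<mu> = "\<mu>(H 1 := - \<mu> (H 1))"
    have sq_eq: "(\<lambda>v. ?\<mu> v ^ 2) = (\<lambda>v. \<mu> v ^ 2)" by (auto simp: fun_eq_iff)
    have \<Phi>: "mp_value (\<Phi> m n) ?\<mu> = - mp_value (\<Phi> m n) \<mu>"
    proof -
      have "(\<Prod>i=1..m. ?\<mu> (H i)) = - \<mu> (H 1) * (\<Prod>i\<in>{1..m} - {1}. \<mu> (H i))"
        using False by (subst prod.remove[of _ 1]) simp_all
      also have "\<dots> = - (\<Prod>i=1..m. \<mu> (H i))"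
        using False prod.remove[of "{1..m}" 1 "\<lambda>i. \<mu> (H i)"] by simp
      finally show ?thesis unfolding value_\<Phi> sq_eq by simp
    qed
    have alt: "mp_value h \<mu> = 0 \<or> mp_value h ?\<mu> = 0" if h: "h \<in> M" for h
    proof -
      obtain f g where fg: "f \<in> J_h m n" "g \<in> W'_invariants m n" "h = f + \<Phi> m n * g" using rep[OF h] by blast
      obtain k where k: "k \<in> symmetric_polys 1 m n" "sq k = (f + \<Phi> m n * g) * (f - \<Phi> m n * g)"
        using osp_even_norm[OF fg(1,2)] by blast
      have "f + \<Phi> m n * (- g) \<in> I_osp_even m n"
        unfolding I_osp_even_def using fg(1) W'_invariants_uminus[OF fg(2)] by blast
      then have "f - \<Phi> m n * g \<in> I_osp_even m n" by simp
      then have "sq k \<in> M" unfolding k(2) fg(3)[symmetric] by (rule MI(5)[OF h])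
      then have "mp_value h \<mu> * mp_value (f - \<Phi> m n * g) \<mu> = 0"
        using \<mu>[OF k(1)] unfolding k(2) fg(3)[symmetric] by (simp add: value_hom)
      moreover have "mp_value h ?\<mu> = mp_value (f - \<Phi> m n * g) \<mu>"
      proof -
        obtain f0 where f0: "f = sq f0" using fg(1) unfolding J_h_eq by blast
        obtain G where G: "\<And>z. mp_value g z = G (\<lambda>v. z v ^ 2)"
          using W'_invariants_symalg[OF fg(2)] by blast
        show ?thesis
          unfolding fg(3) f0 value_hom value_sq G sq_eq \<Phi> by simp
      qed
      ultimately show ?thesis by auto
    qed
    \<comment> \<open>The elements of \<open>M\<close> vanishing at either point form two subgroups
      that cover \<open>M\<close>, and a group is not the union of two proper subgroups.\<close>
    have "(\<forall>h\<in>M. mp_value h \<mu> = 0) \<or> (\<forall>h\<in>M. mp_value h ?\<mu> = 0)"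
    proof (rule ccontr)
      assume "\<not> ?thesis"
      then obtain h1 h2 where h: "h1 \<in> M" "mp_value h1 \<mu> \<noteq> 0" "h2 \<in> M" "mp_value h2 ?\<mu> \<noteq> 0" by blast
      then have "mp_value h1 ?\<mu> = 0" "mp_value h2 \<mu> = 0" using alt by blast+
      moreover have "mp_value (h1 + h2) \<mu> = 0 \<or> mp_value (h1 + h2) ?\<mu> = 0"
        by (rule alt[OF MI(3)[OF h(1,3)]])
      ultimately show False using h(2,4) by (simp add: value_hom del: fun_upd_apply)
    qed
    then show ?thesis by blast
  qed
qed

section \<open>Maximal ideals\<close>

lemma ring_ideal_subset:
  fixes A :: "'r::comm_ring_1 set"
  assumes "ideal M (ring_of_type_algebra\<lparr>carrier := A\<rparr>)"
  shows "subring1 A" "ideal_of A M"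
proof -
  let ?R = "ring_of_type_algebra\<lparr>carrier := A\<rparr>"
  interpret ideal M ?R by fact
  have sel: "carrier ?R = A" "add ?R = (+)" "monoid.mult ?R = (*)" "ring.zero ?R = 0" "monoid.one ?R = 1"
    by (simp_all add: ring_of_type_algebra_def)
  have closed: "0 \<in> A" "1 \<in> A" using zero_closed one_closed unfolding sel .
  have add: "a + b \<in> A" if "a \<in> A" "b \<in> A" for a b
    using add.m_closed[of a b] that unfolding sel by simp
  have mult: "a * b \<in> A" if "a \<in> A" "b \<in> A" for a b
    using m_closed[of a b] that unfolding sel by simp
  have neg: "- b \<in> A" if b: "b \<in> A" for b
  proof -
    have "a_inv ?R b \<in> A" using a_inv_closed[of b] b unfolding sel by simp
    moreover have "a_inv ?R b + b = 0" using l_neg[of b] b unfolding sel by simp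
    then have "a_inv ?R b = - b" by (simp add: eq_neg_iff_add_eq_0)
    ultimately show ?thesis by simp
  qed
  have "a - b \<in> A" if "a \<in> A" "b \<in> A" for a b
    using add[OF that(1) neg[OF that(2)]] by simp
  then show "subring1 A" unfolding subring1_def by (intro conjI ballI closed add mult)
  have "M \<subseteq> A" using a_subset unfolding sel .
  moreover have "0 \<in> M" using additive_subgroup.zero_closed[OF is_additive_subgroup] unfolding sel .
  moreover have "a + b \<in> M" if "a \<in> M" "b \<in> M" for a b
    using additive_subgroup.a_closed[OF is_additive_subgroup that] unfolding sel .
  moreover have "a * b \<in> M" if "a \<in> M" "b \<in> A" for a b
    using I_r_closed[of a b] that unfolding sel by simp
  ultimately show "ideal_of A M" unfolding ideal_of_def by (intro conjI ballI)
qed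

lemma ideal_of_imp_ideal:
  fixes A :: "'r::comm_ring_1 set"
  assumes R: "ring (ring_of_type_algebra\<lparr>carrier := A\<rparr>)" and A: "subring1 A" and T: "ideal_of A T"
  shows "ideal T (ring_of_type_algebra\<lparr>carrier := A\<rparr>)"
proof -
  let ?R = "ring_of_type_algebra\<lparr>carrier := A\<rparr>"
  interpret ring ?R by fact
  have sel: "carrier ?R = A" "add ?R = (+)" "monoid.mult ?R = (*)" "ring.zero ?R = 0" "monoid.one ?R = 1"
    by (simp_all add: ring_of_type_algebra_def)
  note TI = ideal_ofD[OF T A]
  show ?thesis
  proof (rule idealI[OF R])
    show "subgroup T (add_monoid ?R)"
    proof (rule add.subgroupI)
      show "T \<subseteq> carrier ?R" "T \<noteq> {}" using TI(1,2) unfolding sel by blast+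
      show "a \<oplus>\<^bsub>?R\<^esub> b \<in> T" if "a \<in> T" "b \<in> T" for a b
        using TI(3)[OF that] unfolding sel .
      fix a assume a: "a \<in> T"
      then have "a \<in> A" using TI(1) by blast
      then have "a_inv ?R a + a = 0" using l_neg[of a] unfolding sel by simp
      then have "a_inv ?R a = 0 - a" by (simp add: eq_neg_iff_add_eq_0)
      then show "\<ominus>\<^bsub>?R\<^esub> a \<in> T" using TI(4)[OF TI(2) a] by simp
    qed
  qed (use TI(5,6) in \<open>simp_all add: sel del: ring.simps\<close>)
qed

text \<open>The functions in \<open>A\<close> vanishing at the point form an ideal that contains
  \<open>M\<close> and omits 1, so maximality leaves only equality.\<close>

lemma maximal_ideal_eq_vanishing_ideal:
  fixes A :: "('v, 'k::field_char_0) mpoly set"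
  assumes M: "maximalideal M (ring_of_type_algebra\<lparr>carrier := A\<rparr>)"
    and vanish: "\<And>f. f \<in> M \<Longrightarrow> mp_value f \<mu> = 0"
  shows "M = {f \<in> A. mp_value f \<mu> = 0}"
proof -
  let ?R = "ring_of_type_algebra\<lparr>carrier := A\<rparr>" and ?T = "{f \<in> A. mp_value f \<mu> = 0}"
  interpret maximalideal M ?R by fact
  note facts = ring_ideal_subset[OF is_ideal]
  have carr: "carrier ?R = A" by simp
  have "ideal_of A ?T"
    unfolding ideal_of_def
  proof (intro conjI ballI)
    show "?T \<subseteq> A" by blast
    show "0 \<in> ?T" using subring1D(1)[OF facts(1)] by (simp add: value_hom)
    show "f + g \<in> ?T" if "f \<in> ?T" "g \<in> ?T" for f g
      using that subring1D(3)[OF facts(1), of f g] by (simp add: value_hom)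
    show "f * g \<in> ?T" if "f \<in> ?T" "g \<in> A" for f g
      using that subring1D(5)[OF facts(1), of f g] by (simp add: value_hom)
  qed
  then have T: "ideal ?T ?R" by (rule ideal_of_imp_ideal[OF ring_axioms facts(1)])
  have MT: "M \<subseteq> ?T"
  proof
    fix f assume "f \<in> M"
    then show "f \<in> ?T" using ideal_ofD(1)[OF facts(2,1)] vanish[of f] by blast
  qed
  have "?T \<subseteq> carrier ?R" unfolding carr by (rule Collect_restrict)
  with T MT have alt: "?T = M \<or> ?T = carrier ?R" by (rule I_maximal)
  have "1 \<notin> ?T" by (simp add: value_hom)
  then have neq: "?T \<noteq> A" using subring1D(2)[OF facts(1)] by metis
  from alt show ?thesis
  proof
    assume "?T = M"
    then show ?thesis by (rule sym)
  next
    assume "?T = carrier ?R"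
    then have "?T = A" unfolding carr .
    with neq show ?thesis by (rule notE)
  qed
qed

text \<open>Needed to cut a common zero down to the coordinates in \<open>hvars m n\<close>, as
  membership in \<open>dual_cartan\<close> demands: the values of elements of I(h) do not depend on
  any others.\<close>

lemma I_h_polyfun:
  fixes f :: "(hvar, 'k::{alg_closed_field, field_char_0}) mpoly"
  assumes "f \<in> I_h \<gg> m n"
  shows "mp_value f \<in> polyfun (hvars m n)"
proof -
  have V: "hvars m n = Hs m \<union> Hs' n" by (simp add: hvars_def)
  have J: "mp_value f \<in> polyfun (Hs m \<union> Hs' n)" if f: "f \<in> J_h m n" for f :: "(hvar, 'k) mpoly"
  proof -
    obtain g where g: "g \<in> symmetric_polys 1 m n" "f = sq g" using f unfolding J_h_eq by blast
    have "mp_value g \<in> polyfun (Hs m \<union> Hs' n)"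
      using g(1) unfolding symmetric_polys_def S_h_eq mpoly_in_iff by blast
    then have "(\<lambda>z. mp_value g (\<lambda>v. z v ^ 2)) \<in> polyfun (Hs m \<union> Hs' n)"
      by (rule polyfun_subst) (intro polyfun_power polyfun.var)
    then show ?thesis unfolding g(2) value_sq[abs_def] .
  qed
  show ?thesis
  proof (cases \<gg>)
    case GL
    then show ?thesis using assms unfolding V by (simp add: I_gl_def S_h_eq mpoly_in_iff)
  next
    case OSP_odd
    then show ?thesis using assms J unfolding V by simp
  next
    case OSP_even
    then obtain h g where hg: "h \<in> J_h m n" "g \<in> W'_invariants m n" "f = h + \<Phi> m n * g"
      using assms I_osp_even_def[of m n] by (simp only: I_h.simps) blast
    have "mp_value g \<in> polyfun (Hs m \<union> Hs' n)"
      using hg(2) unfolding W'_invariants_def S_h_eq mpoly_in_iff by blast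
    moreover have "mp_value (\<Phi> m n) \<in> polyfun (Hs m \<union> Hs' n)"
    proof -
      have "(\<lambda>z. (\<Prod>i=1..m. z (H i)) * crossdiff (Hs m) (Hs' n) (\<lambda>v. z v ^ 2)) \<in> polyfun (Hs m \<union> Hs' n)"
        by (intro polyfun.mult polyfun_prod polyfun_subst[OF symalgD(1)[OF crossdiff_symalg]] polyfun_power polyfun.var) auto
      then show ?thesis unfolding value_\<Phi>[abs_def] .
    qed
    ultimately have "(\<lambda>z. mp_value h z + mp_value (\<Phi> m n) z * mp_value g z) \<in> polyfun (Hs m \<union> Hs' n)"
      by (intro polyfun.add polyfun.mult J[OF hg(1)])
    then show ?thesis unfolding V hg(3) by (simp add: value_hom)
  qed
qed

theorem mainTheorem5:
  fixes \<gg> :: superalgebra_type and m n :: nat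
    and M :: "(hvar, 'k::{alg_closed_field, field_char_0}) mpoly set"
  assumes "maximalideal M (I_ring \<gg> m n)"
  shows "\<exists>\<mu>\<in>dual_cartan m n. M = {f \<in> I_h \<gg> m n. mp_value f \<mu> = 0}"
proof -
  let ?A = "I_h \<gg> m n :: (hvar, 'k) mpoly set"
  have max: "maximalideal M (ring_of_type_algebra\<lparr>carrier := ?A\<rparr>)"
    using assms by (simp add: I_ring_def)
  then have "ideal M (ring_of_type_algebra\<lparr>carrier := ?A\<rparr>)" by (rule maximalideal.axioms)
  note facts = ring_ideal_subset[OF this]
  have "M \<noteq> ?A" using maximalideal.I_notcarr[OF max] by auto
  have 1: "1 \<notin> M"
  proof
    assume "1 \<in> M"
    then have "f \<in> M" if "f \<in> ?A" for f
      using ideal_ofD(5)[OF facts(2,1) _ that, of 1] by simp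
    then show False using \<open>M \<noteq> ?A\<close> ideal_ofD(1)[OF facts(2,1)] by blast
  qed
  have "\<exists>\<mu>. \<forall>f\<in>M. mp_value f \<mu> = 0"
  proof (cases \<gg>)
    case GL
    then have "?A = symmetric_polys (-1) m n" by (simp add: I_gl_def symmetric_polys_def)
    then show ?thesis using facts(2) 1 by (intro symmetric_polys_common_zero[of "-1" m n]) simp_all
  next
    case OSP_odd
    then have A: "?A = J_h m n" by simp
    obtain \<mu> where \<mu>: "\<forall>g\<in>symmetric_polys 1 m n. sq g \<in> M \<longrightarrow> mp_value (sq g) \<mu> = 0"
      using ideal_common_zero_on_J_h[OF facts(1) _ facts(2) 1, of m n] A by blast
    have "mp_value f \<mu> = 0" if "f \<in> M" for f
    proof -
      have "f \<in> J_h m n" using that ideal_ofD(1)[OF facts(2,1)] A by blast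
      then show ?thesis using \<mu> that unfolding J_h_eq by blast
    qed
    then show ?thesis by blast
  next
    case OSP_even
    then have A: "?A = I_osp_even m n" by simp
    show ?thesis by (rule osp_even_common_zero[OF facts[unfolded A] 1])
  qed
  then obtain \<mu> where \<mu>: "\<And>f. f \<in> M \<Longrightarrow> mp_value f \<mu> = 0" by blast
  let ?\<nu> = "restrict \<mu> (hvars m n)"
  have "mp_value f ?\<nu> = mp_value f \<mu>" if "f \<in> ?A" for f
    by (rule polyfun_cong[OF I_h_polyfun[OF that]]) simp
  then have "M = {f \<in> ?A. mp_value f ?\<nu> = 0}"
    using maximal_ideal_eq_vanishing_ideal[OF max \<mu>] by auto
  moreover have "?\<nu> \<in> dual_cartan m n" by (simp add: dual_cartan_def)
  ultimately show ?thesis by blast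
qed

end
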